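(* There is a universal constant $C>0$ such that the following holds. Let $\varepsilon\in(0,1)$, let $\eta=(1+\varepsilon)\sqrt2/2$, and let $\Gamma=A^\eta$ or $\Gamma=O^\eta$, where $$A^\eta=\{(\eta\theta\cos 2\pi\theta,\eta\theta\sin 2\pi\theta):\theta\geq 0\},\qquad O^\eta=\{(x,y)\in\mathbb{R}^2: x^2+y^2=\eta^2k^2 \text{ for some } k\in\{1,2,3,\dots\}\}.$$ Then for every integer $N\geq 1$, with $J=C\ln(\varepsilon^{-1}N)$, $$A(\Gamma,\Sigma_{N,J})\leq C\,N^{-1/6}\,\varepsilon^{-1}\ln^4(CN).$$
   Context: The Fourier transform is $\hat f(\xi)=\int e^{-2\pi i\xi\cdot x}f(x)\,dx$; functions on $[-1/2,1/2]^2$ are extended by zero to $\mathbb{R}^2$. Let $h^0=\chi_{[0,1)}$ and $h^1=\chi_{[0,1/2)}-\chi_{[1/2,1)}$. The Haar wavelets on $[-1/2,1/2]^2$ are $$h^e_{j,k}(x)=2^{j/2}h^{e_1}(2^j(x_1+1/2)-k_1)\;2^{j/2}h^{e_2}(2^j(x_2+1/2)-k_2),$$ for integers $j\geq0$, $k=(k_1,k_2)\in\mathbb{Z}^2\cap 2^j[0,1)^2$ and $e=(e_1,e_2)\in\{0,1\}^2\setminus\{(0,0)\}$. For an integer $N\geq1$ and real $J\geq 0$, $\Sigma_{N,J}$ is the set of all functions $\sum_{(j,k,e)\in F}c^e_{j,k}h^e_{j,k}$ with $c^e_{j,k}\in\mathbb{C}$ and $F$ a set of at most $N$ admissible triples $(j,k,e)$,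 all satisfying $0\leq j\leq J$. With $\mu_\Gamma$ the restriction of the one-dimensional Hausdorff measure $\mathcal{H}^1$ to $\Gamma$, the stability margin is $$A(\Gamma,\Sigma_{N,J})=\inf\{\|\hat f\|_{L^2(\mu_\Gamma)}: f\in\Sigma_{N,J},\ \|f\|_2=1\}.$$ *)

theory Defs
  imports "HOL-Analysis.Analysis"
begin

text \<open>
  One-dimensional Hausdorff measure, normalised so that each covering set contributes its
  diameter (on rectifiable curves this is arc length). The boundedness condition is needed because
  the library's diameter is unspecified on unbounded sets.
\<close>

definition hausdorff1_pre :: "real \<Rightarrow> 'a::metric_space set \<Rightarrow> ennreal" where
  "hausdorff1_pre \<delta> E =
     (INF U\<in>{U :: nat \<Rightarrow> 'a set. (\<forall>i. bounded (U i) \<and> diameter (U i) \<le> \<delta>) \<and> E \<subseteq> (\<Union>i. U i)}.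
        \<Sum>i. ennreal (diameter (U i)))"

definition hausdorff1_outer :: "'a::metric_space set \<Rightarrow> ennreal" where
  "hausdorff1_outer E = (SUP \<delta>\<in>{0<..}. hausdorff1_pre \<delta> E)"

definition hausdorff1 :: "'a::metric_space measure" where
  "hausdorff1 = measure_of UNIV (sets borel) hausdorff1_outer"

text \<open>
  The library constructor \<^const>\<open>measure_of\<close> returns the zero measure when its argument is
  not countably additive, so we check that \<^const>\<open>hausdorff1_outer\<close> is a metric outer
  measure and hence a measure on the Borel sets.
\<close>

lemma hausdorff1_pre_le:
  assumes "\<And>i. bounded (U i)" "\<And>i. diameter (U i) \<le> \<delta>" "E \<subseteq> (\<Union>i. U i)"
  shows "hausdorff1_pre \<delta> E \<le> (\<Sum>i. ennreal (diameter (U i)))"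
  unfolding hausdorff1_pre_def using assms by (intro INF_lower) auto

lemma hausdorff1_pre_mono: "E \<subseteq> F \<Longrightarrow> hausdorff1_pre \<delta> E \<le> hausdorff1_pre \<delta> F"
  unfolding hausdorff1_pre_def by (intro INF_superset_mono) auto

lemma hausdorff1_pre_antimono: "\<delta> \<le> \<delta>' \<Longrightarrow> hausdorff1_pre \<delta>' E \<le> hausdorff1_pre \<delta> E"
  unfolding hausdorff1_pre_def by (intro INF_superset_mono) (auto intro: order_trans)

lemma hausdorff1_pre_le_outer: "0 < \<delta> \<Longrightarrow> hausdorff1_pre \<delta> E \<le> hausdorff1_outer E"
  unfolding hausdorff1_outer_def by (intro SUP_upper) auto

lemma hausdorff1_outer_mono: "E \<subseteq> F \<Longrightarrow> hausdorff1_outer E \<le> hausdorff1_outer F"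
  unfolding hausdorff1_outer_def by (intro SUP_mono) (auto intro: hausdorff1_pre_mono)

lemma hausdorff1_outer_empty [simp]: "hausdorff1_outer {} = 0"
proof -
  have "hausdorff1_pre \<delta> ({} :: 'a set) \<le> 0" if "0 < \<delta>" for \<delta>
    using hausdorff1_pre_le[of "\<lambda>_. {} :: 'a set" \<delta> "{}"] that by simp
  then show ?thesis
    unfolding hausdorff1_outer_def by (simp add: SUP_eq_iff)
qed

lemma hausdorff1_pre_UN_le:
  fixes A :: "nat \<Rightarrow> 'a::metric_space set"
  shows "hausdorff1_pre \<delta> (\<Union>i. A i) \<le> (\<Sum>i. hausdorff1_pre \<delta> (A i))"
proof (rule ennreal_le_epsilon)
  fix e :: real assume "0 < e" and "(\<Sum>n. hausdorff1_pre \<delta> (A n)) < top"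
  then have less: "hausdorff1_pre \<delta> (A n) < hausdorff1_pre \<delta> (A n) + e * (1/2)^Suc n" for n
    by (auto simp add: less_top dest!: ennreal_suminf_lessD)
  have "\<exists>U. (\<forall>i. bounded (U i) \<and> diameter (U i) \<le> \<delta>) \<and> A n \<subseteq> (\<Union>i. U i) \<and>
      (\<Sum>i. ennreal (diameter (U i))) \<le> hausdorff1_pre \<delta> (A n) + e * (1/2)^Suc n" for n
    using less[of n] unfolding hausdorff1_pre_def[of \<delta> "A n"] INF_less_iff
    by (auto intro: less_imp_le)
  then obtain B :: "nat \<Rightarrow> nat \<Rightarrow> 'a set" where
    B: "\<And>n i. bounded (B n i)" "\<And>n i. diameter (B n i) \<le> \<delta>" "\<And>n. A n \<subseteq> (\<Union>i. B n i)"
    and Ble: "\<And>n. (\<Sum>i. ennreal (diameter (B n i))) \<le> hausdorff1_pre \<delta> (A n) + e * (1/2)^Suc n"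
    by metis
  define C where "C = case_prod B \<circ> prod_decode"
  have A_C: "(\<Union>i. A i) \<subseteq> (\<Union>i. C i)"
    using B(3) by (auto simp add: C_def subset_eq) (metis prod.case prod_encode_inverse)
  have "hausdorff1_pre \<delta> (\<Union>i. A i) \<le> (\<Sum>i. ennreal (diameter (C i)))"
    using A_C B by (intro hausdorff1_pre_le) (auto simp: C_def split: prod.split)
  also have "\<dots> = (\<Sum>i. (\<lambda>(n, i). ennreal (diameter (B n i))) (prod_decode i))"
    by (simp add: C_def split_def)
  also have "\<dots> = (\<Sum>n. \<Sum>i. ennreal (diameter (B n i)))"
    by (intro suminf_ennreal_2dimen) auto
  also have "\<dots> \<le> (\<Sum>n. hausdorff1_pre \<delta> (A n) + e * (1/2) ^ Suc n)"
    by (intro suminf_le allI Ble) auto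
  also have "\<dots> = (\<Sum>n. hausdorff1_pre \<delta> (A n)) + (\<Sum>n. ennreal e * ennreal ((1/2) ^ Suc n))"
    using \<open>0 < e\<close> by (subst suminf_add[symmetric])
      (auto simp del: ennreal_suminf_cmult simp add: ennreal_mult[symmetric])
  also have "\<dots> = (\<Sum>n. hausdorff1_pre \<delta> (A n)) + e"
    unfolding ennreal_suminf_cmult
    by (subst suminf_ennreal_eq[OF zero_le_power power_half_series]) auto
  finally show "hausdorff1_pre \<delta> (\<Union>i. A i) \<le> (\<Sum>n. hausdorff1_pre \<delta> (A n)) + e" .
qed

lemma hausdorff1_outer_UN_le:
  fixes A :: "nat \<Rightarrow> 'a::metric_space set"
  shows "hausdorff1_outer (\<Union>i. A i) \<le> (\<Sum>i. hausdorff1_outer (A i))"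
proof -
  have "hausdorff1_pre \<delta> (\<Union>i. A i) \<le> (\<Sum>i. hausdorff1_outer (A i))" if "0 < \<delta>" for \<delta>
    by (rule order_trans[OF hausdorff1_pre_UN_le])
       (intro suminf_le hausdorff1_pre_le_outer that, auto)
  then show ?thesis
    unfolding hausdorff1_outer_def[of "\<Union>i. A i"] by (intro SUP_least) auto
qed

lemma outer_measure_space_hausdorff1:
  "outer_measure_space UNIV (hausdorff1_outer :: 'a::metric_space set \<Rightarrow> ennreal)"
  unfolding outer_measure_space_def positive_def increasing_def countably_subadditive_def
  using hausdorff1_outer_UN_le by (auto intro: hausdorff1_outer_mono)

lemma hausdorff1_outer_Un_le:
  "hausdorff1_outer (A \<union> B) \<le> hausdorff1_outer A + hausdorff1_outer B"
proof -
  have U: "(\<Union>i::nat. if i = 0 then A else if i = 1 then B else {}) = A \<union> B"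
    by (auto split: if_splits)
  have "hausdorff1_outer (\<Union>i::nat. if i = 0 then A else if i = 1 then B else {})
      \<le> (\<Sum>i. hausdorff1_outer (if i = 0 then A else if i = 1 then B else {}))"
    by (rule hausdorff1_outer_UN_le)
  also have "\<dots> = hausdorff1_outer A + hausdorff1_outer B"
    by (subst suminf_finite[of "{0,1}"]) auto
  finally show ?thesis
    unfolding U .
qed

lemma hausdorff1_outer_Un_separated:
  fixes A B :: "'a::metric_space set"
  assumes "0 < d" and d: "\<And>x y. x \<in> A \<Longrightarrow> y \<in> B \<Longrightarrow> d \<le> dist x y"
  shows "hausdorff1_outer A + hausdorff1_outer B \<le> hausdorff1_outer (A \<union> B)"
proof -
  have pre: "hausdorff1_pre \<delta> A + hausdorff1_pre \<delta> B \<le> hausdorff1_pre \<delta> (A \<union> B)"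
    if "0 < \<delta>" "\<delta> < d" for \<delta>
    unfolding hausdorff1_pre_def[of \<delta> "A \<union> B"]
  proof (intro INF_greatest, clarify)
    fix U :: "nat \<Rightarrow> 'a set"
    assume U: "\<forall>i. bounded (U i) \<and> diameter (U i) \<le> \<delta>" and cov: "A \<union> B \<subseteq> (\<Union>i. U i)"
    define V where "V S i = (if U i \<inter> S = {} then {} else U i)" for S i
    have disj: "U i \<inter> A = {} \<or> U i \<inter> B = {}" for i
    proof (rule ccontr)
      assume "\<not> ?thesis"
      then obtain x y where "x \<in> U i" "x \<in> A" "y \<in> U i" "y \<in> B" by auto
      then show False
        using d[of x y] diameter_bounded_bound[of "U i" x y] U \<open>\<delta> < d\<close>
        by (meson leD le_less_trans order_trans)
    qed
    have V: "hausdorff1_pre \<delta> S \<le> (\<Sum>i. ennreal (diameter (V S i)))" if "S \<subseteq> A \<union> B" for S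
    proof (rule hausdorff1_pre_le)
      show "S \<subseteq> (\<Union>i. V S i)"
        using cov that unfolding V_def by fastforce
    qed (use U \<open>0 < \<delta>\<close> in \<open>auto simp: V_def\<close>)
    have "hausdorff1_pre \<delta> A + hausdorff1_pre \<delta> B
        \<le> (\<Sum>i. ennreal (diameter (V A i))) + (\<Sum>i. ennreal (diameter (V B i)))"
      by (intro add_mono V) auto
    also have "\<dots> = (\<Sum>i. ennreal (diameter (V A i)) + ennreal (diameter (V B i)))"
      by (rule suminf_add) auto
    also have "\<dots> \<le> (\<Sum>i. ennreal (diameter (U i)))"
    proof (intro suminf_le allI)
      fix n
      show "ennreal (diameter (V A n)) + ennreal (diameter (V B n)) \<le> ennreal (diameter (U n))"
        using disj[of n] by (auto simp: V_def)
    qed auto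
    finally show "hausdorff1_pre \<delta> A + hausdorff1_pre \<delta> B \<le> (\<Sum>i. ennreal (diameter (U i)))" .
  qed
  have "hausdorff1_outer A + hausdorff1_outer B =
      (SUP \<delta>\<in>{0<..}. hausdorff1_pre \<delta> A + hausdorff1_pre \<delta> B)"
    unfolding hausdorff1_outer_def
  proof (rule SUP_add_directed_ennreal[symmetric])
    fix i j :: real assume "i \<in> {0<..}" "j \<in> {0<..}"
    then show "\<exists>k\<in>{0<..}. hausdorff1_pre i A + hausdorff1_pre j B
        \<le> hausdorff1_pre k A + hausdorff1_pre k B"
      by (intro bexI[of _ "min i j"] add_mono hausdorff1_pre_antimono) auto
  qed
  also have "\<dots> \<le> hausdorff1_outer (A \<union> B)"
  proof (rule SUP_least)
    fix \<delta> :: real assume "\<delta> \<in> {0<..}"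
    define \<delta>' where "\<delta>' = min \<delta> (d / 2)"
    have \<delta>': "0 < \<delta>'" "\<delta>' \<le> \<delta>" "\<delta>' < d"
      using \<open>\<delta> \<in> _\<close> \<open>0 < d\<close> by (auto simp: \<delta>'_def)
    have "hausdorff1_pre \<delta> A + hausdorff1_pre \<delta> B \<le> hausdorff1_pre \<delta>' A + hausdorff1_pre \<delta>' B"
      using \<delta>' by (intro add_mono hausdorff1_pre_antimono) auto
    also have "\<dots> \<le> hausdorff1_pre \<delta>' (A \<union> B)"
      using \<delta>' by (intro pre)
    also have "\<dots> \<le> hausdorff1_outer (A \<union> B)"
      using \<delta>' by (intro hausdorff1_pre_le_outer)
    finally show "hausdorff1_pre \<delta> A + hausdorff1_pre \<delta> B \<le> hausdorff1_outer (A \<union> B)" .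
  qed
  finally show ?thesis .
qed

lemma hausdorff1_outer_sum_separated:
  fixes R :: "nat \<Rightarrow> 'a::metric_space set"
  assumes "\<And>n. \<exists>d>0. \<forall>m<n. \<forall>x\<in>R m. \<forall>y\<in>R n. d \<le> dist x y"
  shows "(\<Sum>i<n. hausdorff1_outer (R i)) \<le> hausdorff1_outer (\<Union>i<n. R i)"
proof (induction n)
  case (Suc n)
  obtain d where d: "0 < d" "\<forall>m<n. \<forall>x\<in>R m. \<forall>y\<in>R n. d \<le> dist x y"
    using assms by blast
  have "(\<Sum>i<Suc n. hausdorff1_outer (R i)) \<le> hausdorff1_outer (\<Union>i<n. R i) + hausdorff1_outer (R n)"
    using Suc by (simp add: add_right_mono)
  also have "\<dots> \<le> hausdorff1_outer ((\<Union>i<n. R i) \<union> R n)"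
    using d by (intro hausdorff1_outer_Un_separated[of d]) auto
  also have "(\<Union>i<n. R i) \<union> R n = (\<Union>i<Suc n. R i)"
    by (auto simp: lessThan_Suc)
  finally show ?case .
qed simp

lemma hausdorff1_outer_closed:
  fixes C E :: "'a::metric_space set"
  assumes "closed C"
  shows "hausdorff1_outer (E \<inter> C) + hausdorff1_outer (E - C) = hausdorff1_outer E"
proof (rule antisym)
  have "hausdorff1_outer (E \<inter> C \<union> (E - C)) \<le> hausdorff1_outer (E \<inter> C) + hausdorff1_outer (E - C)"
    by (rule hausdorff1_outer_Un_le)
  then show "hausdorff1_outer E \<le> hausdorff1_outer (E \<inter> C) + hausdorff1_outer (E - C)"
    by (simp add: Int_Diff_Un)
  show "hausdorff1_outer (E \<inter> C) + hausdorff1_outer (E - C) \<le> hausdorff1_outer E"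
  proof (cases "C = {} \<or> hausdorff1_outer E = top")
    case False
    then have "C \<noteq> {}" and fin: "hausdorff1_outer E \<noteq> top" by auto
    define r where "r n = 1 / real (Suc n)" for n
    define A where "A n = {x \<in> E. r n \<le> infdist x C}" for n
    define R where "R n = {x \<in> E. r (Suc n) \<le> infdist x C \<and> infdist x C < r n}" for n
    have r_pos: "0 < r n" for n by (simp add: r_def)
    have r_less: "r n < r m" if "m < n" for m n
      using that by (simp add: r_def frac_less2)
    have r_le: "r n \<le> r m" if "m \<le> n" for m n
      using that r_less[of m n] by (cases "m = n") auto
    have sep: "r (Suc m) - r (m + 2) \<le> dist x y" if "x \<in> R m'" "y \<in> R n" "m' \<le> m" "m + 2 \<le> n"
      for x y m m' n
    proof -
      have "r (Suc m) \<le> infdist x C"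
        using that r_le[of "Suc m'" "Suc m"] by (auto simp: R_def)
      moreover have "infdist y C < r (m + 2)"
        using that r_le[of "m + 2" n] by (auto simp: R_def)
      ultimately show ?thesis
        using infdist_triangle[of x C y] by linarith
    qed
    have half: "(\<Sum>i. hausdorff1_outer (R (2 * i + b))) \<le> hausdorff1_outer E" for b
    proof (rule suminf_le_const)
      fix n
      have "(\<Sum>i<n. hausdorff1_outer (R (2 * i + b))) \<le> hausdorff1_outer (\<Union>i<n. R (2 * i + b))"
      proof (rule hausdorff1_outer_sum_separated)
        fix n
        show "\<exists>d>0. \<forall>m<n. \<forall>x\<in>R (2 * m + b). \<forall>y\<in>R (2 * n + b). d \<le> dist x y"
        proof (cases n)
          case (Suc k)
          have "r (Suc (2 * k + b)) - r (2 * k + b + 2) \<le> dist x y"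
            if "m < n" "x \<in> R (2 * m + b)" "y \<in> R (2 * n + b)" for m x y
            using that Suc by (intro sep[of x "2 * m + b" y "2 * n + b"]) auto
          then show ?thesis
            using r_less[of "Suc (2 * k + b)" "2 * k + b + 2"]
            by (intro exI[of _ "r (Suc (2 * k + b)) - r (2 * k + b + 2)"]) auto
        qed (auto intro: exI[of _ 1])
      qed
      also have "\<dots> \<le> hausdorff1_outer E"
        by (intro hausdorff1_outer_mono) (auto simp: R_def)
      finally show "(\<Sum>i<n. hausdorff1_outer (R (2 * i + b))) \<le> hausdorff1_outer E" .
    qed auto
    have "(\<Sum>i. hausdorff1_outer (R i)) \<le> hausdorff1_outer E + hausdorff1_outer E"
    proof (rule suminf_le_const)
      fix n
      have "(\<Sum>i<n. hausdorff1_outer (R i)) \<le> (\<Sum>i<2 * n. hausdorff1_outer (R i))"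
        by (intro sum_mono2) auto
      also have "\<dots> = (\<Sum>i<n. hausdorff1_outer (R (2 * i + 0))) + (\<Sum>i<n. hausdorff1_outer (R (2 * i + 1)))"
        by (induction n) (auto simp: ac_simps)
      also have "\<dots> \<le> hausdorff1_outer E + hausdorff1_outer E"
        by (intro add_mono order_trans[OF sum_le_suminf half]) auto
      finally show "(\<Sum>i<n. hausdorff1_outer (R i)) \<le> hausdorff1_outer E + hausdorff1_outer E" .
    qed auto
    then have sum_R: "(\<Sum>i. hausdorff1_outer (R i)) \<noteq> top"
      using fin by (metis ennreal_add_eq_top top.extremum_unique)
    define g where "g i = enn2real (hausdorff1_outer (R i))" for i
    have "hausdorff1_outer (R i) \<le> hausdorff1_outer E" for i
      by (intro hausdorff1_outer_mono) (auto simp: R_def)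
    then have "hausdorff1_outer (R i) \<noteq> top" for i
      using fin by (metis top.extremum_unique)
    then have g: "hausdorff1_outer (R i) = ennreal (g i)" "0 \<le> g i" for i
      by (simp_all add: g_def ennreal_enn2real_if)
    have "summable g"
      using sum_R g by (intro summable_suminf_not_top) auto
    have tail_eq: "(\<Sum>i. hausdorff1_outer (R (i + n))) = ennreal (\<Sum>i. g (i + n))" for n
    proof -
      have "summable (\<lambda>i. g (i + n))"
        using \<open>summable g\<close> by (rule summable_ignore_initial_segment)
      then have "(\<Sum>i. ennreal (g (i + n))) = ennreal (\<Sum>i. g (i + n))"
        by (intro suminf_ennreal2 g(2))
      then show ?thesis
        by (simp only: g(1))
    qed
    have "(\<lambda>n. \<Sum>i. g (i + n)) \<longlonglongrightarrow> 0"
      using \<open>summable g\<close> by (rule suminf_exist_split2)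
    then have "(\<lambda>n. ennreal (\<Sum>i. g (i + n))) \<longlonglongrightarrow> ennreal 0"
      by (rule tendsto_ennrealI)
    then have tail: "(\<lambda>n. \<Sum>i. hausdorff1_outer (R (i + n))) \<longlonglongrightarrow> 0"
      unfolding tail_eq by simp
    have split: "E - C \<subseteq> A n \<union> (\<Union>i. R (i + n))" for n
    proof
      fix x assume x: "x \<in> E - C"
      then have pos: "0 < infdist x C"
        using assms \<open>C \<noteq> {}\<close> by (auto intro: infdist_pos_not_in_closed)
      show "x \<in> A n \<union> (\<Union>i. R (i + n))"
      proof (cases "r n \<le> infdist x C")
        case False
        obtain k where k: "r k < infdist x C"
          using reals_Archimedean[OF pos] unfolding r_def inverse_eq_divide by blast
        define l where "l = (LEAST k. r k \<le> infdist x C)"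
        have l: "r l \<le> infdist x C"
          unfolding l_def using less_imp_le[OF k] by (rule LeastI)
        have "n < l"
          using l False r_le[of l n] by (meson not_le order_trans)
        then obtain i where i: "l = Suc (i + n)"
          by (metis add.commute less_iff_Suc_add)
        have "i + n < (LEAST k. r k \<le> infdist x C)"
          using i unfolding l_def by linarith
        then have "\<not> r (i + n) \<le> infdist x C"
          by (rule not_less_Least)
        then have "x \<in> R (i + n)"
          using l i x by (simp add: R_def)
        then show ?thesis
          by blast
      qed (use x in \<open>auto simp: A_def\<close>)
    qed
    have "hausdorff1_outer (E \<inter> C) + hausdorff1_outer (E - C)
        \<le> hausdorff1_outer E + (\<Sum>i. hausdorff1_outer (R (i + n)))" for n
    proof -
      have "hausdorff1_outer (E - C) \<le> hausdorff1_outer (A n) + hausdorff1_outer (\<Union>i. R (i + n))"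
        by (rule order_trans[OF hausdorff1_outer_mono[OF split] hausdorff1_outer_Un_le])
      also have "\<dots> \<le> hausdorff1_outer (A n) + (\<Sum>i. hausdorff1_outer (R (i + n)))"
        by (intro add_left_mono hausdorff1_outer_UN_le)
      finally have "hausdorff1_outer (E \<inter> C) + hausdorff1_outer (E - C) \<le>
          (hausdorff1_outer (E \<inter> C) + hausdorff1_outer (A n)) + (\<Sum>i. hausdorff1_outer (R (i + n)))"
        by (simp add: add.assoc add_left_mono)
      also have "hausdorff1_outer (E \<inter> C) + hausdorff1_outer (A n) \<le> hausdorff1_outer (E \<inter> C \<union> A n)"
      proof (rule hausdorff1_outer_Un_separated[OF r_pos[of n]])
        fix x y assume "x \<in> E \<inter> C" "y \<in> A n"
        then show "r n \<le> dist x y"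
          using infdist_le[of x C y] by (auto simp: A_def dist_commute)
      qed
      also have "\<dots> \<le> hausdorff1_outer E"
        by (intro hausdorff1_outer_mono) (auto simp: A_def)
      finally show ?thesis
        by (simp add: add_right_mono)
    qed
    moreover have "(\<lambda>n. hausdorff1_outer E + (\<Sum>i. hausdorff1_outer (R (i + n))))
        \<longlonglongrightarrow> hausdorff1_outer E + 0"
      by (intro tendsto_add tail tendsto_const)
    ultimately show ?thesis
      by (intro LIMSEQ_le_const[where X = "\<lambda>n. hausdorff1_outer E + (\<Sum>i. hausdorff1_outer (R (i + n)))"]) auto
  qed auto
qed

theorem measure_space_hausdorff1:
  "measure_space UNIV (sets borel) (hausdorff1_outer :: 'a::metric_space set \<Rightarrow> ennreal)"
proof -
  let ?H = "hausdorff1_outer :: 'a set \<Rightarrow> ennreal"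
  let ?L = "lambda_system UNIV UNIV ?H"
  interpret U: sigma_algebra UNIV "UNIV :: 'a set set"
    using sigma_algebra_Pow[of "UNIV :: 'a set"] by simp
  have L: "measure_space UNIV ?L ?H"
    by (rule U.caratheodory_lemma[OF outer_measure_space_hausdorff1])
  then have "sigma_algebra UNIV ?L"
    by (simp add: measure_space_def)
  moreover have "Collect closed \<subseteq> ?L"
    using hausdorff1_outer_closed by (auto simp: U.lambda_system_eq)
  ultimately have "sets borel \<subseteq> ?L"
    unfolding borel_eq_closed by (simp add: sigma_algebra.sigma_sets_subset)
  then show ?thesis
    using L sets.sigma_algebra_axioms[of "borel :: 'a measure"]
    unfolding measure_space_def positive_def countably_additive_def
    by (simp add: subset_eq)
qed

lemma sets_hausdorff1 [simp]: "sets hausdorff1 = sets borel"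
  unfolding hausdorff1_def by (metis sets.sets_measure_of_eq space_borel)

lemma space_hausdorff1 [simp]: "space hausdorff1 = UNIV"
  by (simp add: hausdorff1_def)

lemma emeasure_hausdorff1: "E \<in> sets borel \<Longrightarrow> emeasure hausdorff1 E = hausdorff1_outer E"
  using measure_space_hausdorff1[where 'a = 'a] unfolding hausdorff1_def measure_space_def
  by (intro emeasure_measure_of_sigma) auto

text \<open>The \<open>L\<^sup>2\<close> norm is extended-valued, since the trace of a function on an unbounded curve
  need not be square integrable.\<close>

definition L2_norm :: "'a measure \<Rightarrow> ('a \<Rightarrow> complex) \<Rightarrow> ennreal" where
  "L2_norm M f =
     (let I = (\<integral>\<^sup>+ x. ennreal ((norm (f x))\<^sup>2) \<partial>M)
      in if I = \<infinity> then \<infinity> else ennreal (sqrt (enn2real I)))"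

definition fourier :: "(real^2 \<Rightarrow> complex) \<Rightarrow> real^2 \<Rightarrow> complex" where
  "fourier f \<xi> = (\<integral>x. exp (- 2 * of_real pi * \<i> * of_real (\<xi> \<bullet> x)) * f x \<partial>lborel)"

definition haar1 :: "nat \<Rightarrow> real \<Rightarrow> real" where
  "haar1 e t = (if e = 0 then indicator {0..<1} t
                else indicator {0..<1/2} t - indicator {1/2..<1} t)"

type_synonym haar_index = "nat \<times> (int \<times> int) \<times> (nat \<times> nat)"

fun haar :: "haar_index \<Rightarrow> real^2 \<Rightarrow> real" where
  "haar (j, (k1, k2), (e1, e2)) x =
     2 powr (real j / 2) * haar1 e1 (2 ^ j * (x $ 1 + 1/2) - of_int k1) *
     (2 powr (real j / 2) * haar1 e2 (2 ^ j * (x $ 2 + 1/2) - of_int k2))"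

text \<open>For the shifts \<open>k\<close> below, \<open>haar\<close> is supported in \<open>[-1/2, 1/2)\<^sup>2\<close>, so it is already the
  extension by zero to the whole plane.\<close>

definition haar_indices :: "haar_index set" where
  "haar_indices = {(j, (k1, k2), e).
     k1 \<in> {0..<2 ^ j} \<and> k2 \<in> {0..<2 ^ j} \<and> e \<in> {0, 1} \<times> {0, 1} - {(0, 0)}}"

definition sparse_haar :: "nat \<Rightarrow> real \<Rightarrow> (real^2 \<Rightarrow> complex) set" where
  "sparse_haar N J =
     {\<lambda>x. \<Sum>i\<in>F. c i * of_real (haar i x) | F c.
        F \<subseteq> haar_indices \<and> finite F \<and> card F \<le> N \<and> (\<forall>i\<in>F. real (fst i) \<le> J)}"

text \<open>The restriction of Hausdorff measure is meaningful for Borel \<open>\<Gamma>\<close>; the two curves defined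
  below are closed sets.\<close>

definition stability_margin :: "(real^2) set \<Rightarrow> (real^2 \<Rightarrow> complex) set \<Rightarrow> ennreal" where
  "stability_margin \<Gamma> \<Sigma> =
     (INF f\<in>{f \<in> \<Sigma>. L2_norm lborel f = 1}. L2_norm (restrict_space hausdorff1 \<Gamma>) (fourier f))"

definition spiral :: "real \<Rightarrow> (real^2) set" where
  "spiral \<eta> = {vector [\<eta> * \<theta> * cos (2 * pi * \<theta>), \<eta> * \<theta> * sin (2 * pi * \<theta>)] | \<theta>. \<theta> \<ge> 0}"

definition concentric_circles :: "real \<Rightarrow> (real^2) set" where
  "concentric_circles \<eta> = {p. \<exists>k::nat. k \<ge> 1 \<and> (p $ 1)\<^sup>2 + (p $ 2)\<^sup>2 = \<eta>\<^sup>2 * (real k)\<^sup>2}"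

end

theory Submission
  imports Defs
begin

text \<open>
  Bessel's inequality on the unit square and a Taylor expansion of the exponential show that
  \<open>\<parallel>F^\<parallel>\<close> in \<open>L\<^sup>2(\<mu>\<^sub>\<Gamma>)\<close> is at most a constant times \<open>\<parallel>F\<parallel>\<close> for every \<open>F\<close> supported in the square,
  because each unit cell of the frequency plane contains a bounded length of \<open>\<Gamma>\<close>.

  The bad function is a difference \<open>f = g(x - a) - \<omega> g(x + a)\<close> of two bumps of width
  \<open>w = \<epsilon> / 4\<close> at opposite corners of the square, modulated to the frequency \<open>R\<close> in the diagonal
  direction. The distance \<open>2\<bar>a\<bar> = 1 / \<eta>\<close> makes the transform of \<open>f\<close> vanish on equidistant parallel lines
  of spacing \<open>\<eta>\<close>, and near frequency \<open>R\<close> the curve deviates from such lines by \<open>O((1 + v\<^sup>2) / R)\<close>, where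
  \<open>v\<close> is the transversal frequency. Factors \<open>v\<^sup>2\<close> cost derivatives of the bumps, so the
  trace of \<open>f\<close> is \<open>O(\<parallel>f\<parallel> / (R w\<^sup>2))\<close>.

  With \<open>4\<^sup>n \<le> N < 4\<^sup>n\<^sup>+\<^sup>1\<close> all Haar functions of level below \<open>n\<close> may be used at once, so that \<open>f\<close> can be
  replaced by a piecewise constant function at relative cost \<open>O(2\<^sup>-\<^sup>n R / w + 1 / R)\<close>.
  The choice \<open>R = N powr (1/6) / \<epsilon>\<close> makes all errors \<open>O(q)\<close> with \<open>q = N powr (-1/6) / \<epsilon>\<close>. If \<open>q\<close> is not
  small, a single Haar function suffices.
\<close>

section \<open>Fourier transforms on the unit square\<close>

text \<open>The bumps have to lie at distance \<open>1 / \<eta>\<close> along the diagonal of the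
  square, whose length is \<open>sqrt 2\<close>. With bumps of positive width this is possible only
  for \<eta> above \<open>sqrt 2 / 2\<close>, and the room left is of order \<epsilon>; this forces
  the width \<open>w\<close> and is the source of the powers of \<epsilon>. Cancellation happens on
  straight lines while the curve bends: a large \<open>R\<close> flattens it, but makes the function
  oscillate too fast for \<open>N\<close> wavelets. The trace of the pair is
  \<open>O(1 / (R w))\<close> and its norm is of order \<open>w\<close>, hence the quotient
  \<open>1 / (R w^2)\<close>. Two further obstacles shape the proof. Haar wavelets have mean zero,
  so the mean of the pair cannot be approximated; it is small because of the oscillation. And the
  trace bound must survive the passage to a discontinuous step function, which is why the trace
  inequality is proved for bounded measurable functions: it serves the derivative packets, the
  approximation error and the single wavelet alike.\<close>

lemma lborel_integral_prod:
  fixes f :: "'a::euclidean_space \<Rightarrow> real \<Rightarrow> complex"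
  assumes "\<And>b. b \<in> Basis \<Longrightarrow> integrable lborel (f b)"
  shows "(\<integral>x. (\<Prod>b\<in>Basis. f b (x \<bullet> b)) \<partial>lborel) = (\<Prod>b\<in>Basis. (\<integral>t. f b t \<partial>lborel))"
proof -
  have [measurable]: "f b \<in> borel_measurable borel" if "b \<in> Basis" for b
    using borel_measurable_integrable[OF assms[OF that]] by simp
  interpret product_sigma_finite "\<lambda>b::'a. lborel :: real measure" ..
  have "(\<integral>x. (\<Prod>b\<in>Basis. f b (x \<bullet> b)) \<partial>lborel)
      = (\<integral>x. (\<Prod>b\<in>Basis. f b (x b)) \<partial>(\<Pi>\<^sub>M b\<in>(Basis::'a set). lborel))"
    unfolding lborel_eq[where 'a = 'a]
    by (subst integral_distr) (auto intro!: Bochner_Integration.integral_cong prod.cong)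
  also have "\<dots> = (\<Prod>b\<in>Basis. (\<integral>t. f b t \<partial>lborel))"
    using assms by (intro product_integral_prod) auto
  finally show ?thesis .
qed

lemma Basis_real2: "(Basis :: (real^2) set) = {axis 1 1, axis 2 1}"
  by (auto simp: Basis_vec_def UNIV_2)

lemma axis_1_neq_2: "axis 1 (1::real) \<noteq> (axis 2 1 :: real^2)"
  by (simp add: axis_eq_axis)

lemma integral_real2_product:
  fixes p q :: "real \<Rightarrow> complex"
  assumes "integrable lborel p" "integrable lborel q"
  shows "(\<integral>x. p (x $ 1) * q (x $ 2) \<partial>(lborel :: (real^2) measure)) = (\<integral>t. p t \<partial>lborel) * (\<integral>t. q t \<partial>lborel)"
  using lborel_integral_prod[of "\<lambda>b::real^2. if b = axis 1 1 then p else q"] assms axis_1_neq_2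
  by (simp add: Basis_real2 inner_axis axis_1_neq_2[symmetric])

section \<open>Bounded functions on the square and their transforms\<close>

definition half_square :: "(real^2) set" where
  "half_square = {x. \<bar>x $ 1\<bar> \<le> 1/2 \<and> \<bar>x $ 2\<bar> \<le> 1/2}"

text \<open>Boundedness on a set of measure one gives integrability and square integrability at the
  same time. The class is stable under multiplication by characters and by powers of the
  coordinates, and it contains step functions as well as bumps.\<close>

definition bdd_on_square :: "(real^2 \<Rightarrow> complex) \<Rightarrow> bool" where
  "bdd_on_square F \<longleftrightarrow> F \<in> borel_measurable borel \<and> (\<exists>B. \<forall>x. norm (F x) \<le> B)
     \<and> (\<forall>x. x \<notin> half_square \<longrightarrow> F x = 0)"

lemma half_square_cbox: "half_square = cbox (vector [-1/2,-1/2]) (vector [1/2,1/2])"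
  by (auto simp: half_square_def mem_box_cart forall_2 abs_le_iff)

lemma emeasure_cbox_vector:
  assumes "a \<le> b" "c \<le> d"
  shows "emeasure lborel (cbox (vector [a,c]) (vector [b,d]) :: (real^2) set) = ennreal ((b - a) * (d - c))"
  using assms by (subst emeasure_lborel_cbox)
    (auto simp: Basis_real2 inner_axis axis_1_neq_2)

lemma half_square_sets [measurable]: "half_square \<in> sets borel"
  by (simp add: half_square_cbox)

lemma emeasure_half_square: "emeasure lborel half_square = 1"
  unfolding half_square_cbox by (subst emeasure_cbox_vector) auto

lemma bdd_on_square_measurable [measurable_dest]: "bdd_on_square F \<Longrightarrow> F \<in> borel_measurable borel"
  by (simp add: bdd_on_square_def)

lemma bdd_on_square_mult:
  assumes "bdd_on_square F" "G \<in> borel_measurable borel" "\<And>x. x \<in> half_square \<Longrightarrow> norm (G x) \<le> B"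
  shows "bdd_on_square (\<lambda>x. G x * F x)"
proof -
  obtain B' where B': "\<And>x. norm (F x) \<le> B'"
    using assms by (auto simp: bdd_on_square_def)
  have "norm (G x * F x) \<le> \<bar>B\<bar> * \<bar>B'\<bar>" for x
  proof (cases "x \<in> half_square")
    case True
    then show ?thesis
      unfolding norm_mult using assms(3)[OF True] B'[of x] by (intro mult_mono) auto
  qed (use assms in \<open>auto simp: bdd_on_square_def\<close>)
  then show ?thesis
    using assms unfolding bdd_on_square_def by auto
qed

lemma bdd_on_square_integrable:
  assumes "bdd_on_square F"
  shows "integrable lborel F"
proof -
  obtain B where "\<And>x. norm (F x) \<le> B"
    using assms by (auto simp: bdd_on_square_def)
  then show ?thesis
    using assms by (intro integrableI_bounded_set[where A = half_square and B = B])
      (auto simp: bdd_on_square_def emeasure_half_square)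
qed

definition char :: "real^2 \<Rightarrow> real^2 \<Rightarrow> complex" where
  "char \<xi> x = exp (- 2 * of_real pi * \<i> * of_real (\<xi> \<bullet> x))"

lemma char_cis: "char \<xi> x = cis (- 2 * pi * (\<xi> \<bullet> x))"
  by (simp add: char_def cis_conv_exp mult_ac)

lemma fourier_char: "fourier F \<xi> = (\<integral>x. char \<xi> x * F x \<partial>lborel)"
  by (simp add: fourier_def char_def)

lemma norm_char [simp]: "norm (char \<xi> x) = 1"
  by (simp add: char_cis)

lemma char_measurable [measurable]: "(\<lambda>x. char \<xi> x) \<in> borel_measurable borel"
  unfolding char_cis cis_conv_exp by measurable

lemma bdd_on_square_char: "bdd_on_square F \<Longrightarrow> bdd_on_square (\<lambda>x. char \<xi> x * F x)"
  by (rule bdd_on_square_mult[where B = 1]) auto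

lemma fourier_measurable:
  assumes "F \<in> borel_measurable borel"
  shows "fourier F \<in> borel_measurable borel"
proof -
  have [measurable]: "F \<in> borel_measurable lborel" using assms by simp
  have "(\<lambda>\<xi>. \<integral>x. exp (- 2 * of_real pi * \<i> * of_real (\<xi> \<bullet> x)) * F x \<partial>lborel) \<in> borel_measurable borel"
    by (rule lborel.borel_measurable_lebesgue_integral) measurable
  then show ?thesis
    by (simp add: fourier_def[abs_def])
qed

text \<open>The integral of \<open>|F - P|^2\<close> is nonnegative, where \<open>P\<close> is the
  orthogonal projection of \<open>F\<close> to the span of the \<open>e i\<close>; orthonormality
  leaves the integral of \<open>|F|^2\<close> minus the sum of the squared coefficients. The
  integrability hypotheses on the products allow the expanded square to be integrated term by
  term.\<close>

lemma bessel_inequality: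
  fixes F :: "'a \<Rightarrow> complex" and e :: "'i \<Rightarrow> 'a \<Rightarrow> complex"
  assumes "finite S"
    and FF: "integrable M (\<lambda>x. F x * cnj (F x))"
    and Fe: "\<And>i. i \<in> S \<Longrightarrow> integrable M (\<lambda>x. F x * cnj (e i x))"
    and ee: "\<And>i j. i \<in> S \<Longrightarrow> j \<in> S \<Longrightarrow> integrable M (\<lambda>x. e i x * cnj (e j x))"
    and orth: "\<And>i j. i \<in> S \<Longrightarrow> j \<in> S \<Longrightarrow> (\<integral>x. e i x * cnj (e j x) \<partial>M) = of_bool (i = j)"
  shows "(\<Sum>i\<in>S. (norm (\<integral>x. F x * cnj (e i x) \<partial>M))\<^sup>2) \<le> Re (\<integral>x. F x * cnj (F x) \<partial>M)"
proof -
  define c where "c i = (\<integral>x. F x * cnj (e i x) \<partial>M)" for i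
  define P where "P x = (\<Sum>i\<in>S. c i * e i x)" for x
  have eF: "integrable M (\<lambda>x. e i x * cnj (F x))" "(\<integral>x. e i x * cnj (F x) \<partial>M) = cnj (c i)" if "i \<in> S" for i
  proof -
    have *: "(\<lambda>x. e i x * cnj (F x)) = (\<lambda>x. cnj (F x * cnj (e i x)))" by (simp add: mult.commute)
    show "integrable M (\<lambda>x. e i x * cnj (F x))"
      unfolding * using Fe[OF that] by (simp only: complex_integrable_cnj)
    show "(\<integral>x. e i x * cnj (F x) \<partial>M) = cnj (c i)"
      unfolding * c_def by (simp only: Bochner_Integration.integral_cnj)
  qed
  have expand: "(F x - P x) * cnj (F x - P x) = F x * cnj (F x) - (\<Sum>i\<in>S. cnj (c i) * (F x * cnj (e i x)))
      - (\<Sum>i\<in>S. c i * (e i x * cnj (F x))) + (\<Sum>i\<in>S. \<Sum>j\<in>S. c i * cnj (c j) * (e i x * cnj (e j x)))" for x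
  proof -
    have "P x * cnj (P x) = (\<Sum>i\<in>S. \<Sum>j\<in>S. c i * cnj (c j) * (e i x * cnj (e j x)))"
      by (simp add: P_def sum_product mult_ac)
    moreover have "F x * cnj (P x) = (\<Sum>i\<in>S. cnj (c i) * (F x * cnj (e i x)))"
      unfolding P_def cnj_sum sum_distrib_left by (simp add: mult_ac)
    moreover have "P x * cnj (F x) = (\<Sum>i\<in>S. c i * (e i x * cnj (F x)))"
      unfolding P_def sum_distrib_right by (simp add: mult_ac)
    ultimately show ?thesis by (simp add: algebra_simps)
  qed
  have I1: "integrable M (\<lambda>x. \<Sum>i\<in>S. cnj (c i) * (F x * cnj (e i x)))"
    using Fe by (intro Bochner_Integration.integrable_sum integrable_mult_right) auto
  have I2: "integrable M (\<lambda>x. \<Sum>i\<in>S. c i * (e i x * cnj (F x)))"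
    using eF by (intro Bochner_Integration.integrable_sum integrable_mult_right) auto
  have I3: "integrable M (\<lambda>x. \<Sum>i\<in>S. \<Sum>j\<in>S. c i * cnj (c j) * (e i x * cnj (e j x)))"
    using ee by (intro Bochner_Integration.integrable_sum integrable_mult_right) auto
  have "0 \<le> (\<integral>x. (norm (F x - P x))\<^sup>2 \<partial>M)"
    by simp
  also have "\<dots> = Re (of_real (\<integral>x. (norm (F x - P x))\<^sup>2 \<partial>M))"
    by simp
  also have "of_real (\<integral>x. (norm (F x - P x))\<^sup>2 \<partial>M) = (\<integral>x. (F x - P x) * cnj (F x - P x) \<partial>M)"
    unfolding integral_complex_of_real[symmetric] by (intro Bochner_Integration.integral_cong refl) (rule complex_norm_square)
  also have "\<dots> = (\<integral>x. F x * cnj (F x) \<partial>M) - (\<integral>x. (\<Sum>i\<in>S. cnj (c i) * (F x * cnj (e i x))) \<partial>M)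
      - (\<integral>x. (\<Sum>i\<in>S. c i * (e i x * cnj (F x))) \<partial>M)
      + (\<integral>x. (\<Sum>i\<in>S. \<Sum>j\<in>S. c i * cnj (c j) * (e i x * cnj (e j x))) \<partial>M)"
    unfolding expand using FF I1 I2 I3
    by (simp only: Bochner_Integration.integral_add Bochner_Integration.integral_diff
        Bochner_Integration.integrable_diff)
  also have "(\<integral>x. (\<Sum>i\<in>S. cnj (c i) * (F x * cnj (e i x))) \<partial>M) = (\<Sum>i\<in>S. cnj (c i) * c i)"
    using Fe by (subst Bochner_Integration.integral_sum) (auto simp: c_def)
  also have "(\<integral>x. (\<Sum>i\<in>S. c i * (e i x * cnj (F x))) \<partial>M) = (\<Sum>i\<in>S. c i * cnj (c i))"
    using eF by (subst Bochner_Integration.integral_sum) auto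
  also have "(\<integral>x. (\<Sum>i\<in>S. \<Sum>j\<in>S. c i * cnj (c j) * (e i x * cnj (e j x))) \<partial>M) = (\<Sum>i\<in>S. \<Sum>j\<in>S. c i * cnj (c j) * of_bool (i = j))"
  proof -
    have "(\<integral>x. (\<Sum>i\<in>S. \<Sum>j\<in>S. c i * cnj (c j) * (e i x * cnj (e j x))) \<partial>M)
        = (\<Sum>i\<in>S. \<integral>x. (\<Sum>j\<in>S. c i * cnj (c j) * (e i x * cnj (e j x))) \<partial>M)"
      using ee by (intro Bochner_Integration.integral_sum Bochner_Integration.integrable_sum integrable_mult_right)
    also have "\<dots> = (\<Sum>i\<in>S. \<Sum>j\<in>S. \<integral>x. c i * cnj (c j) * (e i x * cnj (e j x)) \<partial>M)"
      using ee by (intro sum.cong refl Bochner_Integration.integral_sum integrable_mult_right)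
    also have "\<dots> = (\<Sum>i\<in>S. \<Sum>j\<in>S. c i * cnj (c j) * of_bool (i = j))"
      by (intro sum.cong refl) (simp only: integral_mult_right_zero orth)
    finally show ?thesis .
  qed
  also have "\<dots> = (\<Sum>i\<in>S. c i * cnj (c i))"
    using \<open>finite S\<close> by (intro sum.cong refl) (simp add: of_bool_def if_distrib[of "\<lambda>x. _ * x"] sum.delta cong: if_cong)
  also have "Re ((\<integral>x. F x * cnj (F x) \<partial>M) - (\<Sum>i\<in>S. cnj (c i) * c i) - (\<Sum>i\<in>S. c i * cnj (c i)) + (\<Sum>i\<in>S. c i * cnj (c i)))
      = Re (\<integral>x. F x * cnj (F x) \<partial>M) - (\<Sum>i\<in>S. (norm (c i))\<^sup>2)"
    by (simp add: cmod_power2) (simp add: power2_eq_square)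
  finally show ?thesis
    by (simp add: c_def)
qed


section \<open>Lattice characters and Fourier coefficients on the square\<close>

definition lattice :: "int \<times> int \<Rightarrow> real^2" where
  "lattice m = vector [of_int (fst m), of_int (snd m)]"

lemma lattice_nth [simp]: "lattice m $ 1 = of_int (fst m)" "lattice m $ 2 = of_int (snd m)"
  by (simp_all add: lattice_def)

lemma inner_real2: "(x :: real^2) \<bullet> y = x $ 1 * y $ 1 + x $ 2 * y $ 2"
  by (simp add: inner_vec_def sum_2)

text \<open>The product of a cut-off lattice character with the conjugate of another one factors
  into two of these functions, with the differences of the indices as \<open>k\<close>; this
  separates the variables in the orthogonality relations.\<close>

definition char1 :: "int \<Rightarrow> real \<Rightarrow> complex" where
  "char1 k t = indicator {-1/2..1/2} t *\<^sub>R cis (2 * pi * of_int k * t)"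

lemma integrable_char1: "integrable lborel (char1 k)"
  unfolding char1_def cis_conv_exp
  by (intro borel_integrable_compact[unfolded set_integrable_def] compact_Icc continuous_intros)

lemma integral_char1: "(\<integral>t. char1 k t \<partial>lborel) = of_bool (k = 0)"
proof (cases "k = 0")
  case True
  have "(\<integral>t. indicator {-1/2..1/2} t *\<^sub>R (1::complex) \<partial>(lborel :: real measure)) = 1"
    by (simp add: scaleR_conv_of_real)
  then show ?thesis
    using True by (simp add: char1_def)
next
  case False
  let ?F = "\<lambda>t. cis (2 * pi * of_int k * t) / (\<i> * 2 * pi * of_int k)"
  have "(\<integral>t. indicator {-1/2..1/2} t *\<^sub>R cis (2 * pi * of_int k * t) \<partial>lborel) = ?F (1/2) - ?F (-1/2)"
  proof (rule integral_FTC_Icc)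
    show "(?F has_vector_derivative cis (2 * pi * of_int k * t)) (at t within {-1/2..1/2})" for t
    proof -
      define A where "A = \<i> * 2 * pi * of_int k"
      have A: "A \<noteq> 0" and cis: "cis (2 * pi * of_int k * s) = exp (s *\<^sub>R A)" for s
        using False by (simp_all add: A_def cis_conv_exp scaleR_conv_of_real mult_ac)
      have "((\<lambda>t. exp (t *\<^sub>R A) / A) has_vector_derivative exp (t *\<^sub>R A) * A / A) (at t within {-1/2..1/2})"
        by (intro has_vector_derivative_divide exp_scaleR_has_vector_derivative_right)
      then show ?thesis
        using A unfolding cis A_def[symmetric] by simp
    qed
    show "continuous_on {-1/2..1/2} (\<lambda>t. cis (2 * pi * of_int k * t))"
      unfolding cis_conv_exp by (intro continuous_intros)
  qed simp
  also have "\<dots> = 0"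
  proof -
    have "sin (pi * of_int k) = 0"
      by (simp add: sin_zero_iff_int2)
    then have "cis (2 * pi * of_int k * (1/2)) = cis (2 * pi * of_int k * (-1/2))"
      by (simp add: complex_eq_iff)
    then show ?thesis by simp
  qed
  finally show ?thesis
    using False by (simp add: char1_def)
qed

definition sq_integral :: "('a::euclidean_space \<Rightarrow> complex) \<Rightarrow> ennreal" where
  "sq_integral F = (\<integral>\<^sup>+x. ennreal ((norm (F x))\<^sup>2) \<partial>lborel)"

lemma bdd_on_square_indicator:
  assumes "G \<in> borel_measurable borel" "\<And>x. x \<in> half_square \<Longrightarrow> norm (G x) \<le> B"
  shows "bdd_on_square (\<lambda>x. indicator half_square x * G x)"
  unfolding bdd_on_square_def
proof (intro conjI exI allI impI)
  show "norm (indicator half_square x * G x) \<le> \<bar>B\<bar>" for x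
    using order_trans[OF assms(2)[of x] abs_ge_self] by (auto simp: indicator_def)
qed (use assms in \<open>auto simp: indicator_def\<close>)

text \<open>Since \<open>F\<close> vanishes outside the unit square, its transform at a lattice
  point is its coefficient with respect to a lattice character cut off to the square, and these
  cut-off characters are orthonormal.\<close>

lemma fourier_bessel:
  assumes F: "bdd_on_square F" and "finite S"
  shows "(\<Sum>m\<in>S. ennreal ((norm (fourier F (lattice m)))\<^sup>2)) \<le> sq_integral F"
proof -
  have [measurable]: "F \<in> borel_measurable borel"
    using F by auto
  obtain B where B: "\<And>x. norm (F x) \<le> B"
    using F by (auto simp: bdd_on_square_def)
  define e where "e m x = indicator half_square x * char (- lattice m) x" for m x
  have [measurable]: "e m \<in> borel_measurable borel" for m
    unfolding e_def by measurable
  have Fe: "(\<lambda>x. F x * cnj (e m x)) = (\<lambda>x. char (lattice m) x * F x)" for m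
    using F by (auto simp: fun_eq_iff e_def bdd_on_square_def indicator_def char_cis cis_cnj)
  have [measurable]: "cnj \<in> borel_measurable borel"
    by (intro borel_measurable_continuous_onI continuous_intros)
  have FF: "bdd_on_square (\<lambda>x. F x * cnj (F x))"
    using bdd_on_square_mult[OF F, of "\<lambda>x. cnj (F x)" B] B by (simp add: mult.commute)
  have ee_eq: "e m x * cnj (e n x) = char1 (fst m - fst n) (x $ 1) * char1 (snd m - snd n) (x $ 2)" for m n x
    by (auto simp: e_def char1_def char_cis half_square_def indicator_def inner_real2 cis_mult cis_cnj algebra_simps)
  have "(\<Sum>m\<in>S. (norm (\<integral>x. F x * cnj (e m x) \<partial>lborel))\<^sup>2) \<le> Re (\<integral>x. F x * cnj (F x) \<partial>lborel)"
  proof (rule bessel_inequality[OF \<open>finite S\<close>])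
    show "integrable lborel (\<lambda>x. F x * cnj (F x))"
      using FF by (rule bdd_on_square_integrable)
    show "integrable lborel (\<lambda>x. F x * cnj (e m x))" for m
      unfolding Fe by (intro bdd_on_square_integrable bdd_on_square_char F)
    show "integrable lborel (\<lambda>x. e m x * cnj (e n x))" for m n
    proof -
      have "bdd_on_square (\<lambda>x. indicator half_square x * (e m x * cnj (e n x)))"
        by (rule bdd_on_square_indicator[where B = 1]) (auto simp: e_def norm_mult indicator_def)
      also have "(\<lambda>x. indicator half_square x * (e m x * cnj (e n x))) = (\<lambda>x. e m x * cnj (e n x))"
        by (auto simp: e_def indicator_def)
      finally show ?thesis by (rule bdd_on_square_integrable)
    qed
    show "(\<integral>x. e m x * cnj (e n x) \<partial>lborel) = of_bool (m = n)" for m n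
      unfolding ee_eq by (subst integral_real2_product) (auto simp: integrable_char1 integral_char1 prod_eq_iff)
  qed
  also have "Re (\<integral>x. F x * cnj (F x) \<partial>lborel) = (\<integral>x. (norm (F x))\<^sup>2 \<partial>lborel)"
    by (simp add: complex_norm_square[symmetric] del: of_real_power)
  finally have "ennreal (\<Sum>m\<in>S. (norm (fourier F (lattice m)))\<^sup>2) \<le> ennreal (\<integral>x. (norm (F x))\<^sup>2 \<partial>lborel)"
    by (simp add: Fe fourier_char)
  also have "\<dots> = sq_integral F"
    unfolding sq_integral_def
  proof (rule nn_integral_eq_integral[symmetric])
    show "integrable lborel (\<lambda>x. (norm (F x))\<^sup>2)"
      using bdd_on_square_integrable[OF FF] integrable_norm by (fastforce simp: norm_mult power2_eq_square)
  qed auto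
  finally show ?thesis
    by (simp add: sum_ennreal)
qed

section \<open>Taylor expansion of the transform around lattice points\<close>

definition taylor_weight :: "nat \<Rightarrow> real" where "taylor_weight p = (2 * pi) ^ p / fact p"

lemma taylor_weight_nonneg [simp]: "0 \<le> taylor_weight p" by (simp add: taylor_weight_def)

lemma taylor_weight_sums: "taylor_weight sums exp (2 * pi)"
  using exp_converges[of "2 * pi"] by (simp add: taylor_weight_def[abs_def] field_simps)

text \<open>Cauchy-Schwarz for the measure on the naturals with masses
  \<open>taylor_weight p\<close>, whose total mass is \<open>exp (2 * pi)\<close>. It is applied to
  finite sums and passed to the limit; the bound \<open>B\<close> makes both series
  converge.\<close>

lemma weighted_square_sum_le:
  fixes b :: "nat \<Rightarrow> real"
  assumes b: "\<And>p. 0 \<le> b p" "\<And>p. b p \<le> B"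
  shows "summable (\<lambda>p. taylor_weight p * b p)" "summable (\<lambda>p. taylor_weight p * (b p)\<^sup>2)"
    "(\<Sum>p. taylor_weight p * b p)\<^sup>2 \<le> exp (2 * pi) * (\<Sum>p. taylor_weight p * (b p)\<^sup>2)"
proof -
  have sw: "summable taylor_weight" using taylor_weight_sums by (rule sums_summable)
  have B: "0 \<le> B" using b[of 0] by linarith
  show s1: "summable (\<lambda>p. taylor_weight p * b p)"
    by (rule summable_comparison_test'[OF summable_mult2[OF sw, of B]])
       (use b B in \<open>auto intro!: mult_left_mono simp: abs_mult\<close>)
  show s2: "summable (\<lambda>p. taylor_weight p * (b p)\<^sup>2)"
    by (rule summable_comparison_test'[OF summable_mult2[OF sw, of "B\<^sup>2"]])
       (use b B in \<open>auto intro!: mult_left_mono power_mono simp: abs_mult\<close>)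
  show "(\<Sum>p. taylor_weight p * b p)\<^sup>2 \<le> exp (2 * pi) * (\<Sum>p. taylor_weight p * (b p)\<^sup>2)"
  proof (rule LIMSEQ_le_const2)
    show "(\<lambda>n. (\<Sum>p<n. taylor_weight p * b p)\<^sup>2) \<longlonglongrightarrow> (\<Sum>p. taylor_weight p * b p)\<^sup>2"
      by (intro tendsto_power summable_LIMSEQ s1)
    have "(\<Sum>p<n. taylor_weight p * b p)\<^sup>2 \<le> exp (2 * pi) * (\<Sum>p. taylor_weight p * (b p)\<^sup>2)" for n
    proof -
      have "(\<Sum>p<n. taylor_weight p * b p)\<^sup>2 = (\<Sum>p<n. sqrt (taylor_weight p) * (sqrt (taylor_weight p) * b p))\<^sup>2"
        by (simp add: mult.assoc[symmetric])
      also have "\<dots> \<le> (\<Sum>p<n. (sqrt (taylor_weight p))\<^sup>2) * (\<Sum>p<n. (sqrt (taylor_weight p) * b p)\<^sup>2)"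
        by (rule Cauchy_Schwarz_ineq_sum)
      also have "\<dots> = (\<Sum>p<n. taylor_weight p) * (\<Sum>p<n. taylor_weight p * (b p)\<^sup>2)"
        by (simp add: power_mult_distrib)
      also have "\<dots> \<le> (\<Sum>p. taylor_weight p) * (\<Sum>p. taylor_weight p * (b p)\<^sup>2)"
        by (intro mult_mono sum_le_suminf sw s2 suminf_nonneg sum_nonneg) auto
      also have "(\<Sum>p. taylor_weight p) = exp (2 * pi)"
        using taylor_weight_sums by (simp add: sums_iff)
      finally show ?thesis .
    qed
    then show "\<exists>N. \<forall>n\<ge>N. (\<Sum>p<n. taylor_weight p * b p)\<^sup>2 \<le> exp (2 * pi) * (\<Sum>p. taylor_weight p * (b p)\<^sup>2)"
      by blast
  qed
qed

text \<open>Up to a constant factor, the transform of \<open>coord_mult i p F\<close> is the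
  \<open>p\<close>-th partial derivative of the transform of \<open>F\<close>. On the square the
  coordinates are at most 1/2 in modulus, so the multiplication does not increase the norm.\<close>

definition coord_mult :: "2 \<Rightarrow> nat \<Rightarrow> (real^2 \<Rightarrow> complex) \<Rightarrow> real^2 \<Rightarrow> complex" where
  "coord_mult i p F x = of_real ((x $ i) ^ p) * F x"

lemma half_square_nth: "x \<in> half_square \<Longrightarrow> \<bar>x $ i\<bar> \<le> 1/2"
  using exhaust_2[of i] by (auto simp: half_square_def)

lemma coord_mult_bound:
  assumes "F \<in> borel_measurable borel" "\<And>x. x \<notin> half_square \<Longrightarrow> F x = 0"
  shows "norm (coord_mult i p F x) \<le> norm (F x)"
proof (cases "x \<in> half_square")
  case True
  then have "\<bar>x $ i\<bar> ^ p \<le> 1"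
    using half_square_nth[of x i] by (intro power_le_one) auto
  then show ?thesis
    by (simp add: coord_mult_def norm_mult norm_power mult_left_le_one_le)
qed (use assms in \<open>simp add: coord_mult_def\<close>)

lemma bdd_on_square_coord_mult:
  assumes F: "bdd_on_square F"
  shows "bdd_on_square (coord_mult i p F)"
proof -
  have [measurable]: "F \<in> borel_measurable borel" using F by auto
  have *: "norm (coord_mult i p F x) \<le> norm (F x)" for x
    using F by (intro coord_mult_bound) (auto simp: bdd_on_square_def)
  obtain B where B: "norm (F x) \<le> B" for x
    using F by (auto simp: bdd_on_square_def)
  have "coord_mult i p F \<in> borel_measurable borel"
    unfolding coord_mult_def[abs_def] by measurable
  then show ?thesis
    using order_trans[OF * B] F by (auto simp: bdd_on_square_def coord_mult_def)
qed

lemma sq_integral_coord_mult_le: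
  assumes F: "bdd_on_square F"
  shows "sq_integral (coord_mult i p F) \<le> sq_integral F"
  unfolding sq_integral_def using F
  by (intro nn_integral_mono ennreal_leI power_mono coord_mult_bound) (auto simp: bdd_on_square_def)

lemma norm_fourier_le:
  assumes "bdd_on_square F"
  shows "norm (fourier F \<xi>) \<le> (\<integral>x. norm (F x) \<partial>lborel)"
  unfolding fourier_char using integral_norm_bound[of lborel "\<lambda>x. char \<xi> x * F x"] by (simp add: norm_mult)

lemma norm_fourier_coord_mult_le:
  assumes F: "bdd_on_square F"
  shows "norm (fourier (coord_mult i p F) \<xi>) \<le> (\<integral>x. norm (F x) \<partial>lborel)"
proof -
  have "norm (fourier (coord_mult i p F) \<xi>) \<le> (\<integral>x. norm (coord_mult i p F x) \<partial>lborel)"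
    by (rule norm_fourier_le[OF bdd_on_square_coord_mult[OF F]])
  also have "\<dots> \<le> (\<integral>x. norm (F x) \<partial>lborel)"
    using F by (intro integral_mono integrable_norm bdd_on_square_integrable bdd_on_square_coord_mult coord_mult_bound)
      (auto simp: bdd_on_square_def)
  finally show ?thesis .
qed

text \<open>Moving the frequency by \<open>\<delta>\<close> multiplies the integrand by an
  exponential in \<open>x $ i\<close>. The terms of its power series, times
  \<open>char \<xi> x * F x\<close>, are dominated by \<open>taylor_weight p * norm (F x)\<close>,
  so the series may be integrated term by term.\<close>

lemma fourier_shift_le:
  assumes F: "bdd_on_square F" and "\<bar>\<delta>\<bar> \<le> 1"
  shows "norm (fourier F (\<xi> + \<delta> *\<^sub>R axis i 1)) \<le> (\<Sum>p. taylor_weight p * norm (fourier (coord_mult i p F) \<xi>))"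
proof -
  have [measurable]: "F \<in> borel_measurable borel" using F by auto
  define a where "a = - 2 * of_real pi * \<i> * of_real \<delta>"
  define f where "f p x = (a ^ p /\<^sub>R fact p) * (char \<xi> x * coord_mult i p F x)" for p x
  have a: "norm a \<le> 2 * pi"
    using assms(2) by (simp add: a_def norm_mult)
  have f_int: "integrable lborel (f p)" for p
    unfolding f_def by (intro integrable_mult_right bdd_on_square_integrable bdd_on_square_char bdd_on_square_coord_mult F)
  have int_f: "(\<integral>x. f p x \<partial>lborel) = (a ^ p /\<^sub>R fact p) * fourier (coord_mult i p F) \<xi>" for p
    unfolding f_def fourier_char by simp
  have wa: "norm (a ^ p /\<^sub>R fact p) \<le> taylor_weight p" for p
    using power_mono[OF a norm_ge_zero, of p] by (simp add: taylor_weight_def norm_power divide_right_mono field_simps)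
  have f_sums: "(\<lambda>p. f p x) sums (char (\<xi> + \<delta> *\<^sub>R axis i 1) x * F x)" for x
  proof -
    have "(\<lambda>p. (a * of_real (x $ i)) ^ p /\<^sub>R fact p) sums exp (a * of_real (x $ i))"
      by (rule exp_converges)
    from sums_mult[OF this, of "char \<xi> x * F x"]
    have "(\<lambda>p. f p x) sums (char \<xi> x * F x * exp (a * of_real (x $ i)))"
      by (simp add: f_def coord_mult_def power_mult_distrib mult_ac scaleR_conv_of_real)
    also have "char \<xi> x * F x * exp (a * of_real (x $ i)) = char (\<xi> + \<delta> *\<^sub>R axis i 1) x * F x"
      by (simp add: char_def a_def exp_add[symmetric] inner_axis' inner_add_left algebra_simps)
    finally show ?thesis .
  qed
  have norm_f: "norm (f p x) \<le> taylor_weight p * norm (F x)" for p x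
  proof -
    have "norm (coord_mult i p F x) \<le> norm (F x)"
      using F by (intro coord_mult_bound) (auto simp: bdd_on_square_def)
    then show ?thesis
      unfolding f_def norm_mult by (intro mult_mono wa) auto
  qed
  have sw: "summable taylor_weight" using taylor_weight_sums by (rule sums_summable)
  have s1: "summable (\<lambda>p. norm (f p x))" for x
    by (rule summable_comparison_test'[OF summable_mult2[OF sw, of "norm (F x)"]]) (use norm_f in auto)
  have s2: "summable (\<lambda>p. \<integral>x. norm (f p x) \<partial>lborel)"
  proof (rule summable_comparison_test'[OF summable_mult2[OF sw, of "\<integral>x. norm (F x) \<partial>lborel"]])
    have "(\<integral>x. norm (f p x) \<partial>lborel) \<le> (\<integral>x. taylor_weight p * norm (F x) \<partial>lborel)" for p
      using norm_f by (intro integral_mono integrable_norm f_int integrable_mult_right bdd_on_square_integrable F)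
    then show "norm (\<integral>x. norm (f p x) \<partial>lborel) \<le> taylor_weight p * (\<integral>x. norm (F x) \<partial>lborel)" for p
      by simp
  qed
  have "(\<lambda>p. \<integral>x. f p x \<partial>lborel) sums (\<integral>x. (\<Sum>p. f p x) \<partial>lborel)"
    by (rule sums_integral) (use f_int s1 s2 in auto)
  then have sums: "(\<lambda>p. \<integral>x. f p x \<partial>lborel) sums fourier F (\<xi> + \<delta> *\<^sub>R axis i 1)"
    using f_sums by (simp add: sums_iff fourier_char)
  have bound: "norm (fourier (coord_mult i p F) \<xi>) \<le> (\<integral>x. norm (F x) \<partial>lborel)" for p
    by (rule norm_fourier_coord_mult_le[OF F])
  have s3: "summable (\<lambda>p. taylor_weight p * norm (fourier (coord_mult i p F) \<xi>))"
    by (rule weighted_square_sum_le(1)) (use bound in auto)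
  have le: "norm (\<integral>x. f p x \<partial>lborel) \<le> taylor_weight p * norm (fourier (coord_mult i p F) \<xi>)" for p
    unfolding int_f norm_mult by (intro mult_right_mono wa) auto
  have s4: "summable (\<lambda>p. norm (\<integral>x. f p x \<partial>lborel))"
    by (rule summable_comparison_test'[OF s3]) (use le in auto)
  have "norm (fourier F (\<xi> + \<delta> *\<^sub>R axis i 1)) \<le> (\<Sum>p. norm (\<integral>x. f p x \<partial>lborel))"
    using summable_norm[OF s4] sums by (simp add: sums_iff)
  also have "\<dots> \<le> (\<Sum>p. taylor_weight p * norm (fourier (coord_mult i p F) \<xi>))"
    by (intro suminf_le le s3 s4)
  finally show ?thesis .
qed

lemma fourier_shift_sq_le:
  assumes F: "bdd_on_square F" and "\<bar>\<delta>\<bar> \<le> 1"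
  shows "ennreal ((norm (fourier F (\<xi> + \<delta> *\<^sub>R axis i 1)))\<^sup>2)
    \<le> ennreal (exp (2 * pi)) * (\<Sum>p. ennreal (taylor_weight p) * ennreal ((norm (fourier (coord_mult i p F) \<xi>))\<^sup>2))"
proof -
  let ?b = "\<lambda>p. norm (fourier (coord_mult i p F) \<xi>)"
  have bound: "?b p \<le> (\<integral>x. norm (F x) \<partial>lborel)" for p
    by (rule norm_fourier_coord_mult_le[OF F])
  note w = weighted_square_sum_le[of ?b, OF norm_ge_zero bound]
  have "ennreal ((norm (fourier F (\<xi> + \<delta> *\<^sub>R axis i 1)))\<^sup>2) \<le> ennreal ((\<Sum>p. taylor_weight p * ?b p)\<^sup>2)"
    by (intro ennreal_leI power_mono fourier_shift_le assms) auto
  also have "\<dots> \<le> ennreal (exp (2 * pi) * (\<Sum>p. taylor_weight p * (?b p)\<^sup>2))"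
    by (intro ennreal_leI w(3))
  also have "\<dots> = ennreal (exp (2 * pi)) * (\<Sum>p. ennreal (taylor_weight p * (?b p)\<^sup>2))"
    by (subst suminf_ennreal2[OF _ w(2)]) (auto simp: ennreal_mult suminf_nonneg[OF w(2)])
  finally show ?thesis
    by (simp add: ennreal_mult)
qed

text \<open>Majorant of \<open>\<bar>F^\<bar>\<^sup>2\<close> on a whole unit cell in terms of transforms at a single lattice point, to
  which Bessel's inequality applies.\<close>

definition cell_bound :: "(real^2 \<Rightarrow> complex) \<Rightarrow> int \<times> int \<Rightarrow> ennreal" where
  "cell_bound F m = ennreal (exp (2 * pi)) * (\<Sum>p. ennreal (taylor_weight p) * (ennreal (exp (2 * pi)) *
     (\<Sum>q. ennreal (taylor_weight q) * ennreal ((norm (fourier (coord_mult 2 q (coord_mult 1 p F)) (lattice m)))\<^sup>2))))"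

definition cell :: "int \<times> int \<Rightarrow> (real^2) set" where
  "cell m = {x. \<lfloor>x $ 1\<rfloor> = fst m \<and> \<lfloor>x $ 2\<rfloor> = snd m}"

lemma fourier_le_cell_bound:
  assumes F: "bdd_on_square F" and \<xi>: "\<xi> \<in> cell m"
  shows "ennreal ((norm (fourier F \<xi>))\<^sup>2) \<le> cell_bound F m"
proof -
  define d1 where "d1 = \<xi> $ 1 - of_int (fst m)"
  define d2 where "d2 = \<xi> $ 2 - of_int (snd m)"
  have d: "\<bar>d1\<bar> \<le> 1" "\<bar>d2\<bar> \<le> 1"
    using \<xi> unfolding cell_def d1_def d2_def by (auto simp: abs_le_iff) linarith+
  \<comment> \<open>The lattice point is left in the second coordinate and then in the first, so the
    outer expansion is in coordinate 1 and each of its terms is expanded in coordinate 2.\<close>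
  have \<xi>_eq: "\<xi> = (lattice m + d2 *\<^sub>R axis 2 1) + d1 *\<^sub>R axis 1 1"
    by (simp add: vec_eq_iff forall_2 axis_def d1_def d2_def)
  have "ennreal ((norm (fourier F \<xi>))\<^sup>2) \<le> ennreal (exp (2 * pi)) *
      (\<Sum>p. ennreal (taylor_weight p) * ennreal ((norm (fourier (coord_mult 1 p F) (lattice m + d2 *\<^sub>R axis 2 1)))\<^sup>2))"
    by (subst \<xi>_eq) (rule fourier_shift_sq_le[OF F d(1)])
  also have "\<dots> \<le> cell_bound F m"
    unfolding cell_bound_def
    by (intro mult_left_mono suminf_le fourier_shift_sq_le bdd_on_square_coord_mult F d(2)) auto
  finally show ?thesis .
qed

text \<open>Bessel's inequality applies to each \<open>coord_mult 2 q (coord_mult 1 p F)\<close>,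
  whose norm is at most that of \<open>F\<close>. Each coordinate contributes one factor
  \<open>exp (2 * pi)\<close> from Cauchy-Schwarz and one from the sum of the weights, hence
  \<open>exp (8 * pi)\<close>.\<close>

lemma sum_cell_bound_le:
  assumes F: "bdd_on_square F" and S: "finite S"
  shows "(\<Sum>m\<in>S. cell_bound F m) \<le> ennreal (exp (8 * pi)) * sq_integral F"
proof -
  let ?W = "ennreal (exp (2 * pi))"
  let ?B = "\<lambda>p q m. ennreal ((norm (fourier (coord_mult 2 q (coord_mult 1 p F)) (lattice m)))\<^sup>2)"
  have W: "(\<Sum>p. ennreal (taylor_weight p)) = ?W"
    using taylor_weight_sums by (simp add: sums_iff suminf_ennreal2)
  have swap: "(\<Sum>m\<in>S. \<Sum>p. f p m) = (\<Sum>p. \<Sum>m\<in>S. f p m)" for f :: "nat \<Rightarrow> int \<times> int \<Rightarrow> ennreal"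
    by (subst suminf_sum) auto
  have "(\<Sum>m\<in>S. cell_bound F m) = ?W * (\<Sum>p. ennreal (taylor_weight p) * (?W * (\<Sum>q. ennreal (taylor_weight q) * (\<Sum>m\<in>S. ?B p q m))))"
    unfolding cell_bound_def by (simp add: sum_distrib_left[symmetric] swap)
  also have "\<dots> \<le> ?W * (\<Sum>p. ennreal (taylor_weight p) * (?W * (\<Sum>q. ennreal (taylor_weight q) * sq_integral F)))"
  proof (intro mult_left_mono suminf_le)
    fix p q
    have "(\<Sum>m\<in>S. ?B p q m) \<le> sq_integral (coord_mult 2 q (coord_mult 1 p F))"
      by (intro fourier_bessel bdd_on_square_coord_mult F S)
    also have "\<dots> \<le> sq_integral F"
      by (intro order_trans[OF sq_integral_coord_mult_le sq_integral_coord_mult_le] bdd_on_square_coord_mult F)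
    finally show "(\<Sum>m\<in>S. ?B p q m) \<le> sq_integral F" .
  qed auto
  also have "\<dots> = ?W * ?W * ?W * ?W * sq_integral F"
    by (simp add: W mult_ac)
  also have "?W * ?W * ?W * ?W = ennreal (exp (8 * pi))"
    by (simp add: ennreal_mult[symmetric] exp_add[symmetric])
  finally show ?thesis .
qed

section \<open>Length of the curves in unit cells\<close>

text \<open>On \<open>E\<close> the inverse of \<open>p\<close> is \<open>L\<close>-Lipschitz. The
  preimages of \<open>n\<close> equal subintervals have diameter at most \<open>L * l / n\<close>,
  so these covers have total diameter at most \<open>L * l\<close> however fine they are. The
  half-open range keeps the index of the last piece below \<open>n\<close>.\<close>

lemma hausdorff1_outer_le_projection:
  fixes E :: "'a::metric_space set" and p :: "'a \<Rightarrow> real"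
  assumes "0 \<le> L" and lip: "\<And>x y. x \<in> E \<Longrightarrow> y \<in> E \<Longrightarrow> dist x y \<le> L * \<bar>p x - p y\<bar>"
    and range: "\<And>x. x \<in> E \<Longrightarrow> a \<le> p x \<and> p x < a + l"
  shows "hausdorff1_outer E \<le> ennreal (L * l)"
proof (cases "E = {}")
  case False
  then have l: "0 < l" using range by fastforce
  show ?thesis
    unfolding hausdorff1_outer_def
  proof (rule SUP_least)
    fix \<delta> :: real assume "\<delta> \<in> {0<..}"
    then have \<delta>: "0 < \<delta>" by simp
    obtain n where n: "L * l / \<delta> < real n" using reals_Archimedean2 by blast
    have n0: "0 < real n" using n \<open>0 \<le> L\<close> l \<delta> by (smt (verit) divide_nonneg_pos mult_nonneg_nonneg)
    define d where "d = L * l / real n"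
    have d: "0 \<le> d" "d \<le> \<delta>"
      using n n0 \<delta> \<open>0 \<le> L\<close> l by (auto simp: d_def field_simps)
    define U where "U i = (if i < n then {x \<in> E. real i \<le> (p x - a) * n / l \<and> (p x - a) * n / l < real i + 1} else {})" for i
    have U_dist: "dist x y \<le> d" if "x \<in> U i" "y \<in> U i" for i x y
    proof -
      have xy: "x \<in> E" "y \<in> E" and "\<bar>(p x - a) * n / l - (p y - a) * n / l\<bar> \<le> 1"
        using that by (auto simp: U_def split: if_splits)
      moreover have "(p x - a) * n / l - (p y - a) * n / l = (p x - p y) * (n / l)"
        by (simp add: diff_divide_distrib algebra_simps)
      ultimately have "\<bar>p x - p y\<bar> * (n / l) \<le> 1"
        using n0 l by (simp add: abs_mult)
      then have "\<bar>p x - p y\<bar> \<le> l / n"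
        using n0 l by (simp add: field_simps)
      then have "L * \<bar>p x - p y\<bar> \<le> L * (l / n)"
        using \<open>0 \<le> L\<close> by (rule mult_left_mono)
      then show ?thesis
        using lip[OF xy] by (simp add: d_def)
    qed
    have diam: "diameter (U i) \<le> d" for i
      using d U_dist[of _ i] unfolding diameter_def by (auto intro!: cSUP_least)
    have bdd: "bounded (U i)" for i
      unfolding bounded_def using U_dist[of _ i] by (cases "U i = {}") blast+
    have cov: "E \<subseteq> (\<Union>i. U i)"
    proof
      fix x assume x: "x \<in> E"
      let ?s = "(p x - a) * n / l"
      have s: "0 \<le> ?s" "?s < n"
        using range[OF x] n0 l mult_strict_right_mono[of "p x - a" l "real n"] by (auto simp: divide_less_eq mult_ac)
      have "real (nat \<lfloor>?s\<rfloor>) \<le> ?s" "?s < real (nat \<lfloor>?s\<rfloor>) + 1"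
        using s by (auto simp: of_nat_nat) 
      moreover have "nat \<lfloor>?s\<rfloor> < n"
        using s by linarith
      ultimately have "x \<in> U (nat \<lfloor>?s\<rfloor>)"
        using x by (simp add: U_def)
      then show "x \<in> (\<Union>i. U i)" by blast
    qed
    have "hausdorff1_pre \<delta> E \<le> (\<Sum>i. ennreal (diameter (U i)))"
      using bdd diam d cov by (intro hausdorff1_pre_le) (auto intro: order_trans)
    also have "\<dots> = (\<Sum>i<n. ennreal (diameter (U i)))"
      by (rule suminf_finite) (auto simp: U_def)
    also have "\<dots> \<le> (\<Sum>i<n. ennreal d)"
      by (intro sum_mono ennreal_leI diam)
    also have "\<dots> = ennreal (L * l)"
      using n0 d by (simp add: d_def ennreal_of_nat_eq_real_of_nat ennreal_mult[symmetric])
    finally show "hausdorff1_pre \<delta> E \<le> ennreal (L * l)" .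
  qed
qed simp

lemma hausdorff1_outer_UN_finite:
  "finite S \<Longrightarrow> hausdorff1_outer (\<Union>i\<in>S. A i) \<le> (\<Sum>i\<in>S. hausdorff1_outer (A i))"
proof (induction S rule: finite_induct)
  case (insert i S)
  then show ?case
    using hausdorff1_outer_Un_le[of "A i" "\<Union>i\<in>S. A i"] by (auto intro: order_trans add_left_mono)
qed simp

lemma hausdorff1_outer_UN_card:
  assumes "finite S" "card S \<le> n" "\<And>i. i \<in> S \<Longrightarrow> hausdorff1_outer (A i) \<le> ennreal c" "0 \<le> c"
  shows "hausdorff1_outer (\<Union>i\<in>S. A i) \<le> ennreal (n * c)"
proof -
  have "hausdorff1_outer (\<Union>i\<in>S. A i) \<le> (\<Sum>i\<in>S. hausdorff1_outer (A i))"
    using assms by (intro hausdorff1_outer_UN_finite)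
  also have "\<dots> \<le> (\<Sum>i\<in>S. ennreal c)"
    using assms by (intro sum_mono)
  also have "\<dots> \<le> ennreal (n * c)"
    using assms by (auto simp: ennreal_of_nat_eq_real_of_nat ennreal_mult[symmetric] intro!: ennreal_leI mult_right_mono)
  finally show ?thesis .
qed

text \<open>Counts the windows of the spiral, or the circles, that meet a given cell: two of them
  have nearby indices because the cell is small.\<close>

lemma finite_card_of_diff_le:
  fixes S :: "nat set"
  assumes "\<And>i j. i \<in> S \<Longrightarrow> j \<in> S \<Longrightarrow> i \<le> j + d"
  shows "finite S \<and> card S \<le> Suc d"
proof (cases "S = {}")
  case False
  define m where "m = (LEAST i. i \<in> S)"
  have "m \<in> S" "\<And>i. i \<in> S \<Longrightarrow> m \<le> i"
    using False unfolding m_def by (auto intro: LeastI Least_le)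
  then have "S \<subseteq> {m..m + d}"
    using assms by auto
  then show ?thesis
    using card_mono[of "{m..m+d}" S] finite_subset[of S "{m..m+d}"] by simp
qed simp

lemma norm_le_abs2: "norm (x :: real^2) \<le> \<bar>x $ 1\<bar> + \<bar>x $ 2\<bar>"
  using norm_le_l1_cart[of x] by (simp add: sum_2)

lemma cell_dist:
  assumes "x \<in> cell m" "y \<in> cell m"
  shows "dist x y \<le> 2"
proof -
  have "\<bar>x $ 1 - y $ 1\<bar> \<le> 1" "\<bar>x $ 2 - y $ 2\<bar> \<le> 1"
    using assms by (auto simp: cell_def abs_le_iff) linarith+
  then show ?thesis
    using norm_le_abs2[of "x - y"] by (simp add: dist_norm)
qed

section \<open>Arcs in polar coordinates\<close>

definition polar :: "real \<Rightarrow> real \<Rightarrow> real^2" where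
  "polar r t = vector [r * cos (2 * pi * t), r * sin (2 * pi * t)]"

lemma polar_nth [simp]: "polar r t $ 1 = r * cos (2 * pi * t)" "polar r t $ 2 = r * sin (2 * pi * t)"
  by (simp_all add: polar_def)

lemma norm_polar [simp]: "norm (polar r t) = \<bar>r\<bar>"
proof -
  have "(norm (polar r t))\<^sup>2 = r\<^sup>2"
    by (simp add: norm_vec_def L2_set_def sum_2 power_mult_distrib distrib_left[symmetric])
  then show ?thesis
    by (metis abs_norm_cancel power2_eq_iff abs_minus_cancel)
qed

text \<open>Angular window of width a quarter turn, on which one of the coordinates is a
  bi-Lipschitz parameter.\<close>

definition window :: "nat \<Rightarrow> real set" where
  "window l = {real l / 4 - 1/8 .. real l / 4 + 1/8}"

text \<open>On the window \<open>4 * pi * (t - l / 4)\<close> stays within \<open>\<pi> / 2\<close>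
  of 0, so its cosine is nonnegative. This cosine is \<open>cos (4 * pi * t)\<close> up to the sign
  \<open>(-1) ^ l\<close>, and the double angle formulas turn the sign into the two bounds.\<close>

lemma window_cos_sin:
  assumes "t \<in> window l"
  shows "even l \<Longrightarrow> 1/2 \<le> (cos (2 * pi * t))\<^sup>2" "odd l \<Longrightarrow> 1/2 \<le> (sin (2 * pi * t))\<^sup>2"
proof -
  have "\<bar>t - l / 4\<bar> \<le> 1/8"
    using assms unfolding window_def atLeastAtMost_iff abs_le_iff by linarith
  then have "4 * pi * \<bar>t - l / 4\<bar> \<le> 4 * pi * (1/8)"
    by (intro mult_left_mono) auto
  moreover have "\<bar>4 * pi * (t - l / 4)\<bar> = 4 * pi * \<bar>t - l / 4\<bar>"
    by (subst abs_mult) simp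
  ultimately have "\<bar>4 * pi * (t - l / 4)\<bar> \<le> pi / 2"
    by linarith
  then have "0 \<le> cos (4 * pi * (t - l / 4))"
    using cos_ge_zero[of "4 * pi * (t - l / 4)"] unfolding abs_le_iff by linarith
  also have "4 * pi * (t - l / 4) = 2 * (2 * pi * t) - l * pi"
    by (simp add: algebra_simps)
  also have "cos (2 * (2 * pi * t) - l * pi) = (-1) ^ l * cos (2 * (2 * pi * t))"
    by (simp add: cos_diff)
  finally have *: "0 \<le> (-1) ^ l * cos (2 * (2 * pi * t))" .
  show "1/2 \<le> (cos (2 * pi * t))\<^sup>2" if "even l"
    using * that cos_double_cos[of "2 * pi * t"] by simp
  show "1/2 \<le> (sin (2 * pi * t))\<^sup>2" if "odd l"
    using * that cos_double_sin[of "2 * pi * t"] by simp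
qed

lemma sq_half_imp_abs:
  fixes c s :: real
  assumes "1/2 \<le> c\<^sup>2" "c\<^sup>2 + s\<^sup>2 = 1"
  shows "7/10 \<le> \<bar>c\<bar>" "\<bar>s\<bar> \<le> \<bar>c\<bar>"
proof -
  have "(7/10)\<^sup>2 \<le> \<bar>c\<bar>\<^sup>2" using assms by (simp add: power2_eq_square)
  then show "7/10 \<le> \<bar>c\<bar>" by (rule power2_le_imp_le) auto
  have "\<bar>s\<bar>\<^sup>2 \<le> \<bar>c\<bar>\<^sup>2" using assms by simp
  then show "\<bar>s\<bar> \<le> \<bar>c\<bar>" by (rule power2_le_imp_le) auto
qed

text \<open>Mean value theorem for \<open>f\<close> and for \<open>g\<close>, at two possibly
  different points: per unit of the parameter \<open>f\<close> moves by at most \<open>A\<close> and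
  \<open>g\<close> by at least \<open>B\<close>. It exhibits one coordinate of an arc as a Lipschitz
  function of the other.\<close>

lemma arc_projection:
  fixes f g f' g' :: "real \<Rightarrow> real"
  assumes f: "\<And>t. t \<in> {u..v} \<Longrightarrow> (f has_real_derivative f' t) (at t)"
    and g: "\<And>t. t \<in> {u..v} \<Longrightarrow> (g has_real_derivative g' t) (at t)"
    and fb: "\<And>t. t \<in> {u..v} \<Longrightarrow> \<bar>f' t\<bar> \<le> A" and gb: "\<And>t. t \<in> {u..v} \<Longrightarrow> B \<le> \<bar>g' t\<bar>"
    and "0 < B" "s \<in> {u..v}" "t \<in> {u..v}"
  shows "\<bar>f s - f t\<bar> \<le> A / B * \<bar>g s - g t\<bar>"
proof -
  have main: "\<bar>f s - f t\<bar> \<le> A / B * \<bar>g s - g t\<bar>" if "s < t" "s \<in> {u..v}" "t \<in> {u..v}" for s t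
  proof -
    have df: "(f has_real_derivative f' x) (at x)" and dg: "(g has_real_derivative g' x) (at x)" if "s \<le> x" "x \<le> t" for x
      using that \<open>s \<in> _\<close> \<open>t \<in> _\<close> by (auto intro!: f g)
    obtain y where y: "s < y" "y < t" "f t - f s = (t - s) * f' y"
      using MVT2[OF \<open>s < t\<close>, of f f', OF df] by blast
    obtain z where z: "s < z" "z < t" "g t - g s = (t - s) * g' z"
      using MVT2[OF \<open>s < t\<close>, of g g', OF dg] by blast
    have "\<bar>f t - f s\<bar> \<le> (t - s) * A"
      unfolding y(3) abs_mult using y that fb[of y] by (auto intro!: mult_mono)
    moreover have "(t - s) * B \<le> \<bar>g t - g s\<bar>"
      unfolding z(3) abs_mult using z that gb[of z] \<open>0 < B\<close> by (auto intro!: mult_mono)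
    moreover have "0 \<le> A" using fb[of s] that by auto
    ultimately have "\<bar>f t - f s\<bar> * B \<le> A * \<bar>g t - g s\<bar>"
      using \<open>0 < B\<close> by (smt (verit, ccfv_SIG) mult.assoc mult.commute mult_left_mono)
    then show ?thesis
      using \<open>0 < B\<close> by (simp add: field_simps abs_minus_commute)
  qed
  show ?thesis
    using main[of s t] main[of t s] assms(6,7) by (cases s t rule: linorder_cases) (auto simp: abs_minus_commute)
qed

lemma polar_derivative:
  "((\<lambda>t. (a + b * t) * cos (2 * pi * t)) has_real_derivative
     b * cos (2 * pi * t) - 2 * pi * (a + b * t) * sin (2 * pi * t)) (at t)"
  "((\<lambda>t. (a + b * t) * sin (2 * pi * t)) has_real_derivative
     b * sin (2 * pi * t) + 2 * pi * (a + b * t) * cos (2 * pi * t)) (at t)"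
  by (auto intro!: derivative_eq_intros simp: algebra_simps)

text \<open>On a window the angular part dominates. As \<open>b \<le> r\<close> and
  \<open>\<bar>s\<bar> \<le> \<bar>c\<bar>\<close>, the lower bounds follow from
  \<open>(6 - 1) * r * \<bar>c\<bar>\<close> and \<open>5 * 7/10 > 3\<close>, the upper ones from
  \<open>r0 + 11 * r0\<close>. The second pair of signs serves the windows in which sine and cosine
  exchange their roles.\<close>

lemma radial_derivative_bounds:
  fixes b r c s r0 :: real
  assumes "0 \<le> b" "b \<le> r0" "r0 \<le> r" "r \<le> 5/4 * r0" "1/2 \<le> c\<^sup>2" "c\<^sup>2 + s\<^sup>2 = 1"
  shows "3 * r0 \<le> \<bar>b * s + 2 * pi * r * c\<bar>" "\<bar>b * c - 2 * pi * r * s\<bar> \<le> 12 * r0"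
    "3 * r0 \<le> \<bar>b * s - 2 * pi * r * c\<bar>" "\<bar>b * c + 2 * pi * r * s\<bar> \<le> 12 * r0"
proof -
  note cs = sq_half_imp_abs[OF assms(5,6)]
  have c1: "\<bar>c\<bar> \<le> 1" using assms(6) by (metis abs_square_le_1 le_add_same_cancel1 zero_le_power2)
  have s1: "\<bar>s\<bar> \<le> 1" using cs c1 by simp
  have r: "0 \<le> r0" "0 \<le> r" using assms by auto
  have bs: "\<bar>b * s\<bar> \<le> r * \<bar>c\<bar>"
    unfolding abs_mult using assms cs by (intro mult_mono) auto
  have bc: "\<bar>b * c\<bar> \<le> r0"
    unfolding abs_mult using mult_mono[of "\<bar>b\<bar>" r0 "\<bar>c\<bar>" 1] assms c1 by simp
  have lo: "6 * (r * \<bar>c\<bar>) \<le> \<bar>2 * pi * r * c\<bar>"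
  proof -
    have "6 * (r * \<bar>c\<bar>) \<le> 2 * pi * (r * \<bar>c\<bar>)"
      using pi_gt3 r by (intro mult_right_mono) auto
    then show ?thesis using r by (simp add: abs_mult)
  qed
  have rc: "7/10 * r0 \<le> r * \<bar>c\<bar>"
    using mult_mono[of r0 r "7/10" "\<bar>c\<bar>"] assms cs r by simp
  have hi: "\<bar>2 * pi * r * s\<bar> \<le> 11 * r0"
  proof -
    have "\<bar>s\<bar>\<^sup>2 \<le> 1/2" using assms by simp
    also have "(1/2::real) \<le> (3/4)\<^sup>2" by (simp add: power2_eq_square)
    finally have "\<bar>s\<bar> \<le> 3/4" by (rule power2_le_imp_le) simp
    have "2 * pi * r * \<bar>s\<bar> \<le> 8 * (5/4 * r0) * 1"
      using pi_less_4 assms r s1 by (intro mult_mono) auto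
    also have "\<dots> \<le> 11 * r0" using r by simp
    finally show ?thesis using r by (simp add: abs_mult)
  qed
  show "3 * r0 \<le> \<bar>b * s + 2 * pi * r * c\<bar>" "3 * r0 \<le> \<bar>b * s - 2 * pi * r * c\<bar>"
    using bs lo rc by linarith+
  show "\<bar>b * c - 2 * pi * r * s\<bar> \<le> 12 * r0" "\<bar>b * c + 2 * pi * r * s\<bar> \<le> 12 * r0"
    using bc hi by linarith+
qed

text \<open>The affine radius treats both curves at once: \<open>a = 0\<close> belongs to the spiral
  and \<open>b = 0\<close> to a circle.\<close>

definition polar_arc :: "real \<Rightarrow> real \<Rightarrow> nat \<Rightarrow> (real^2) set" where
  "polar_arc a b l = (\<lambda>t. polar (a + b * t) t) ` window l"

text \<open>On an even window the second coordinate, on an odd one the first, has derivative at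
  least \<open>3 * r0\<close> in modulus, the other one at most \<open>12 * r0\<close>. Inside a
  cell the arc is therefore a graph of Lipschitz constant 4 over part of a unit interval, and
  \<open>1 + 4 = 5\<close>.\<close>

lemma hausdorff1_arc_cell:
  assumes b: "0 \<le> b" "b \<le> a + b * (real l / 4 - 1/8)" "0 < a + b * (real l / 4 - 1/8)"
  shows "hausdorff1_outer (polar_arc a b l \<inter> cell m) \<le> ennreal 5"
proof -
  define u where "u = real l / 4 - 1/8"
  define v where "v = real l / 4 + 1/8"
  have W: "window l = {u..v}" by (simp add: window_def u_def v_def)
  define r0 where "r0 = a + b * u"
  have r0: "0 < r0" "b \<le> r0" using b by (auto simp: r0_def u_def)
  have r: "r0 \<le> a + b * t" "a + b * t \<le> 5/4 * r0" if "t \<in> {u..v}" for t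
  proof -
    have t: "u \<le> t" "t \<le> u + 1/4" using that by (auto simp: u_def v_def)
    show "r0 \<le> a + b * t" using t b by (auto simp: r0_def intro!: mult_left_mono)
    have "b * t \<le> b * (u + 1/4)" using t b by (intro mult_left_mono)
    then show "a + b * t \<le> 5/4 * r0" using r0 by (simp add: r0_def algebra_simps)
  qed
  let ?x = "\<lambda>t. (a + b * t) * cos (2 * pi * t)" and ?y = "\<lambda>t. (a + b * t) * sin (2 * pi * t)"
  show ?thesis
  proof (cases "even l")
    case True
    have *: "\<bar>?x s - ?x t\<bar> \<le> 12 * r0 / (3 * r0) * \<bar>?y s - ?y t\<bar>" if "s \<in> {u..v}" "t \<in> {u..v}" for s t
    proof (rule arc_projection[OF polar_derivative _ _ _ that])
      fix z assume z: "z \<in> {u..v}"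
      have c: "1/2 \<le> (cos (2 * pi * z))\<^sup>2" using window_cos_sin(1)[of z l] z True W by simp
      note rr = radial_derivative_bounds[OF b(1) r0(2) r[OF z] c sin_cos_squared_add2]
      show "\<bar>b * cos (2 * pi * z) - 2 * pi * (a + b * z) * sin (2 * pi * z)\<bar> \<le> 12 * r0" by (rule rr)
      show "3 * r0 \<le> \<bar>b * sin (2 * pi * z) + 2 * pi * (a + b * z) * cos (2 * pi * z)\<bar>" by (rule rr)
    qed (use r0 in auto)
    have "hausdorff1_outer (polar_arc a b l \<inter> cell m) \<le> ennreal (5 * 1)"
    proof (rule hausdorff1_outer_le_projection[where p = "\<lambda>x. x $ 2" and a = "of_int (snd m)"])
      fix p q assume "p \<in> polar_arc a b l \<inter> cell m" "q \<in> polar_arc a b l \<inter> cell m"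
      then obtain s t where st: "s \<in> {u..v}" "t \<in> {u..v}" "p = polar (a + b * s) s" "q = polar (a + b * t) t"
        by (auto simp: polar_arc_def W)
      show "dist p q \<le> 5 * \<bar>p $ 2 - q $ 2\<bar>"
        using norm_le_abs2[of "p - q"] *[OF st(1,2)] r0 by (simp add: st(3,4) dist_norm)
    qed (auto simp: cell_def, linarith+)
    then show ?thesis by simp
  next
    case False
    have *: "\<bar>?y s - ?y t\<bar> \<le> 12 * r0 / (3 * r0) * \<bar>?x s - ?x t\<bar>" if "s \<in> {u..v}" "t \<in> {u..v}" for s t
    proof (rule arc_projection[OF polar_derivative(2,1) _ _ _ that])
      fix z assume z: "z \<in> {u..v}"
      have c: "1/2 \<le> (sin (2 * pi * z))\<^sup>2" using window_cos_sin(2)[of z l] z False W by simp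
      note rr = radial_derivative_bounds[OF b(1) r0(2) r[OF z] c sin_cos_squared_add]
      show "\<bar>b * sin (2 * pi * z) + 2 * pi * (a + b * z) * cos (2 * pi * z)\<bar> \<le> 12 * r0" by (rule rr)
      show "3 * r0 \<le> \<bar>b * cos (2 * pi * z) - 2 * pi * (a + b * z) * sin (2 * pi * z)\<bar>" by (rule rr)
    qed (use r0 in auto)
    have "hausdorff1_outer (polar_arc a b l \<inter> cell m) \<le> ennreal (5 * 1)"
    proof (rule hausdorff1_outer_le_projection[where p = "\<lambda>x. x $ 1" and a = "of_int (fst m)"])
      fix p q assume "p \<in> polar_arc a b l \<inter> cell m" "q \<in> polar_arc a b l \<inter> cell m"
      then obtain s t where st: "s \<in> {u..v}" "t \<in> {u..v}" "p = polar (a + b * s) s" "q = polar (a + b * t) t"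
        by (auto simp: polar_arc_def W)
      show "dist p q \<le> 5 * \<bar>p $ 1 - q $ 1\<bar>"
        using norm_le_abs2[of "p - q"] *[OF st(1,2)] r0 by (simp add: st(3,4) dist_norm)
    qed (auto simp: cell_def, linarith+)
    then show ?thesis by simp
  qed
qed

section \<open>The spiral and the circles inside a cell\<close>

lemma spiral_polar: "spiral \<eta> = {polar (\<eta> * t) t | t. 0 \<le> t}"
  by (simp add: spiral_def polar_def)

lemma nearest_window:
  assumes "0 \<le> t"
  shows "\<exists>l. t \<in> window l"
proof -
  define l where "l = nat \<lfloor>4 * t + 1/2\<rfloor>"
  have "real l \<le> 4 * t + 1/2" "4 * t + 1/2 < real l + 1"
    using assms by (auto simp: l_def)
  then have "t \<in> window l" by (auto simp: window_def)
  then show ?thesis ..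
qed

text \<open>The arc estimate needs a radius of at least \<open>\<eta>\<close>, that is,
  \<open>t \<ge> 1\<close> on the whole window. The centre \<open>t < 5/4\<close> is therefore
  treated separately, and the windows \<open>l \<ge> 5\<close> cover the rest. The total is
  \<open>44 + 15 * 5 = 119\<close>.\<close>

lemma hausdorff1_spiral_cell:
  assumes \<eta>: "7/10 < \<eta>" "\<eta> < 3/2"
  shows "hausdorff1_outer (spiral \<eta> \<inter> cell m) \<le> ennreal 120"
proof -
  define E0 where "E0 = (\<lambda>t. polar (\<eta> * t) t) ` {0..<5/4}"
  define S where "S = {l. 5 \<le> l \<and> polar_arc 0 \<eta> l \<inter> cell m \<noteq> {}}"
  have lip: "\<bar>\<eta> * s * cos (2 * pi * s) - \<eta> * t * cos (2 * pi * t)\<bar> \<le> 11 * \<eta> / 1 * \<bar>s - t\<bar>"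
    "\<bar>\<eta> * s * sin (2 * pi * s) - \<eta> * t * sin (2 * pi * t)\<bar> \<le> 11 * \<eta> / 1 * \<bar>s - t\<bar>"
    if "s \<in> {0..5/4}" "t \<in> {0..5/4}" for s t
  proof -
    have bound: "\<bar>x\<bar> \<le> 11 * \<eta>" if "\<bar>x\<bar> \<le> \<eta> * 1 + 2 * pi * (\<eta> * z) * 1" "z \<in> {0..5/4}" for x z
    proof -
      have "2 * pi * (\<eta> * z) \<le> 8 * (\<eta> * (5/4))"
        using that pi_less_4 \<eta> by (intro mult_mono) auto
      then show ?thesis using that by simp
    qed
    have tri: "\<bar>\<eta> * c - 2 * pi * (\<eta> * z) * s\<bar> \<le> \<eta> * 1 + 2 * pi * (\<eta> * z) * 1"
      "\<bar>\<eta> * c + 2 * pi * (\<eta> * z) * s\<bar> \<le> \<eta> * 1 + 2 * pi * (\<eta> * z) * 1"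
      if "\<bar>c\<bar> \<le> 1" "\<bar>s\<bar> \<le> 1" "0 \<le> z" for c s z
    proof -
      have "\<eta> * \<bar>c\<bar> \<le> \<eta> * 1" "2 * pi * (\<eta> * z) * \<bar>s\<bar> \<le> 2 * pi * (\<eta> * z) * 1"
        using that \<eta> by (intro mult_left_mono; simp)+
      then have "\<bar>\<eta> * c\<bar> \<le> \<eta> * 1" "\<bar>2 * pi * (\<eta> * z) * s\<bar> \<le> 2 * pi * (\<eta> * z) * 1"
        using that \<eta> by (simp_all add: abs_mult)
      then show "\<bar>\<eta> * c - 2 * pi * (\<eta> * z) * s\<bar> \<le> \<eta> * 1 + 2 * pi * (\<eta> * z) * 1"
        "\<bar>\<eta> * c + 2 * pi * (\<eta> * z) * s\<bar> \<le> \<eta> * 1 + 2 * pi * (\<eta> * z) * 1" by linarith+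
    qed
    show "\<bar>\<eta> * s * cos (2 * pi * s) - \<eta> * t * cos (2 * pi * t)\<bar> \<le> 11 * \<eta> / 1 * \<bar>s - t\<bar>"
      using that polar_derivative(1)[of 0 \<eta>]
      by (intro arc_projection[where f = "\<lambda>s. \<eta> * s * cos (2 * pi * s)" and u = 0 and v = "5/4" and g = "\<lambda>s. s"
            and g' = "\<lambda>_. 1" and f' = "\<lambda>t. \<eta> * cos (2 * pi * t) - 2 * pi * (\<eta> * t) * sin (2 * pi * t)"])
        (auto intro!: bound tri)
    show "\<bar>\<eta> * s * sin (2 * pi * s) - \<eta> * t * sin (2 * pi * t)\<bar> \<le> 11 * \<eta> / 1 * \<bar>s - t\<bar>"
      using that polar_derivative(2)[of 0 \<eta>]
      by (intro arc_projection[where f = "\<lambda>s. \<eta> * s * sin (2 * pi * s)" and u = 0 and v = "5/4" and g = "\<lambda>s. s"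
            and g' = "\<lambda>_. 1" and f' = "\<lambda>t. \<eta> * sin (2 * pi * t) + 2 * pi * (\<eta> * t) * cos (2 * pi * t)"])
        (auto intro!: bound tri)
  qed
  \<comment> \<open>Both coordinates have derivative at most \<open>11 * \<eta>\<close> in modulus
    while the radius has derivative \<open>\<eta>\<close>, which gives 22; the radius stays below
    \<open>3/2 * (5/4) < 2\<close>.\<close>
  have E0: "hausdorff1_outer E0 \<le> ennreal (22 * 2)"
  proof (rule hausdorff1_outer_le_projection[where p = norm and a = 0])
    fix p q assume "p \<in> E0" "q \<in> E0"
    then obtain s t where st: "s \<in> {0..<5/4}" "t \<in> {0..<5/4}" "p = polar (\<eta> * s) s" "q = polar (\<eta> * t) t"
      by (auto simp: E0_def)
    have "dist p q \<le> 22 * (\<eta> * \<bar>s - t\<bar>)"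
      using norm_le_abs2[of "p - q"] lip[of s t] st by (simp add: dist_norm)
    also have "\<eta> * \<bar>s - t\<bar> = \<bar>norm p - norm q\<bar>"
      using st \<eta> by (simp add: abs_mult right_diff_distrib[symmetric])
    finally show "dist p q \<le> 22 * \<bar>norm p - norm q\<bar>" .
  next
    fix p assume "p \<in> E0"
    then obtain s where s: "s \<in> {0..<5/4}" "p = polar (\<eta> * s) s"
      by (auto simp: E0_def)
    have "\<eta> * s \<le> 3/2 * (5/4)" using s \<eta> by (intro mult_mono) auto
    then show "0 \<le> norm p \<and> norm p < 0 + 2"
      using s \<eta> by simp
  qed simp
  \<comment> \<open>Points of one cell are at distance at most 2, so their parameters differ by at
    most \<open>2 / \<eta> < 3\<close>, and the indices of the windows by at most
    \<open>4 * 3 + 1\<close>.\<close>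
  have "i \<le> j + 14" if ij: "i \<in> S" "j \<in> S" for i j
  proof -
    obtain p q where "p \<in> polar_arc 0 \<eta> i \<inter> cell m" "q \<in> polar_arc 0 \<eta> j \<inter> cell m"
      using ij unfolding S_def by blast
    moreover from this obtain s t where st: "s \<in> window i" "t \<in> window j" "p = polar (\<eta> * s) s" "q = polar (\<eta> * t) t"
      by (auto simp: polar_arc_def)
    ultimately have "dist p q \<le> 2" by (auto intro: cell_dist)
    then have "\<bar>norm p - norm q\<bar> \<le> 2"
      using norm_triangle_ineq3[of p q] by (simp add: dist_norm)
    moreover have pos: "0 \<le> s" "0 \<le> t" using st ij by (auto simp: window_def S_def)
    ultimately have "\<bar>\<eta> * s - \<eta> * t\<bar> \<le> 2"
      using st \<eta> by simp
    then have "\<eta> * \<bar>s - t\<bar> \<le> 2" using \<eta> by (simp add: abs_mult right_diff_distrib[symmetric])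
    moreover have "7/10 * \<bar>s - t\<bar> \<le> \<eta> * \<bar>s - t\<bar>" using \<eta> by (intro mult_right_mono) auto
    ultimately have "\<bar>s - t\<bar> \<le> 3" by simp
    then have "real i \<le> real j + 14"
      using st by (auto simp: window_def)
    then show ?thesis by linarith
  qed
  from finite_card_of_diff_le[of S, OF this] have S: "finite S" "card S \<le> 15" by auto
  have sub: "spiral \<eta> \<inter> cell m \<subseteq> E0 \<union> (\<Union>l\<in>S. polar_arc 0 \<eta> l \<inter> cell m)"
  proof
    fix p assume p: "p \<in> spiral \<eta> \<inter> cell m"
    then obtain t where t: "0 \<le> t" "p = polar (\<eta> * t) t" by (auto simp: spiral_polar)
    then obtain l where l: "t \<in> window l" using nearest_window by blast
    show "p \<in> E0 \<union> (\<Union>l\<in>S. polar_arc 0 \<eta> l \<inter> cell m)"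
    proof (cases "t < 5/4")
      case False
      then have "5 \<le> real l" using l by (auto simp: window_def)
      moreover have "p \<in> polar_arc 0 \<eta> l" using l t by (auto simp: polar_arc_def)
      ultimately show ?thesis using p by (auto simp: S_def)
    qed (use t in \<open>auto simp: E0_def\<close>)
  qed
  have "hausdorff1_outer (spiral \<eta> \<inter> cell m) \<le> hausdorff1_outer E0 + hausdorff1_outer (\<Union>l\<in>S. polar_arc 0 \<eta> l \<inter> cell m)"
    by (rule order_trans[OF hausdorff1_outer_mono[OF sub] hausdorff1_outer_Un_le])
  also have "\<dots> \<le> ennreal (22 * 2) + ennreal (15 * 5)"
  proof (intro add_mono E0)
    have "hausdorff1_outer (polar_arc 0 \<eta> l \<inter> cell m) \<le> ennreal 5" if "l \<in> S" for l
    proof (rule hausdorff1_arc_cell)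
      have "1 \<le> real l / 4 - 1/8" using that by (auto simp: S_def)
      then have "\<eta> * 1 \<le> \<eta> * (real l / 4 - 1/8)" using \<eta> by (intro mult_left_mono) auto
      then show "\<eta> \<le> 0 + \<eta> * (real l / 4 - 1/8)" "0 < 0 + \<eta> * (real l / 4 - 1/8)" "0 \<le> \<eta>" using \<eta> by auto
    qed
    then show "hausdorff1_outer (\<Union>l\<in>S. polar_arc 0 \<eta> l \<inter> cell m) \<le> ennreal (15 * 5)"
      using hausdorff1_outer_UN_card[OF S, of "\<lambda>l. polar_arc 0 \<eta> l \<inter> cell m" 5] by simp
  qed
  also have "\<dots> \<le> ennreal 120"
    by (subst ennreal_plus[symmetric]) auto
  finally show ?thesis .
qed

lemma circle_polar:
  assumes "(p $ 1)\<^sup>2 + (p $ 2)\<^sup>2 = r\<^sup>2" "0 < r"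
  shows "\<exists>t. 0 \<le> t \<and> t < 1 \<and> p = polar r t"
proof -
  have "(p $ 1 / r)\<^sup>2 + (p $ 2 / r)\<^sup>2 = 1"
    using assms by (simp add: power_divide add_divide_distrib[symmetric])
  then obtain t where t: "0 \<le> t" "t < 2 * pi" "p $ 1 / r = cos t" "p $ 2 / r = sin t"
    using sincos_total_2pi by metis
  then have "p = polar r (t / (2 * pi))"
    using assms(2) by (simp add: vec_eq_iff forall_2 field_simps)
  then show ?thesis
    using t by (intro exI[of _ "t / (2 * pi)"]) auto
qed

text \<open>Radii of circles meeting one cell differ by at most 2, and \<open>2 / \<eta> < 3\<close>
  leaves at most three circles. Each is covered by the five windows \<open>0, ..., 4\<close>, and
  every piece has length at most 5 in the cell.\<close>

lemma hausdorff1_circles_cell: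
  assumes \<eta>: "7/10 < \<eta>"
  shows "hausdorff1_outer (concentric_circles \<eta> \<inter> cell m) \<le> ennreal 120"
proof -
  define S where "S = {k::nat. 1 \<le> k \<and> (\<exists>p\<in>cell m. norm p = \<eta> * k)}"
  have "i \<le> j + 2" if ij: "i \<in> S" "j \<in> S" for i j
  proof -
    obtain p q where pq: "p \<in> cell m" "norm p = \<eta> * i" "q \<in> cell m" "norm q = \<eta> * j"
      using ij unfolding S_def by blast
    then have "\<bar>\<eta> * i - \<eta> * j\<bar> \<le> 2"
      using norm_triangle_ineq3[of p q] cell_dist[of p m q] by (simp add: dist_norm)
    then have "\<eta> * \<bar>real i - real j\<bar> \<le> 2" using \<eta> by (simp add: abs_mult right_diff_distrib[symmetric])
    moreover have "7/10 * \<bar>real i - real j\<bar> \<le> \<eta> * \<bar>real i - real j\<bar>" using \<eta> by (intro mult_right_mono) auto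
    ultimately have "7/10 * \<bar>real i - real j\<bar> \<le> 2" by linarith
    then have "real i - real j < 3"
      using abs_ge_self[of "real i - real j"] by simp
    then show ?thesis by linarith
  qed
  from finite_card_of_diff_le[of S, OF this] have S: "finite S" "card S \<le> 3" by auto
  have sub: "concentric_circles \<eta> \<inter> cell m \<subseteq> (\<Union>k\<in>S. \<Union>l\<in>{..4}. polar_arc (\<eta> * k) 0 l \<inter> cell m)"
  proof
    fix p assume p: "p \<in> concentric_circles \<eta> \<inter> cell m"
    then obtain k :: nat where k: "1 \<le> k" "(p $ 1)\<^sup>2 + (p $ 2)\<^sup>2 = (\<eta> * k)\<^sup>2"
      by (auto simp: concentric_circles_def power_mult_distrib)
    have pos: "0 < \<eta> * k" using k \<eta> by simp
    obtain t where t: "0 \<le> t" "t < 1" "p = polar (\<eta> * k) t"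
      using circle_polar[OF k(2) pos] by blast
    obtain l where l: "t \<in> window l" using nearest_window[OF t(1)] by blast
    have "real l < 5" using l t by (auto simp: window_def)
    then have "l \<le> 4" by linarith
    moreover have "p \<in> polar_arc (\<eta> * k) 0 l" using l t by (auto simp: polar_arc_def)
    moreover have "k \<in> S" using k(1) p pos norm_polar[of "\<eta> * k" t] unfolding S_def t(3)[symmetric] by (auto intro!: bexI[of _ p])
    ultimately show "p \<in> (\<Union>k\<in>S. \<Union>l\<in>{..4}. polar_arc (\<eta> * k) 0 l \<inter> cell m)" using p by auto
  qed
  have "hausdorff1_outer (\<Union>l\<in>{..4::nat}. polar_arc (\<eta> * k) 0 l \<inter> cell m) \<le> ennreal (real 5 * 5)" if "k \<in> S" for k :: nat
    using that \<eta> by (intro hausdorff1_outer_UN_card hausdorff1_arc_cell) (auto simp: S_def)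
  then have "hausdorff1_outer (\<Union>k\<in>S. \<Union>l\<in>{..4}. polar_arc (\<eta> * k) 0 l \<inter> cell m) \<le> ennreal (real 3 * (real 5 * 5))"
    by (rule hausdorff1_outer_UN_card[OF S]) simp_all
  then have "hausdorff1_outer (concentric_circles \<eta> \<inter> cell m) \<le> ennreal (real 3 * (real 5 * 5))"
    using hausdorff1_outer_mono[OF sub] by (rule order_trans[rotated])
  also have "\<dots> \<le> ennreal 120" by (intro ennreal_leI) simp
  finally show ?thesis .
qed

section \<open>Measurability of the curves\<close>

lemma closed_circle: "closed {p :: real^2. (p $ 1)\<^sup>2 + (p $ 2)\<^sup>2 = c}"
  by (intro closed_Collect_eq continuous_intros)

lemma concentric_circles_sets [measurable]: "concentric_circles \<eta> \<in> sets borel"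
proof -
  have "concentric_circles \<eta> = (\<Union>k\<in>{1..}. {p. (p $ 1)\<^sup>2 + (p $ 2)\<^sup>2 = \<eta>\<^sup>2 * (real k)\<^sup>2})"
    by (auto simp: concentric_circles_def)
  also have "\<dots> \<in> sets borel"
    by (intro sets.countable_UN' borel_closed closed_circle countableI_type image_subsetI)
  finally show ?thesis .
qed

lemma continuous_polar: "continuous_on A (\<lambda>t. polar (\<eta> * t) t)"
proof -
  have eq: "polar (\<eta> * t) t = (\<eta> * t * cos (2 * pi * t)) *\<^sub>R axis 1 1 + (\<eta> * t * sin (2 * pi * t)) *\<^sub>R axis 2 1" for t
    by (simp add: vec_eq_iff forall_2 axis_def)
  show ?thesis
    unfolding eq by (intro continuous_intros)
qed

lemma spiral_sets [measurable]: "spiral \<eta> \<in> sets borel"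
proof -
  have "spiral \<eta> = (\<Union>n::nat. (\<lambda>t. polar (\<eta> * t) t) ` {0..real n})"
    unfolding spiral_polar
  proof (intro subset_antisym subsetI)
    fix p assume "p \<in> {polar (\<eta> * t) t | t. 0 \<le> t}"
    then obtain t where "0 \<le> t" "p = polar (\<eta> * t) t" by blast
    moreover obtain n :: nat where "t \<le> real n" using real_arch_simple by blast
    ultimately show "p \<in> (\<Union>n::nat. (\<lambda>t. polar (\<eta> * t) t) ` {0..real n})"
      by (intro UN_I[of n] image_eqI[of _ _ t]) auto
  qed auto
  also have "\<dots> \<in> sets borel"
    by (intro sets.countable_UN' borel_closed compact_imp_closed compact_continuous_image continuous_polar countableI_type image_subsetI compact_Icc)
  finally show ?thesis .
qed

section \<open>Trace inequality\<close>

text \<open>The integral is split over the cells: on each of them the integrand is at most the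
  constant \<open>cell_bound F m\<close>, the curve has length at most \<open>c\<close>, and
  Bessel's inequality controls the sum of the constants. The bijection \<open>e\<close> turns the
  sum over cells into a series whose partial sums run over finite sets of cells.\<close>

lemma trace_inequality:
  assumes \<Gamma> [measurable]: "\<Gamma> \<in> sets borel" and F: "bdd_on_square F"
    and cells: "\<And>m. hausdorff1_outer (\<Gamma> \<inter> cell m) \<le> ennreal c"
  shows "(\<integral>\<^sup>+\<xi>. ennreal ((norm (fourier F \<xi>))\<^sup>2) \<partial>restrict_space hausdorff1 \<Gamma>)
    \<le> ennreal c * (ennreal (exp (8 * pi)) * sq_integral F)"
proof -
  have [measurable]: "cell m \<in> sets borel" for m
    unfolding cell_def by measurable
  define e where "e = from_nat_into (UNIV :: (int \<times> int) set)"
  have "infinite (UNIV :: (int \<times> int) set)"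
    by (simp add: finite_prod)
  then have e: "bij e"
    unfolding e_def by (intro bij_betw_from_nat_into) auto
  have "(\<integral>\<^sup>+\<xi>. ennreal ((norm (fourier F \<xi>))\<^sup>2) \<partial>restrict_space hausdorff1 \<Gamma>)
      = (\<integral>\<^sup>+\<xi>. ennreal ((norm (fourier F \<xi>))\<^sup>2) * indicator \<Gamma> \<xi> \<partial>hausdorff1)"
    by (intro nn_integral_restrict_space) simp
  also have "\<dots> \<le> (\<integral>\<^sup>+\<xi>. (\<Sum>n. cell_bound F (e n) * indicator (\<Gamma> \<inter> cell (e n)) \<xi>) \<partial>hausdorff1)"
  proof (rule nn_integral_mono)
    fix \<xi> :: "real^2"
    obtain n where n: "e n = (\<lfloor>\<xi> $ 1\<rfloor>, \<lfloor>\<xi> $ 2\<rfloor>)"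
      using e by (metis bij_pointE)
    have cell: "\<xi> \<in> cell (e n)" by (simp add: cell_def n)
    have "ennreal ((norm (fourier F \<xi>))\<^sup>2) * indicator \<Gamma> \<xi> \<le> cell_bound F (e n) * indicator (\<Gamma> \<inter> cell (e n)) \<xi>"
      using fourier_le_cell_bound[OF F cell] cell by (auto simp: indicator_def)
    also have "\<dots> = (\<Sum>k\<in>{n}. cell_bound F (e k) * indicator (\<Gamma> \<inter> cell (e k)) \<xi>)"
      by (subst sum.insert) (simp_all only: finite.emptyI empty_iff not_False_eq_True sum.empty add_0_right)
    also have "\<dots> \<le> (\<Sum>n. cell_bound F (e n) * indicator (\<Gamma> \<inter> cell (e n)) \<xi>)"
      by (intro sum_le_suminf) auto
    finally show "ennreal ((norm (fourier F \<xi>))\<^sup>2) * indicator \<Gamma> \<xi>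
      \<le> (\<Sum>n. cell_bound F (e n) * indicator (\<Gamma> \<inter> cell (e n)) \<xi>)" .
  qed
  also have "\<dots> = (\<Sum>n. cell_bound F (e n) * emeasure hausdorff1 (\<Gamma> \<inter> cell (e n)))"
    by (subst nn_integral_suminf) (auto simp: nn_integral_cmult_indicator cong: measurable_cong_sets)
  also have "\<dots> \<le> (\<Sum>n. cell_bound F (e n) * ennreal c)"
    using cells by (intro suminf_le mult_left_mono) (auto simp: emeasure_hausdorff1)
  also have "\<dots> = ennreal c * (\<Sum>n. cell_bound F (e n))"
    by (simp add: mult.commute)
  also have "\<dots> \<le> ennreal c * (ennreal (exp (8 * pi)) * sq_integral F)"
  proof (intro mult_left_mono suminf_le_const)
    fix n
    have "inj_on e {..<n}" using e by (metis bij_betw_def inj_on_subset subset_UNIV)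
    then have "(\<Sum>i<n. cell_bound F (e i)) = (\<Sum>m\<in>e ` {..<n}. cell_bound F m)"
      by (simp add: sum.reindex)
    also have "\<dots> \<le> ennreal (exp (8 * pi)) * sq_integral F"
      by (intro sum_cell_bound_le F) simp
    finally show "(\<Sum>i<n. cell_bound F (e i)) \<le> ennreal (exp (8 * pi)) * sq_integral F" .
  qed auto
  finally show ?thesis .
qed

definition trace_const :: real where "trace_const = 120 * exp (8 * pi)"

lemma trace_const_pos: "0 < trace_const"
  by (simp add: trace_const_def)

definition trace_sq :: "(real^2) set \<Rightarrow> (real^2 \<Rightarrow> complex) \<Rightarrow> ennreal" where
  "trace_sq \<Gamma> F = (\<integral>\<^sup>+\<xi>. ennreal ((norm (fourier F \<xi>))\<^sup>2) \<partial>restrict_space hausdorff1 \<Gamma>)"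

definition is_curve :: "real \<Rightarrow> (real^2) set \<Rightarrow> bool" where
  "is_curve \<eta> \<Gamma> \<longleftrightarrow> \<Gamma> = spiral \<eta> \<or> \<Gamma> = concentric_circles \<eta>"

lemma is_curve_sets: "is_curve \<eta> \<Gamma> \<Longrightarrow> \<Gamma> \<in> sets borel"
  by (auto simp: is_curve_def spiral_sets concentric_circles_sets)

lemma curve_trace_inequality:
  assumes \<Gamma>: "is_curve \<eta> \<Gamma>" and \<eta>: "7/10 < \<eta>" "\<eta> < 3/2" and F: "bdd_on_square F"
  shows "trace_sq \<Gamma> F \<le> ennreal trace_const * sq_integral F"
proof -
  have "trace_sq \<Gamma> F \<le> ennreal 120 * (ennreal (exp (8 * pi)) * sq_integral F)"
    unfolding trace_sq_def
    using \<Gamma> hausdorff1_spiral_cell[OF \<eta>] hausdorff1_circles_cell[OF \<eta>(1)]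
    by (intro trace_inequality is_curve_sets[OF \<Gamma>] F) (auto simp: is_curve_def)
  then show ?thesis
    by (simp add: trace_const_def ennreal_mult mult.assoc)
qed

section \<open>Straightness of the curves near the diagonal direction\<close>

lemma norm_cis_diff_le: "norm (cis x - cis y) \<le> \<bar>x - y\<bar>"
proof -
  have "cis x - cis y = cis y * (cis (x - y) - 1)"
    by (simp add: algebra_simps cis_mult)
  then have "norm (cis x - cis y) = norm (exp (\<i> * of_real (x - y)) - 1)"
    by (simp add: norm_mult cis_conv_exp)
  also have "\<dots> = 2 * \<bar>sin ((x - y) / 2)\<bar>"
    by (rule dist_exp_i_1)
  also have "\<dots> \<le> \<bar>x - y\<bar>"
    using abs_sin_x_le_abs_x[of "(x - y) / 2"] by simp
  finally show ?thesis .
qed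

text \<open>Near the frequency \<open>R\<close> in diagonal direction the curve is almost straight: a point at
  distance \<open>\<rho>\<close> from the origin with transversal coordinate \<open>v\<close> has longitudinal
  coordinate \<open>u = \<rho> - O(v\<^sup>2 / R)\<close>.\<close>

lemma phase_bound:
  fixes u v R \<eta> t \<beta> :: real
  assumes \<eta>: "7/10 < \<eta>" and "0 < R" "0 \<le> t" and uv: "u\<^sup>2 + v\<^sup>2 = (\<eta> * t)\<^sup>2"
    and phase: "0 < u \<Longrightarrow> norm (1 - cis (2 * pi * t - \<beta>)) * (\<eta> * t) \<le> 2 * \<bar>v\<bar>"
  shows "norm (1 - cis (2 * pi * (u / \<eta>) - \<beta>)) \<le> 12 * (\<bar>u - R\<bar> + \<bar>v\<bar> + v\<^sup>2) / R"
proof (cases "u \<le> R / 2")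
  case True
  have "norm (1 - cis (2 * pi * (u / \<eta>) - \<beta>)) \<le> 2"
    using norm_triangle_ineq4[of 1 "cis (2 * pi * (u / \<eta>) - \<beta>)"] by simp
  also have "2 \<le> 12 * (\<bar>u - R\<bar> + \<bar>v\<bar> + v\<^sup>2) / R"
  proof -
    have "2 * R \<le> 12 * (\<bar>u - R\<bar> + \<bar>v\<bar> + v\<^sup>2)"
    proof -
      have "2 * R \<le> 12 * (x + y + z)" if "- (u - R) \<le> x" "0 \<le> y" "0 \<le> z" for x y z
        using that True \<open>0 < R\<close> by argo
      then show ?thesis by simp
    qed
    then show ?thesis using \<open>0 < R\<close> by (simp add: le_divide_eq)
  qed
  finally show ?thesis .
next
  case False
  then have u: "R / 2 < u" "0 < u" using \<open>0 < R\<close> by auto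
  define \<rho> where "\<rho> = \<eta> * t"
  have "u\<^sup>2 \<le> \<rho>\<^sup>2" using uv zero_le_power2[of v] unfolding \<rho>_def by linarith
  moreover have "0 \<le> \<rho>" using \<eta> \<open>0 \<le> t\<close> by (simp add: \<rho>_def)
  ultimately have "u \<le> \<rho>" by (rule power2_le_imp_le)
  have eq: "(\<rho> - u) * (\<rho> + u) = v\<^sup>2"
    using uv by (simp add: \<rho>_def power2_eq_square algebra_simps)
  have "(\<rho> - u) * R \<le> (\<rho> - u) * (\<rho> + u)"
    using u \<open>u \<le> \<rho>\<close> by (intro mult_left_mono) auto
  then have vR: "\<rho> - u \<le> v\<^sup>2 / R"
    using \<open>0 < R\<close> eq by (simp add: field_simps)
  \<comment> \<open>In the applications \<open>2 * pi * t - \<beta>\<close> is a multiple of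
    \<open>2 * pi\<close> on the circles; on the spiral it is the angle between the point and the
    diagonal, whose sine is \<open>v / \<rho>\<close>.\<close>
  have n1: "norm (1 - cis (2 * pi * t - \<beta>)) \<le> 4 * \<bar>v\<bar> / R"
  proof -
    have "norm (1 - cis (2 * pi * t - \<beta>)) * (R / 2) \<le> norm (1 - cis (2 * pi * t - \<beta>)) * \<rho>"
      using u \<open>u \<le> \<rho>\<close> by (intro mult_left_mono) auto
    also have "\<dots> \<le> 2 * \<bar>v\<bar>" using phase u by (simp add: \<rho>_def)
    finally show ?thesis using \<open>0 < R\<close> by (simp add: field_simps)
  qed
  have n2: "norm (cis (2 * pi * t - \<beta>) - cis (2 * pi * (u / \<eta>) - \<beta>)) \<le> 12 * v\<^sup>2 / R"
  proof -
    have "norm (cis (2 * pi * t - \<beta>) - cis (2 * pi * (u / \<eta>) - \<beta>)) \<le> \<bar>2 * pi * t - \<beta> - (2 * pi * (u / \<eta>) - \<beta>)\<bar>"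
      by (rule norm_cis_diff_le)
    also have "2 * pi * t - \<beta> - (2 * pi * (u / \<eta>) - \<beta>) = (2 * pi / \<eta>) * (\<rho> - u)"
      using \<eta> by (simp add: \<rho>_def field_simps)
    also have "\<bar>(2 * pi / \<eta>) * (\<rho> - u)\<bar> = (2 * pi / \<eta>) * (\<rho> - u)"
      using \<eta> \<open>u \<le> \<rho>\<close> by simp
    also have "\<dots> \<le> 12 * (v\<^sup>2 / R)"
    proof (intro mult_mono vR)
      have "2 * pi \<le> 12 * \<eta>" using \<eta> pi_less_4 by simp
      then show "2 * pi / \<eta> \<le> 12" using \<eta> by (simp add: field_simps)
    qed (use \<open>u \<le> \<rho>\<close> in auto)
    finally show ?thesis by simp
  qed
  have "norm (1 - cis (2 * pi * (u / \<eta>) - \<beta>)) \<le> norm (1 - cis (2 * pi * t - \<beta>)) +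
      norm (cis (2 * pi * t - \<beta>) - cis (2 * pi * (u / \<eta>) - \<beta>))"
    using norm_triangle_ineq[of "1 - cis (2 * pi * t - \<beta>)" "cis (2 * pi * t - \<beta>) - cis (2 * pi * (u / \<eta>) - \<beta>)"] by simp
  also have "\<dots> \<le> 4 * \<bar>v\<bar> / R + 12 * v\<^sup>2 / R" using n1 n2 by simp
  also have "\<dots> \<le> 12 * (\<bar>u - R\<bar> + \<bar>v\<bar> + v\<^sup>2) / R"
    using \<open>0 < R\<close> by (simp add: add_divide_distrib[symmetric] divide_right_mono)
  finally show ?thesis .
qed

text \<open>The square of the left side is \<open>2 - 2 * cos x\<close>, and a nonnegative cosine is
  at least its own square, which leaves at most \<open>2 * (sin x)^2\<close>. Without the sign
  condition the estimate fails at \<open>x = pi\<close>.\<close>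

lemma norm_one_minus_cis_le:
  assumes "0 \<le> cos x"
  shows "norm (1 - cis x) \<le> 2 * \<bar>sin x\<bar>"
proof -
  have "(norm (1 - cis x))\<^sup>2 = 2 - 2 * cos x"
    using sin_cos_squared_add[of x] unfolding cmod_power2 by (simp add: power2_eq_square algebra_simps)
  also have "\<dots> \<le> 2 * (1 - (cos x)\<^sup>2)"
    using assms mult_left_mono[OF cos_le_one[of x] assms] by (simp add: power2_eq_square)
  also have "\<dots> \<le> (2 * \<bar>sin x\<bar>)\<^sup>2"
    by (simp add: sin_squared_eq[symmetric])
  finally show ?thesis
    by (rule power2_le_imp_le) simp
qed

text \<open>The spiral meets the diagonal direction at angle \<open>\<pi> / 4\<close>, that is, at radii \<open>\<eta> (k + 1 / 8)\<close> instead
  of \<open>\<eta> k\<close>.\<close>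

definition curve_phase :: "real \<Rightarrow> (real^2) set \<Rightarrow> real" where
  "curve_phase \<eta> \<Gamma> = (if \<Gamma> = concentric_circles \<eta> then 0 else pi / 4)"

text \<open>\<open>u\<close> and \<open>v\<close> are the coordinates along and across the diagonal,
  and the circles have integer parameter \<open>t = k\<close>. On the spiral \<open>u\<close> and
  \<open>v\<close> are \<open>\<eta> * t\<close> times the cosine and the sine of
  \<open>2 * pi * t - pi / 4\<close>; a positive \<open>u\<close> excludes the opposite branch, near
  which this angle is an odd multiple of \<open>pi\<close>.\<close>

lemma curve_phase_bound:
  assumes \<Gamma>: "is_curve \<eta> \<Gamma>" and \<xi>: "\<xi> \<in> \<Gamma>" and \<eta>: "7/10 < \<eta>" and "0 < R"
  defines "u \<equiv> (\<xi> $ 1 + \<xi> $ 2) / sqrt 2" and "v \<equiv> (\<xi> $ 2 - \<xi> $ 1) / sqrt 2"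
  shows "norm (1 - cis (2 * pi * (u / \<eta>) - curve_phase \<eta> \<Gamma>)) \<le> 12 * (\<bar>u - R\<bar> + \<bar>v\<bar> + v\<^sup>2) / R"
proof -
  have uv: "u\<^sup>2 + v\<^sup>2 = (\<xi> $ 1)\<^sup>2 + (\<xi> $ 2)\<^sup>2"
    by (simp add: u_def v_def power_divide power2_eq_square algebra_simps add_divide_distrib[symmetric])
  show ?thesis
  proof (cases "\<Gamma> = concentric_circles \<eta>")
    case True
    then obtain k :: nat where "(\<xi> $ 1)\<^sup>2 + (\<xi> $ 2)\<^sup>2 = (\<eta> * k)\<^sup>2"
      using \<xi> by (auto simp: concentric_circles_def power_mult_distrib)
    moreover have "cis (2 * pi * real k) = 1"
      by (rule cis_multiple_2pi) simp
    ultimately show ?thesis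
      using True uv by (intro phase_bound[where t = k] \<eta> \<open>0 < R\<close>) (auto simp: curve_phase_def)
  next
    case False
    then obtain t where t: "0 \<le> t" "\<xi> = polar (\<eta> * t) t"
      using \<Gamma> \<xi> by (auto simp: is_curve_def spiral_polar)
    have s: "sqrt 2 / 2 = 1 / sqrt 2"
      by (simp add: field_simps)
    have u: "u = \<eta> * t * cos (2 * pi * t - pi / 4)"
      by (simp only: u_def t polar_nth cos_diff cos_45 sin_45 s) (simp add: field_simps)
    have v: "v = \<eta> * t * sin (2 * pi * t - pi / 4)"
      by (simp only: v_def t polar_nth sin_diff cos_45 sin_45 s) (simp add: field_simps)
    show ?thesis
    proof (rule phase_bound[OF \<eta> \<open>0 < R\<close> t(1)])
      show "u\<^sup>2 + v\<^sup>2 = (\<eta> * t)\<^sup>2"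
        unfolding u v power_mult_distrib by (simp add: distrib_left[symmetric])
      assume "0 < u"
      then have "0 \<le> cos (2 * pi * t - pi / 4)"
      proof -
        have "0 \<le> \<eta> * t" using \<eta> t(1) by simp
        then show ?thesis
          using \<open>0 < u\<close> unfolding u by (metis less_eq_real_def mult_nonneg_nonpos not_le)
      qed
      then have "norm (1 - cis (2 * pi * t - pi / 4)) * (\<eta> * t) \<le> 2 * \<bar>sin (2 * pi * t - pi / 4)\<bar> * (\<eta> * t)"
        using \<eta> t(1) by (intro mult_right_mono norm_one_minus_cis_le) auto
      also have "\<dots> = 2 * \<bar>v\<bar>"
        using \<eta> t(1) by (simp add: v abs_mult)
      finally show "norm (1 - cis (2 * pi * t - curve_phase \<eta> \<Gamma>)) * (\<eta> * t) \<le> 2 * \<bar>v\<bar>"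
        using False by (simp add: curve_phase_def)
    qed
  qed
qed

section \<open>Modulated bumps\<close>

definition clamp1 :: "real \<Rightarrow> real" where "clamp1 s = max (-1) (min 1 s)"

lemma clamp1_lipschitz: "\<bar>clamp1 s - clamp1 t\<bar> \<le> \<bar>s - t\<bar>"
  by (auto simp: clamp1_def max_def min_def)

lemma abs_clamp1_le: "\<bar>clamp1 s\<bar> \<le> 1"
  by (auto simp: clamp1_def max_def min_def)

text \<open>The outer square makes the bump and its first derivative vanish at \<open>w\<close> and
  \<open>- w\<close>, so two integrations by parts leave no boundary terms. The clamping gives one
  formula on the whole line, from which the Lipschitz bound follows.\<close>

definition bump :: "real \<Rightarrow> real \<Rightarrow> real" where
  "bump w t = (1 - (clamp1 (t / w))\<^sup>2)\<^sup>2"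

text \<open>First and second derivative of the bump.\<close>

definition bump1 :: "real \<Rightarrow> real \<Rightarrow> real" where
  "bump1 w t = indicator {-w..w} t * (- 4 * t / w^2 * (1 - (t / w)\<^sup>2))"

definition bump2 :: "real \<Rightarrow> real \<Rightarrow> real" where
  "bump2 w t = indicator {-w..w} t * (12 * t^2 / w^4 - 4 / w^2)"

lemma bump_eq: "0 < w \<Longrightarrow> bump w t = indicator {-w..w} t * (1 - (t / w)\<^sup>2)\<^sup>2"
proof (cases "t \<in> {-w..w}")
  case True
  assume "0 < w"
  then have "clamp1 (t / w) = t / w"
    using True unfolding clamp1_def by (auto simp: field_simps)
  then show ?thesis using True by (simp add: bump_def)
next
  case False
  assume "0 < w"
  then have "clamp1 (t / w) = 1 \<or> clamp1 (t / w) = -1"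
    using False unfolding clamp1_def by (auto simp: min_def max_def field_simps)
  then show ?thesis using False by (auto simp: bump_def)
qed

lemma bump_outside: "0 < w \<Longrightarrow> w \<le> \<bar>t\<bar> \<Longrightarrow> bump w t = 0"
proof (cases "t \<in> {-w..w}")
  case True
  assume "0 < w" "w \<le> \<bar>t\<bar>"
  then have "\<bar>t\<bar> = w" using True by auto
  then have "t\<^sup>2 = w\<^sup>2" by (metis power2_abs)
  then show ?thesis using \<open>0 < w\<close> by (simp add: bump_eq power_divide)
qed (simp add: bump_eq)

lemma bump_range: "0 \<le> bump w t" "bump w t \<le> 1"
proof -
  have "(clamp1 (t / w))\<^sup>2 \<le> 1"
    using abs_clamp1_le by (simp add: abs_square_le_1)
  then show "bump w t \<le> 1" "0 \<le> bump w t"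
    unfolding bump_def by (auto intro!: power_le_one)
qed

lemma bump_lipschitz:
  assumes "0 < w"
  shows "\<bar>bump w s - bump w t\<bar> \<le> 4 / w * \<bar>s - t\<bar>"
proof -
  define c d where "c = clamp1 (s / w)" and "d = clamp1 (t / w)"
  have b: "\<bar>c\<bar> \<le> 1" "\<bar>d\<bar> \<le> 1"
    by (simp_all add: c_def d_def abs_clamp1_le)
  then have sq: "c\<^sup>2 \<le> 1" "d\<^sup>2 \<le> 1" by (simp_all add: abs_square_le_1)
  have "bump w s - bump w t = (c - d) * (c + d) * (c\<^sup>2 + d\<^sup>2 - 2)"
    by (simp add: bump_def c_def[symmetric] d_def[symmetric] power2_eq_square algebra_simps)
  then have "\<bar>bump w s - bump w t\<bar> = \<bar>c - d\<bar> * \<bar>c + d\<bar> * \<bar>c\<^sup>2 + d\<^sup>2 - 2\<bar>"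
    by (simp add: abs_mult)
  also have "\<dots> \<le> \<bar>s / w - t / w\<bar> * 2 * 2"
  proof (intro mult_mono)
    show "\<bar>c - d\<bar> \<le> \<bar>s / w - t / w\<bar>" unfolding c_def d_def by (rule clamp1_lipschitz)
    show "\<bar>c + d\<bar> \<le> 2" using b by linarith
    show "\<bar>c\<^sup>2 + d\<^sup>2 - 2\<bar> \<le> 2" using sq zero_le_power2[of c] zero_le_power2[of d] by linarith
  qed auto
  also have "\<bar>s / w - t / w\<bar> = \<bar>s - t\<bar> / w"
    using assms by (simp add: diff_divide_distrib[symmetric])
  finally show ?thesis by simp
qed

lemma bump1_bound: "0 < w \<Longrightarrow> \<bar>bump1 w t\<bar> \<le> 4 / w"
proof (cases "t \<in> {-w..w}")
  case True
  assume w: "0 < w"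
  define r where "r = t / w"
  have r: "\<bar>r\<bar> \<le> 1" using True w by (auto simp: r_def abs_le_iff field_simps)
  then have "r\<^sup>2 \<le> 1" by (simp add: abs_square_le_1)
  then have "\<bar>r\<bar> * \<bar>1 - r\<^sup>2\<bar> \<le> 1 * 1" using r by (intro mult_mono) auto
  moreover have "bump1 w t = - (4 / w) * (r * (1 - r\<^sup>2))"
    using True by (simp add: bump1_def r_def power2_eq_square)
  ultimately show ?thesis
    using w mult_left_mono[of "\<bar>r\<bar> * \<bar>1 - r\<^sup>2\<bar>" 1 "4 / w"] by (simp add: abs_mult)
qed (simp add: bump1_def)

lemma bump2_bound: "0 < w \<Longrightarrow> \<bar>bump2 w t\<bar> \<le> 12 / w^2"
proof (cases "t \<in> {-w..w}")
  case True
  assume w: "0 < w"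
  define r where "r = t / w"
  have r: "\<bar>r\<bar> \<le> 1" using True w by (auto simp: r_def abs_le_iff field_simps)
  then have r2: "0 \<le> r\<^sup>2" "r\<^sup>2 \<le> 1" by (simp_all add: abs_square_le_1)
  have "bump2 w t = (12 * r\<^sup>2 - 4) / w^2"
    using True w by (simp add: bump2_def r_def power2_eq_square power4_eq_xxxx field_simps)
  then have "\<bar>bump2 w t\<bar> = \<bar>12 * r\<^sup>2 - 4\<bar> / w^2"
    by simp
  also have "\<dots> \<le> 12 / w^2"
    using r2 unfolding abs_le_iff by (intro divide_right_mono) (linarith, simp)
  finally show ?thesis .
qed (simp add: bump2_def)

section \<open>One-dimensional transforms and modulated packets\<close>

definition fourier1 :: "(real \<Rightarrow> real) \<Rightarrow> real \<Rightarrow> complex" where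
  "fourier1 p s = (\<integral>t. cis (- 2 * pi * s * t) * of_real (p t) \<partial>lborel)"

text \<open>\<open>P\<close> is differentiable on the whole line and the indicators do the cutting.
  The boundary terms vanish because \<open>P\<close> does at both ends, although the cut-off of
  \<open>P'\<close> may jump there, as the second derivative of the bump does.\<close>

lemma fourier1_by_parts:
  fixes P P' :: "real \<Rightarrow> real"
  assumes "0 < w" "\<And>t. (P has_real_derivative P' t) (at t)" "continuous_on UNIV P'" "P w = 0" "P (- w) = 0"
  shows "fourier1 (\<lambda>t. indicator {-w..w} t * P' t) s = 2 * pi * \<i> * s * fourier1 (\<lambda>t. indicator {-w..w} t * P t) s"
proof -
  define A where "A = - 2 * pi * \<i> * complex_of_real s"
  have cis: "cis (- 2 * pi * s * t) = exp (t *\<^sub>R A)" for t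
    by (simp add: A_def cis_conv_exp scaleR_conv_of_real mult_ac)
  have contP: "continuous_on UNIV P"
    using assms(2) by (meson DERIV_isCont continuous_at_imp_continuous_on)
  have cont: "continuous_on {-w..w} P" "continuous_on {-w..w} P'"
    using contP assms(3) continuous_on_subset by blast+
  let ?f = "\<lambda>t. exp (t *\<^sub>R A) * of_real (P t)"
  let ?f1 = "\<lambda>t. exp (t *\<^sub>R A) * of_real (P' t)" and ?f2 = "\<lambda>t. exp (t *\<^sub>R A) * A * of_real (P t)"
  have int: "integrable lborel (\<lambda>t. indicator {-w..w} t *\<^sub>R ?f1 t)" "integrable lborel (\<lambda>t. indicator {-w..w} t *\<^sub>R ?f2 t)"
    by (intro borel_integrable_compact[unfolded set_integrable_def] compact_Icc continuous_intros cont)+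
  have "(\<integral>t. indicator {-w..w} t *\<^sub>R (?f1 t + ?f2 t) \<partial>lborel) = ?f w - ?f (- w)"
  proof (rule integral_FTC_Icc)
    show "(?f has_vector_derivative ?f1 t + ?f2 t) (at t within {-w..w})" for t
    proof -
      have "((\<lambda>t. complex_of_real (P t)) has_vector_derivative of_real (P' t)) (at t within {-w..w})"
        by (rule has_vector_derivative_of_real) (rule has_field_derivative_at_within[OF assms(2)])
      from has_vector_derivative_mult[OF exp_scaleR_has_vector_derivative_right this]
      have "((\<lambda>t. exp (t *\<^sub>R A) * complex_of_real (P t)) has_vector_derivative
         exp (t *\<^sub>R A) * of_real (P' t) + exp (t *\<^sub>R A) * A * of_real (P t)) (at t within {-w..w})" .
      then show ?thesis .
    qed
    show "continuous_on {-w..w} (\<lambda>t. ?f1 t + ?f2 t)"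
      by (intro continuous_intros cont)
  qed (use assms(1) in linarith)
  then have "(\<integral>t. indicator {-w..w} t *\<^sub>R ?f1 t \<partial>lborel) + (\<integral>t. indicator {-w..w} t *\<^sub>R ?f2 t \<partial>lborel) = 0"
    unfolding scaleR_add_right Bochner_Integration.integral_add[OF int] assms(4,5) of_real_0 mult_zero_right diff_self .
  moreover have "(\<integral>t. indicator {-w..w} t *\<^sub>R ?f1 t \<partial>lborel) = fourier1 (\<lambda>t. indicator {-w..w} t * P' t) s"
    unfolding fourier1_def cis by (intro Bochner_Integration.integral_cong) (auto simp: indicator_def)
  moreover have "(\<integral>t. indicator {-w..w} t *\<^sub>R ?f2 t \<partial>lborel) = A * fourier1 (\<lambda>t. indicator {-w..w} t * P t) s"
    unfolding fourier1_def cis integral_mult_right_zero[symmetric]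
    by (intro Bochner_Integration.integral_cong) (auto simp: indicator_def mult_ac)
  ultimately show ?thesis
    by (simp add: A_def add_eq_0_iff)
qed

lemma fourier1_bump1:
  assumes "0 < w"
  shows "fourier1 (bump1 w) s = 2 * pi * \<i> * s * fourier1 (bump w) s"
  unfolding bump1_def[abs_def] bump_eq[OF assms]
  by (rule fourier1_by_parts[OF assms])
     (use assms in \<open>auto intro!: derivative_eq_intros continuous_intros simp: power2_eq_square\<close>)

lemma fourier1_bump2:
  assumes "0 < w"
  shows "fourier1 (bump2 w) s = 2 * pi * \<i> * s * fourier1 (bump1 w) s"
  unfolding bump1_def[abs_def] bump2_def[abs_def]
  by (rule fourier1_by_parts[OF assms])
     (use assms in \<open>auto intro!: derivative_eq_intros continuous_intros simp: power2_eq_square power4_eq_xxxx field_simps\<close>)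

definition profile :: "real \<Rightarrow> real \<Rightarrow> (real \<Rightarrow> real) \<Rightarrow> bool" where
  "profile w B p \<longleftrightarrow> p \<in> borel_measurable borel \<and> (\<forall>t. \<bar>p t\<bar> \<le> B) \<and> (\<forall>t. t \<notin> {-w..w} \<longrightarrow> p t = 0)"

lemma profile_bump: "0 < w \<Longrightarrow> profile w 1 (bump w)"
proof -
  assume w: "0 < w"
  have eq: "bump w = (\<lambda>t. indicator {-w..w} t * (1 - (t / w)\<^sup>2)\<^sup>2)"
    by (simp add: fun_eq_iff bump_eq[OF w])
  have "bump w \<in> borel_measurable borel"
    unfolding eq by measurable
  then show ?thesis
    using bump_range[of w] bump_outside[OF w] by (auto simp: profile_def)
qed

lemma profile_bump1: "0 < w \<Longrightarrow> profile w (4 / w) (bump1 w)"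
  unfolding profile_def using bump1_bound[of w] by (auto simp: bump1_def[abs_def])

lemma profile_bump2: "0 < w \<Longrightarrow> profile w (12 / w^2) (bump2 w)"
  unfolding profile_def using bump2_bound[of w] by (auto simp: bump2_def[abs_def])

lemma profile_integrable:
  assumes "profile w B p" "0 < w"
  shows "integrable lborel (\<lambda>t. cis (c * t) * complex_of_real (p t))"
proof (rule integrableI_bounded_set[where A = "{-w..w}" and B = B])
  have [measurable]: "p \<in> borel_measurable borel" using assms by (simp add: profile_def)
  show "(\<lambda>t. cis (c * t) * complex_of_real (p t)) \<in> borel_measurable lborel"
    unfolding cis_conv_exp by measurable
qed (use assms in \<open>auto simp: profile_def norm_mult\<close>)

lemma norm_fourier1_le:
  assumes p: "profile w B p" and w: "0 < w"
  shows "norm (fourier1 p s) \<le> 2 * w * B"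
proof -
  have B: "0 \<le> B" using p unfolding profile_def by (meson abs_ge_zero order_trans)
  have int: "integrable lborel (\<lambda>t::real. indicator {-w..w} t *\<^sub>R B)"
    using w by (intro integrable_scaleR_left integrable_real_indicator) auto
  have "norm (fourier1 p s) \<le> (\<integral>t. norm (cis (- 2 * pi * s * t) * complex_of_real (p t)) \<partial>lborel)"
    unfolding fourier1_def by (rule integral_norm_bound)
  also have "\<dots> \<le> (\<integral>t. indicator {-w..w} t *\<^sub>R B \<partial>lborel)"
    using p w by (intro integral_mono integrable_norm profile_integrable[OF p w] int)
      (auto simp: profile_def norm_mult indicator_def)
  also have "\<dots> = 2 * w * B"
    using w by simp
  finally show ?thesis .
qed

text \<open>A tensor product modulated to the frequency \<open>\<xi>0\<close>. Replacing a bump by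
  its first or second derivative multiplies the transform by a constant times a power of the offset
  of that frequency coordinate from \<open>\<xi>0\<close>.\<close>

definition packet :: "(real \<Rightarrow> real) \<Rightarrow> (real \<Rightarrow> real) \<Rightarrow> real^2 \<Rightarrow> real^2 \<Rightarrow> complex" where
  "packet p q \<xi>0 x = cis (2 * pi * (\<xi>0 \<bullet> x)) * of_real (p (x $ 1) * q (x $ 2))"

lemma profile_measurable: "profile w B p \<Longrightarrow> p \<in> borel_measurable borel"
  by (simp add: profile_def)

lemma norm_packet: "norm (packet p q \<xi>0 x) = \<bar>p (x $ 1)\<bar> * \<bar>q (x $ 2)\<bar>"
  by (simp add: packet_def norm_mult abs_mult)

lemma norm_packet_le:
  assumes "profile w B p" "profile w B' q"
  shows "norm (packet p q \<xi>0 x) \<le> B * B'"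
proof -
  have "0 \<le> B" using assms unfolding profile_def by (meson abs_ge_zero order_trans)
  then show ?thesis
    unfolding norm_packet using assms by (intro mult_mono) (auto simp: profile_def)
qed

lemma packet_outside:
  assumes "profile w B p" "profile w B' q" "\<not> (\<bar>x $ 1\<bar> \<le> w \<and> \<bar>x $ 2\<bar> \<le> w)"
  shows "packet p q \<xi>0 x = 0"
  using assms by (auto simp: packet_def profile_def abs_le_iff)

lemma packet_measurable:
  assumes "profile w B p" "profile w B' q"
  shows "packet p q \<xi>0 \<in> borel_measurable borel"
proof -
  have [measurable]: "p \<in> borel_measurable borel" "q \<in> borel_measurable borel"
    using assms by (auto intro: profile_measurable)
  show ?thesis
    unfolding packet_def[abs_def] cis_conv_exp by measurable
qed

lemma bdd_on_square_packet:
  assumes "profile w B p" "profile w B' q" "w \<le> 1/2"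
  shows "bdd_on_square (packet p q \<xi>0)"
  unfolding bdd_on_square_def half_square_def
  using packet_measurable[OF assms(1,2)] norm_packet_le[OF assms(1,2)] packet_outside[OF assms(1,2)] assms(3)
  by (intro conjI exI[of _ "B * B'"]) auto

lemma fourier_packet:
  assumes p: "profile w B p" and q: "profile w B' q" and w: "0 < w"
  shows "fourier (packet p q \<xi>0) \<xi> = fourier1 p (\<xi> $ 1 - \<xi>0 $ 1) * fourier1 q (\<xi> $ 2 - \<xi>0 $ 2)"
proof -
  let ?f = "\<lambda>p s t. cis (- 2 * pi * s * t) * complex_of_real (p t)"
  have eq: "char \<xi> x * packet p q \<xi>0 x = ?f p (\<xi> $ 1 - \<xi>0 $ 1) (x $ 1) * ?f q (\<xi> $ 2 - \<xi>0 $ 2) (x $ 2)" for x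
  proof -
    have "char \<xi> x * cis (2 * pi * (\<xi>0 \<bullet> x)) = cis (- 2 * pi * (\<xi> $ 1 - \<xi>0 $ 1) * x $ 1) * cis (- 2 * pi * (\<xi> $ 2 - \<xi>0 $ 2) * x $ 2)"
      by (simp add: char_cis cis_mult inner_real2 algebra_simps)
    then show ?thesis
      by (simp add: packet_def mult_ac)
  qed
  show ?thesis
    unfolding fourier_char fourier1_def eq
    by (rule integral_real2_product[OF profile_integrable[OF p w] profile_integrable[OF q w]])
qed

lemma sq_integral_le:
  assumes "\<And>x. norm (F x) \<le> B" "\<And>x. x \<notin> A \<Longrightarrow> F x = 0" "A \<in> sets borel"
  shows "sq_integral F \<le> ennreal (B\<^sup>2) * emeasure lborel A"
proof -
  have "sq_integral F \<le> (\<integral>\<^sup>+x. ennreal (B\<^sup>2) * indicator A x \<partial>lborel)"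
    unfolding sq_integral_def using assms
    by (intro nn_integral_mono) (auto simp: indicator_def intro!: ennreal_leI power_mono)
  also have "\<dots> = ennreal (B\<^sup>2) * emeasure lborel A"
    using assms by (simp add: nn_integral_cmult_indicator)
  finally show ?thesis .
qed

lemma sq_integral_packet_le:
  assumes "profile w B p" "profile w B' q" "0 < w"
  shows "sq_integral (packet p q \<xi>0) \<le> ennreal ((2 * w * (B * B'))\<^sup>2)"
proof -
  let ?A = "cbox (vector [-w,-w]) (vector [w,w]) :: (real^2) set"
  have "sq_integral (packet p q \<xi>0) \<le> ennreal ((B * B')\<^sup>2) * emeasure lborel ?A"
  proof (rule sq_integral_le)
    show "norm (packet p q \<xi>0 x) \<le> B * B'" for x by (rule norm_packet_le[OF assms(1,2)])
    show "packet p q \<xi>0 x = 0" if "x \<notin> ?A" for x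
      using that by (intro packet_outside[OF assms(1,2)]) (auto simp: mem_box_cart forall_2 abs_le_iff)
  qed simp
  also have "emeasure lborel ?A = ennreal ((2 * w)\<^sup>2)"
    using assms(3) by (subst emeasure_cbox_vector) (auto simp: power2_eq_square)
  finally show ?thesis
    by (simp add: ennreal_mult'[symmetric] power_mult_distrib mult_ac)
qed

section \<open>The pair of opposite wave packets\<close>

definition diag :: "real \<Rightarrow> real^2" where "diag c = vector [c, c]"

lemma diag_nth [simp]: "diag c $ 1 = c" "diag c $ 2 = c"
  by (simp_all add: diag_def)

text \<open>\<open>diag (R / sqrt 2)\<close> is the vector of length \<open>R\<close> in the
  diagonal direction.\<close>

definition wave :: "real \<Rightarrow> real \<Rightarrow> real^2 \<Rightarrow> complex" where
  "wave w R = packet (bump w) (bump w) (diag (R / sqrt 2))"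

text \<open>The factor \<open>cis (- \<beta>)\<close> shifts the parallel lines on which the
  transform vanishes, so that they fit the phase of the curve.\<close>

definition wave_pair :: "real \<Rightarrow> real \<Rightarrow> real \<Rightarrow> real \<Rightarrow> real^2 \<Rightarrow> complex" where
  "wave_pair w \<alpha> R \<beta> x = wave w R (x - diag \<alpha>) - cis (- \<beta>) * wave w R (x + diag \<alpha>)"

lemma integral_translate:
  fixes h :: "'a::euclidean_space \<Rightarrow> complex"
  assumes [measurable]: "h \<in> borel_measurable borel"
  shows "(\<integral>x. h (c + x) \<partial>lborel) = (\<integral>x. h x \<partial>lborel)"
proof -
  have "(\<integral>x. h x \<partial>lborel) = (\<integral>x. h x \<partial>distr lborel borel ((+) c))"
    by (simp add: lborel_distr_plus)
  then show ?thesis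
    by (simp add: integral_distr)
qed

lemma char_add: "char \<xi> (x + y) = char \<xi> x * char \<xi> y"
  by (simp add: char_cis cis_mult inner_add_right algebra_simps)

lemma fourier_translate:
  assumes [measurable]: "F \<in> borel_measurable borel"
  shows "fourier (\<lambda>x. F (x - a)) \<xi> = char \<xi> a * fourier F \<xi>"
proof -
  have "fourier (\<lambda>x. F (x - a)) \<xi> = (\<integral>x. char \<xi> (a + x) * F (a + x - a) \<partial>lborel)"
    unfolding fourier_char by (subst integral_translate) auto
  also have "\<dots> = char \<xi> a * fourier F \<xi>"
    by (simp add: fourier_char char_add mult.assoc)
  finally show ?thesis .
qed

lemma fourier_integrable:
  assumes "bdd_on_square F"
  shows "integrable lborel (\<lambda>x. char \<xi> x * F x)"
  by (intro bdd_on_square_integrable bdd_on_square_char assms)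

lemma fourier_diff:
  assumes "bdd_on_square F" "bdd_on_square G"
  shows "fourier (\<lambda>x. F x - G x) \<xi> = fourier F \<xi> - fourier G \<xi>"
  using fourier_integrable[OF assms(1), of \<xi>] fourier_integrable[OF assms(2), of \<xi>]
  by (simp add: fourier_char right_diff_distrib)

context
  fixes w \<alpha> R \<beta> :: real
  assumes w: "0 < w" "w \<le> 1/4" and \<alpha>: "1/4 \<le> \<alpha>" "\<alpha> + w \<le> 1/2" and R: "0 < R"
begin

lemma wave_outside: "w \<le> \<bar>x $ 1\<bar> \<or> w \<le> \<bar>x $ 2\<bar> \<Longrightarrow> wave w R x = 0"
  using bump_outside[OF w(1)] by (auto simp: wave_def packet_def)

lemma norm_wave_le: "norm (wave w R x) \<le> 1"
  using norm_packet_le[OF profile_bump profile_bump, OF w(1) w(1)] by (simp add: wave_def)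

lemma wave_measurable [measurable]: "wave w R \<in> borel_measurable borel"
  unfolding wave_def by (rule packet_measurable[OF profile_bump profile_bump, OF w(1) w(1)])

lemma wave_shift_outside:
  assumes "\<bar>c\<bar> = \<alpha>" "\<not> (-1/2 < x $ 1 \<and> x $ 1 < 1/2 \<and> -1/2 < x $ 2 \<and> x $ 2 < 1/2)"
  shows "wave w R (x - diag c) = 0"
  using assms \<alpha> by (intro wave_outside) (auto simp: abs_if split: if_splits)

lemma bdd_on_square_wave_shift:
  assumes "\<bar>c\<bar> = \<alpha>"
  shows "bdd_on_square (\<lambda>x. wave w R (x - diag c))"
  unfolding bdd_on_square_def
proof (intro conjI exI allI impI)
  show "norm (wave w R (x - diag c)) \<le> 1" for x by (rule norm_wave_le)
  show "wave w R (x - diag c) = 0" if "x \<notin> half_square" for x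
    using that by (intro wave_shift_outside assms) (auto simp: half_square_def abs_le_iff)
qed measurable

lemma wave_pair_eq: "wave_pair w \<alpha> R \<beta> x = wave w R (x - diag \<alpha>) - cis (- \<beta>) * wave w R (x - diag (- \<alpha>))"
proof -
  have "x + diag \<alpha> = x - diag (- \<alpha>)"
    by (simp add: vec_eq_iff forall_2)
  then show ?thesis by (simp add: wave_pair_def)
qed

lemma wave_pair_outside:
  assumes "\<not> (-1/2 < x $ 1 \<and> x $ 1 < 1/2 \<and> -1/2 < x $ 2 \<and> x $ 2 < 1/2)"
  shows "wave_pair w \<alpha> R \<beta> x = 0"
  unfolding wave_pair_eq using wave_shift_outside[OF _ assms] \<alpha> by simp

lemma bdd_on_square_wave_pair: "bdd_on_square (wave_pair w \<alpha> R \<beta>)"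
proof -
  have "norm (wave_pair w \<alpha> R \<beta> x) \<le> 1 + 1 * 1" for x
    unfolding wave_pair_def
    by (rule order_trans[OF norm_triangle_ineq4]) (unfold norm_mult, intro add_mono mult_mono norm_wave_le, auto)
  moreover have "wave_pair w \<alpha> R \<beta> \<in> borel_measurable borel"
    unfolding wave_pair_def[abs_def] by measurable
  moreover have "wave_pair w \<alpha> R \<beta> x = 0" if "x \<notin> half_square" for x
    using that by (intro wave_pair_outside) (auto simp: half_square_def abs_le_iff)
  ultimately show ?thesis
    by (auto simp: bdd_on_square_def)
qed

text \<open>The two translations multiply the transform by conjugate phases, and factoring out
  \<open>char \<xi> (diag \<alpha>)\<close> leaves the stated factor. For
  \<open>\<alpha> = 1 / (2 * sqrt 2 * \<eta>)\<close> its argument is the one in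
  \<open>curve_phase_bound\<close>.\<close>

lemma norm_fourier_wave_pair:
  "norm (fourier (wave_pair w \<alpha> R \<beta>) \<xi>)
    = norm (1 - cis (4 * pi * \<alpha> * (\<xi> $ 1 + \<xi> $ 2) - \<beta>)) * norm (fourier (wave w R) \<xi>)"
proof -
  have shift: "fourier (\<lambda>x. wave w R (x - diag c)) \<xi> = char \<xi> (diag c) * fourier (wave w R) \<xi>" for c
    by (rule fourier_translate) measurable
  have b: "bdd_on_square (\<lambda>x. wave w R (x - diag \<alpha>))" "bdd_on_square (\<lambda>x. wave w R (x - diag (- \<alpha>)))"
    using \<alpha> by (auto intro!: bdd_on_square_wave_shift)
  have "fourier (wave_pair w \<alpha> R \<beta>) \<xi> = fourier (\<lambda>x. wave w R (x - diag \<alpha>)) \<xi>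
      - fourier (\<lambda>x. cis (- \<beta>) * wave w R (x - diag (- \<alpha>))) \<xi>"
    unfolding wave_pair_eq[abs_def] by (intro fourier_diff bdd_on_square_mult[where B = 1] b) auto
  also have "fourier (\<lambda>x. cis (- \<beta>) * wave w R (x - diag (- \<alpha>))) \<xi>
      = cis (- \<beta>) * fourier (\<lambda>x. wave w R (x - diag (- \<alpha>))) \<xi>"
    unfolding fourier_char by (simp add: mult.left_commute[of _ "cis (- \<beta>)"])
  finally have "fourier (wave_pair w \<alpha> R \<beta>) \<xi> =
      (char \<xi> (diag \<alpha>) - cis (- \<beta>) * char \<xi> (diag (- \<alpha>))) * fourier (wave w R) \<xi>"
    unfolding shift by (simp add: algebra_simps)
  also have "char \<xi> (diag \<alpha>) - cis (- \<beta>) * char \<xi> (diag (- \<alpha>))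
      = char \<xi> (diag \<alpha>) * (1 - cis (4 * pi * \<alpha> * (\<xi> $ 1 + \<xi> $ 2) - \<beta>))"
    by (simp add: char_cis cis_mult inner_real2 algebra_simps)
  finally show ?thesis
    by (simp add: norm_mult)
qed

lemma fourier_wave:
  "fourier (wave w R) \<xi> = fourier1 (bump w) (\<xi> $ 1 - R / sqrt 2) * fourier1 (bump w) (\<xi> $ 2 - R / sqrt 2)"
  unfolding wave_def using fourier_packet[OF profile_bump profile_bump, OF w(1) w(1) w(1)] by simp

text \<open>The value at 0 is the mean of the pair, which mean-free wavelets cannot reproduce. An
  integration by parts in one coordinate gives \<open>2 / R\<close>, the other coordinate
  contributes its trivial bound \<open>2 * w\<close>, and the pair a factor 2.\<close>

lemma norm_fourier_wave_pair_zero: "norm (fourier (wave_pair w \<alpha> R \<beta>) 0) \<le> 8 * w / R"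
proof -
  let ?s = "- (R / sqrt 2)"
  have b: "norm (fourier1 (bump w) ?s) \<le> 2 * w"
    using norm_fourier1_le[OF profile_bump[OF w(1)] w(1)] by simp
  have "norm (fourier1 (bump1 w) ?s) \<le> 8"
    using norm_fourier1_le[OF profile_bump1[OF w(1)] w(1), of ?s] w by simp
  then have b1: "2 * pi * (R / sqrt 2) * norm (fourier1 (bump w) ?s) \<le> 8"
    unfolding fourier1_bump1[OF w(1)] using R by (simp add: norm_mult norm_divide)
  have "4 * R \<le> 2 * pi * (R / sqrt 2)"
  proof -
    have "sqrt 2 \<le> 3/2"
      by (rule real_le_lsqrt) (auto simp: power2_eq_square)
    then have "4 * sqrt 2 \<le> 2 * pi" using pi_gt3 by linarith
    then have "R * (4 * sqrt 2) \<le> R * (2 * pi)" using R by (intro mult_left_mono) auto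
    then show ?thesis by (simp add: field_simps)
  qed
  then have "4 * R * norm (fourier1 (bump w) ?s) \<le> 8"
    by (intro order_trans[OF _ b1] mult_right_mono) auto
  then have b2: "norm (fourier1 (bump w) ?s) \<le> 2 / R"
    using R by (simp add: field_simps)
  have "norm (fourier (wave w R) 0) \<le> 2 * w * (2 / R)"
    unfolding fourier_wave norm_mult using b b2 w R by (simp only: zero_index diff_0) (intro mult_mono; simp)
  moreover have "norm (1 - cis (4 * pi * \<alpha> * ((0::real^2) $ 1 + 0 $ 2) - \<beta>)) \<le> 2"
    using norm_triangle_ineq4[of 1 "cis (4 * pi * \<alpha> * ((0::real^2) $ 1 + 0 $ 2) - \<beta>)"] by simp
  ultimately have "norm (fourier (wave_pair w \<alpha> R \<beta>) 0) \<le> 2 * (2 * w * (2 / R))"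
    unfolding norm_fourier_wave_pair by (intro mult_mono) auto
  then show ?thesis by simp
qed

text \<open>On the square of side \<open>w\<close> around \<open>diag \<alpha>\<close> each bump
  factor is at least 9/16, and the other wave vanishes because
  \<open>w \<le> 1/4 \<le> \<alpha>\<close>. The modulus is thus at least 81/256, which exceeds
  3/10.\<close>

lemma sq_integral_wave_pair_ge: "ennreal (9/100 * w\<^sup>2) \<le> sq_integral (wave_pair w \<alpha> R \<beta>)"
proof -
  let ?A = "cbox (vector [\<alpha> - w/2, \<alpha> - w/2]) (vector [\<alpha> + w/2, \<alpha> + w/2]) :: (real^2) set"
  have "ennreal (9/100 * w\<^sup>2) = ennreal (9/100) * emeasure lborel ?A"
    using w by (subst emeasure_cbox_vector) (auto simp: power2_eq_square ennreal_mult'[symmetric])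
  also have "\<dots> = (\<integral>\<^sup>+x. ennreal (9/100) * indicator ?A x \<partial>lborel)"
    by (simp add: nn_integral_cmult_indicator)
  also have "\<dots> \<le> sq_integral (wave_pair w \<alpha> R \<beta>)"
    unfolding sq_integral_def
  proof (rule nn_integral_mono)
    fix x :: "real^2"
    show "ennreal (9/100) * indicator ?A x \<le> ennreal ((norm (wave_pair w \<alpha> R \<beta> x))\<^sup>2)"
    proof (cases "x \<in> ?A")
      case True
      then have x: "\<bar>x $ 1 - \<alpha>\<bar> \<le> w / 2" "\<bar>x $ 2 - \<alpha>\<bar> \<le> w / 2"
        unfolding mem_box_cart forall_2 vector_2 abs_le_iff by linarith+
      have "wave w R (x + diag \<alpha>) = 0"
        using x w \<alpha> by (intro wave_outside) (auto simp: abs_le_iff abs_if)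
      have bump: "9/16 \<le> bump w t\<^sub>0 * (1::real)" if "\<bar>t\<^sub>0\<bar> \<le> w / 2" for t\<^sub>0
      proof -
        have t: "t\<^sub>0 \<in> {-w..w}" using that w by (auto simp: abs_le_iff)
        have "\<bar>t\<^sub>0 / w\<bar> \<le> 1/2" using that w by (simp add: field_simps)
        then have "\<bar>t\<^sub>0 / w\<bar>\<^sup>2 \<le> (1/2)\<^sup>2" by (rule power_mono) simp
        then have "3/4 \<le> 1 - (t\<^sub>0 / w)\<^sup>2" by (simp add: power2_eq_square)
        then have "(3/4)\<^sup>2 \<le> (1 - (t\<^sub>0 / w)\<^sup>2)\<^sup>2" by (intro power_mono) auto
        then show ?thesis using t w by (simp add: bump_eq power2_eq_square)
      qed
      have "(9/16) * (9/16) \<le> bump w (x $ 1 - \<alpha>) * bump w (x $ 2 - \<alpha>)"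
        using bump[OF x(1)] bump[OF x(2)] by (intro mult_mono) auto
      also have "\<dots> = norm (wave_pair w \<alpha> R \<beta> x)"
        using \<open>wave w R (x + diag \<alpha>) = 0\<close> bump_range[of w] by (simp add: wave_pair_def wave_def norm_packet)
      finally have "3/10 \<le> norm (wave_pair w \<alpha> R \<beta> x)" by simp
      then have "(3/10)\<^sup>2 \<le> (norm (wave_pair w \<alpha> R \<beta> x))\<^sup>2" by (rule power_mono) simp
      then show ?thesis using True by (simp add: power2_eq_square ennreal_leI)
    qed simp
  qed
  finally show ?thesis .
qed

lemma wave_lipschitz:
  "norm (wave w R x - wave w R y) \<le> (4 / w + 5 * R) * (\<bar>x $ 1 - y $ 1\<bar> + \<bar>x $ 2 - y $ 2\<bar>)"
proof -
  define d1 d2 where "d1 = \<bar>x $ 1 - y $ 1\<bar>" and "d2 = \<bar>x $ 2 - y $ 2\<bar>"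
  let ?c = "\<lambda>x. cis (2 * pi * (diag (R / sqrt 2) \<bullet> x))"
  let ?b = "\<lambda>x::real^2. bump w (x $ 1) * bump w (x $ 2)"
  have c: "norm (?c x - ?c y) \<le> 5 * R * (d1 + d2)"
  proof -
    have "norm (?c x - ?c y) \<le> \<bar>2 * pi * (diag (R / sqrt 2) \<bullet> x) - 2 * pi * (diag (R / sqrt 2) \<bullet> y)\<bar>"
      by (rule norm_cis_diff_le)
    also have "\<dots> = (2 * pi / sqrt 2) * R * \<bar>(x $ 1 - y $ 1) + (x $ 2 - y $ 2)\<bar>"
    proof -
      have "2 * pi * (diag (R / sqrt 2) \<bullet> x) - 2 * pi * (diag (R / sqrt 2) \<bullet> y)
          = (2 * pi / sqrt 2) * R * ((x $ 1 - y $ 1) + (x $ 2 - y $ 2))"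
        by (simp add: inner_real2 diff_divide_distrib add_divide_distrib algebra_simps)
      then show ?thesis using R by (simp add: abs_mult)
    qed
    \<comment> \<open>The slope \<open>2 * pi / sqrt 2\<close> of the phase is below 5, because
      \<open>5 * 63/50 = 6.3\<close> lies above \<open>2 * pi\<close>.\<close>
    also have "\<dots> \<le> 5 * R * (d1 + d2)"
    proof (intro mult_mono)
      have "(63/50)\<^sup>2 \<le> (2::real)" by (simp add: power2_eq_square)
      then have s: "63/50 \<le> sqrt 2" by (rule real_le_rsqrt)
      have "2 * pi \<le> 5 * sqrt 2" using pi_approx(2) s by simp
      then show "2 * pi / sqrt 2 \<le> 5" by (simp add: field_simps)
    qed (use R in \<open>auto simp: d1_def d2_def\<close>)
    finally show ?thesis .
  qed
  have b: "\<bar>?b x - ?b y\<bar> \<le> 4 / w * (d1 + d2)"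
  proof -
    have "?b x - ?b y = (bump w (x $ 1) - bump w (y $ 1)) * bump w (x $ 2) + bump w (y $ 1) * (bump w (x $ 2) - bump w (y $ 2))"
      by (simp add: algebra_simps)
    also have "\<bar>\<dots>\<bar> \<le> \<bar>bump w (x $ 1) - bump w (y $ 1)\<bar> * \<bar>bump w (x $ 2)\<bar> + \<bar>bump w (y $ 1)\<bar> * \<bar>bump w (x $ 2) - bump w (y $ 2)\<bar>"
      by (rule order_trans[OF abs_triangle_ineq]) (simp add: abs_mult)
    also have "\<dots> \<le> (4 / w * d1) * 1 + 1 * (4 / w * d2)"
      unfolding d1_def d2_def using bump_range[of w] bump_lipschitz[OF w(1)] w
      by (intro add_mono mult_mono) auto
    finally show ?thesis by (simp add: algebra_simps add_divide_distrib)
  qed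
  have "wave w R x - wave w R y = ?c x * of_real (?b x - ?b y) + (?c x - ?c y) * of_real (?b y)"
    by (simp add: wave_def packet_def algebra_simps)
  also have "norm \<dots> \<le> \<bar>?b x - ?b y\<bar> + norm (?c x - ?c y) * \<bar>?b y\<bar>"
    by (rule order_trans[OF norm_triangle_ineq]) (simp add: norm_mult del: of_real_diff of_real_mult)
  also have "\<dots> \<le> 4 / w * (d1 + d2) + 5 * R * (d1 + d2) * 1"
  proof (intro add_mono mult_mono b c)
    show "\<bar>?b y\<bar> \<le> 1"
      using bump_range[of w] by (simp add: abs_mult mult_le_one)
  qed (use R in \<open>auto simp: d1_def d2_def\<close>)
  finally show ?thesis by (simp add: d1_def d2_def algebra_simps)
qed

lemma wave_pair_lipschitz:
  "norm (wave_pair w \<alpha> R \<beta> x - wave_pair w \<alpha> R \<beta> y) \<le> (8 / w + 10 * R) * (\<bar>x $ 1 - y $ 1\<bar> + \<bar>x $ 2 - y $ 2\<bar>)"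
proof -
  have "wave_pair w \<alpha> R \<beta> x - wave_pair w \<alpha> R \<beta> y = (wave w R (x - diag \<alpha>) - wave w R (y - diag \<alpha>))
      - cis (- \<beta>) * (wave w R (x + diag \<alpha>) - wave w R (y + diag \<alpha>))"
    by (simp add: wave_pair_def algebra_simps)
  also have "norm \<dots> \<le> norm (wave w R (x - diag \<alpha>) - wave w R (y - diag \<alpha>)) + norm (wave w R (x + diag \<alpha>) - wave w R (y + diag \<alpha>))"
    by (rule order_trans[OF norm_triangle_ineq4]) (simp add: norm_mult)
  also have "\<dots> \<le> (4 / w + 5 * R) * (\<bar>x $ 1 - y $ 1\<bar> + \<bar>x $ 2 - y $ 2\<bar>) + (4 / w + 5 * R) * (\<bar>x $ 1 - y $ 1\<bar> + \<bar>x $ 2 - y $ 2\<bar>)"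
    by (intro add_mono order_trans[OF wave_lipschitz]) simp_all
  finally show ?thesis by (simp add: algebra_simps)
qed

end

section \<open>Trace of the wave pair on the curves\<close>

lemma norm_fourier_measurable_curve:
  assumes "F \<in> borel_measurable borel"
  shows "(\<lambda>\<xi>. ennreal ((norm (fourier F \<xi>))\<^sup>2)) \<in> borel_measurable (restrict_space hausdorff1 \<Gamma>)"
proof (rule measurable_restrict_space1)
  have [measurable]: "fourier F \<in> borel_measurable hausdorff1"
    using fourier_measurable[OF assms] by (simp cong: measurable_cong_sets)
  show "(\<lambda>\<xi>. ennreal ((norm (fourier F \<xi>))\<^sup>2)) \<in> borel_measurable hausdorff1"
    by measurable
qed

text \<open>In the application \<open>x\<close>, \<open>y\<close>, \<open>s\<close> are
  \<open>\<bar>u - R\<bar>\<close>, \<open>\<bar>v\<bar>\<close>, \<open>v\<^sup>2\<close>, and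
  \<open>z1\<close>, \<open>z2\<close> are the frequency offsets from the centre of the packet. Only
  pure powers remain, so each term can be absorbed by derivatives of a single bump. The constant is
  \<open>144 * 16\<close>: 4 from squaring a sum of four terms, 4 from the factor 2 in
  \<open>S\<close>.\<close>

lemma square_sum_bound:
  fixes z1 z2 :: real
  assumes "0 \<le> k" "k \<le> 12 * (x + y + s) / R" "0 < R"
    and "x \<le> \<bar>z1\<bar> + \<bar>z2\<bar>" "y \<le> \<bar>z1\<bar> + \<bar>z2\<bar>" "s \<le> z1\<^sup>2 + z2\<^sup>2"
  shows "k\<^sup>2 \<le> 2304 / R\<^sup>2 * (z1\<^sup>2 + z2\<^sup>2 + z1 ^ 4 + z2 ^ 4)"
proof -
  define S where "S = 2 * \<bar>z1\<bar> + 2 * \<bar>z2\<bar> + z1\<^sup>2 + z2\<^sup>2"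
  have "12 * (x + y + s) \<le> 12 * S"
    using assms by (simp add: S_def)
  then have "12 * (x + y + s) / R \<le> 12 * S / R"
    using \<open>0 < R\<close> by (rule divide_right_mono[OF _ less_imp_le])
  with assms(2) have "k \<le> 12 * S / R" by simp
  then have "k\<^sup>2 \<le> (12 * S / R)\<^sup>2"
    using assms(1) by (rule power_mono)
  also have "\<dots> = 144 / R\<^sup>2 * S\<^sup>2" by (simp add: power_divide power_mult_distrib)
  also have "\<dots> \<le> 144 / R\<^sup>2 * (16 * (z1\<^sup>2 + z2\<^sup>2 + z1 ^ 4 + z2 ^ 4))"
  proof (intro mult_left_mono)
    have four: "(a + b + c + d)\<^sup>2 \<le> 4 * (a\<^sup>2 + b\<^sup>2 + c\<^sup>2 + d\<^sup>2)" for a b c d :: real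
    proof -
      have "4 * (a\<^sup>2 + b\<^sup>2 + c\<^sup>2 + d\<^sup>2) - (a + b + c + d)\<^sup>2
          = (a - b)\<^sup>2 + (a - c)\<^sup>2 + (a - d)\<^sup>2 + (b - c)\<^sup>2 + (b - d)\<^sup>2 + (c - d)\<^sup>2"
        by (simp add: power2_eq_square algebra_simps)
      also have "\<dots> \<ge> 0" by simp
      finally show ?thesis by simp
    qed
    have "S\<^sup>2 \<le> 4 * ((2 * \<bar>z1\<bar>)\<^sup>2 + (2 * \<bar>z2\<bar>)\<^sup>2 + (z1\<^sup>2)\<^sup>2 + (z2\<^sup>2)\<^sup>2)"
      unfolding S_def by (rule four)
    also have "\<dots> \<le> 16 * (z1\<^sup>2 + z2\<^sup>2 + z1 ^ 4 + z2 ^ 4)"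
      by (simp add: power_mult_distrib)
    finally show "S\<^sup>2 \<le> 16 * (z1\<^sup>2 + z2\<^sup>2 + z1 ^ 4 + z2 ^ 4)" .
  qed simp
  finally show ?thesis by simp
qed

text \<open>The squared phase bound consists of second and fourth powers of the frequency offsets.
  Multiplied by the transform of the wave they are dominated by transforms of packets with one bump
  differentiated once or twice, and the trace inequality is applied to these packets; applied to the
  pair itself it would lose the gain \<open>1 / R\<close>.\<close>

lemma wave_pair_trace:
  assumes \<Gamma>: "is_curve \<eta> \<Gamma>" and \<eta>: "7/10 < \<eta>" "\<eta> < 3/2"
    and w: "0 < w" "w \<le> 1/4" and \<alpha>: "1/4 \<le> \<alpha>" "\<alpha> + w \<le> 1/2" and R: "0 < R"
    and \<alpha>\<eta>: "\<alpha> = 1 / (2 * sqrt 2 * \<eta>)"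
  shows "trace_sq \<Gamma> (wave_pair w \<alpha> R (curve_phase \<eta> \<Gamma>)) \<le> ennreal (trace_const * (3000000 / (R\<^sup>2 * w\<^sup>2)))"
proof -
  let ?\<beta> = "curve_phase \<eta> \<Gamma>"
  let ?f = "wave_pair w \<alpha> R ?\<beta>"
  let ?d = "diag (R / sqrt 2)"
  \<comment> \<open>One differentiation for the indices 0 and 1, two for 2 and 3, alternating
    between the coordinates. Larger indices repeat the last case; the sums below run over
    \<open>i < 4\<close>.\<close>
  define G where "G i = (if i = 0 then packet (bump1 w) (bump w) ?d else if i = 1 then packet (bump w) (bump1 w) ?d
     else if i = 2 then packet (bump2 w) (bump w) ?d else packet (bump w) (bump2 w) ?d)" for i :: nat
  note pr = profile_bump[OF w(1)] profile_bump1[OF w(1)] profile_bump2[OF w(1)]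
  have w2: "w \<le> 1/2" using w by simp
  have G: "bdd_on_square (G i)" for i
    unfolding G_def using bdd_on_square_packet[OF _ _ w2] pr by (auto intro: pr)
  have sqG: "sq_integral (G i) \<le> ennreal (if i < 2 then 64 else 576 / w\<^sup>2)" for i
  proof -
    have e: "(2 * w * (4 / w * 1))\<^sup>2 = 64" "(2 * w * (1 * (4 / w)))\<^sup>2 = 64"
      "(2 * w * (12 / w\<^sup>2 * 1))\<^sup>2 = 576 / w\<^sup>2" "(2 * w * (1 * (12 / w\<^sup>2)))\<^sup>2 = 576 / w\<^sup>2"
      using w by (auto simp: power2_eq_square field_simps)
    show ?thesis
      using sq_integral_packet_le[OF pr(2) pr(1) w(1), of ?d] sq_integral_packet_le[OF pr(1) pr(2) w(1), of ?d]
        sq_integral_packet_le[OF pr(3) pr(1) w(1), of ?d] sq_integral_packet_le[OF pr(1) pr(3) w(1), of ?d]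
      unfolding e G_def by auto
  qed
  have fG: "(norm (fourier ?f \<xi>))\<^sup>2 \<le> 2304 / R\<^sup>2 * (\<Sum>i<4. (norm (fourier (G i) \<xi>))\<^sup>2)" if \<xi>: "\<xi> \<in> \<Gamma>" for \<xi>
  proof -
    define u where "u = (\<xi> $ 1 + \<xi> $ 2) / sqrt 2"
    define v where "v = (\<xi> $ 2 - \<xi> $ 1) / sqrt 2"
    define z1 where "z1 = \<xi> $ 1 - R / sqrt 2"
    define z2 where "z2 = \<xi> $ 2 - R / sqrt 2"
    let ?k = "norm (1 - cis (2 * pi * (u / \<eta>) - ?\<beta>))"
    have s2: "1 \<le> sqrt 2" by simp
    have uR: "u - R = (z1 + z2) / sqrt 2"
      by (simp add: u_def z1_def z2_def diff_divide_distrib add_divide_distrib)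
    have vz: "v = (z2 - z1) / sqrt 2"
      by (simp add: v_def z1_def z2_def)
    have div: "\<bar>y\<bar> / sqrt 2 \<le> \<bar>y\<bar>" for y :: real
      using s2 mult_left_mono[of 1 "sqrt 2" "\<bar>y\<bar>"] by (simp add: divide_le_eq)
    have "\<bar>u - R\<bar> \<le> \<bar>z1 + z2\<bar>" "\<bar>v\<bar> \<le> \<bar>z2 - z1\<bar>"
      unfolding uR vz abs_divide using div by simp_all
    then have b1: "\<bar>u - R\<bar> \<le> \<bar>z1\<bar> + \<bar>z2\<bar>" "\<bar>v\<bar> \<le> \<bar>z1\<bar> + \<bar>z2\<bar>"
      using abs_triangle_ineq[of z1 z2] abs_triangle_ineq4[of z2 z1] by linarith+
    have "v\<^sup>2 = (z2 - z1)\<^sup>2 / 2"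
      by (simp add: vz power_divide)
    also have "\<dots> \<le> z1\<^sup>2 + z2\<^sup>2"
      using zero_le_power2[of "z1 + z2"] by (simp add: power2_eq_square algebra_simps)
    finally have b2: "v\<^sup>2 \<le> z1\<^sup>2 + z2\<^sup>2" .
    have "?k \<le> 12 * (\<bar>u - R\<bar> + \<bar>v\<bar> + v\<^sup>2) / R"
      unfolding u_def v_def by (rule curve_phase_bound[OF \<Gamma> \<xi> \<eta>(1) R])
    from square_sum_bound[OF norm_ge_zero this R b1 b2]
    have k: "?k\<^sup>2 \<le> 2304 / R\<^sup>2 * (z1\<^sup>2 + z2\<^sup>2 + z1 ^ 4 + z2 ^ 4)" .
    have "4 * pi * \<alpha> * (\<xi> $ 1 + \<xi> $ 2) = 2 * pi * (u / \<eta>)"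
      using \<eta> by (simp add: \<alpha>\<eta> u_def field_simps)
    then have "(norm (fourier ?f \<xi>))\<^sup>2 = ?k\<^sup>2 * (norm (fourier (wave w R) \<xi>))\<^sup>2"
      using norm_fourier_wave_pair[OF w \<alpha> R, of ?\<beta> \<xi>] by (simp add: power_mult_distrib)
    also have "\<dots> \<le> 2304 / R\<^sup>2 * (z1\<^sup>2 + z2\<^sup>2 + z1 ^ 4 + z2 ^ 4) * (norm (fourier (wave w R) \<xi>))\<^sup>2"
      by (intro mult_right_mono k) simp
    also have "\<dots> = 2304 / R\<^sup>2 * (z1\<^sup>2 * (norm (fourier (wave w R) \<xi>))\<^sup>2 + z2\<^sup>2 * (norm (fourier (wave w R) \<xi>))\<^sup>2
        + z1 ^ 4 * (norm (fourier (wave w R) \<xi>))\<^sup>2 + z2 ^ 4 * (norm (fourier (wave w R) \<xi>))\<^sup>2)"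
      by (simp add: distrib_left distrib_right mult.assoc)
    also have "\<dots> \<le> 2304 / R\<^sup>2 * (\<Sum>i<4. (norm (fourier (G i) \<xi>))\<^sup>2)"
    proof (rule mult_left_mono)
      let ?A = "norm (fourier1 (bump w) z1)" and ?B = "norm (fourier1 (bump w) z2)"
      have g: "norm (fourier (wave w R) \<xi>) = ?A * ?B"
        unfolding fourier_wave[OF w \<alpha> R] z1_def z2_def by (simp add: norm_mult)
      have one: "\<bar>z\<bar> * norm (fourier1 (bump w) z) \<le> norm (fourier1 (bump1 w) z)"
        "\<bar>z\<bar> * norm (fourier1 (bump1 w) z) \<le> norm (fourier1 (bump2 w) z)" for z
      proof -
        have "1 * (\<bar>z\<bar> * c) \<le> 2 * pi * (\<bar>z\<bar> * c)" if "0 \<le> c" for c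
          using that pi_gt3 by (intro mult_right_mono) auto
        then show "\<bar>z\<bar> * norm (fourier1 (bump w) z) \<le> norm (fourier1 (bump1 w) z)"
          "\<bar>z\<bar> * norm (fourier1 (bump1 w) z) \<le> norm (fourier1 (bump2 w) z)"
          unfolding fourier1_bump1[OF w(1)] fourier1_bump2[OF w(1)] by (simp_all add: norm_mult mult.assoc)
      qed
      have two: "z\<^sup>2 * norm (fourier1 (bump w) z) \<le> norm (fourier1 (bump2 w) z)" for z
        using order_trans[OF mult_left_mono[OF one(1)[of z] abs_ge_zero[of z]] one(2)[of z]]
        by (simp add: power2_eq_square mult.assoc[symmetric])
      have FG: "norm (fourier (G 0) \<xi>) = norm (fourier1 (bump1 w) z1) * ?B"
        "norm (fourier (G 1) \<xi>) = ?A * norm (fourier1 (bump1 w) z2)"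
        "norm (fourier (G 2) \<xi>) = norm (fourier1 (bump2 w) z1) * ?B"
        "norm (fourier (G 3) \<xi>) = ?A * norm (fourier1 (bump2 w) z2)"
        using fourier_packet[OF pr(2) pr(1) w(1), of ?d \<xi>] fourier_packet[OF pr(1) pr(2) w(1), of ?d \<xi>]
          fourier_packet[OF pr(3) pr(1) w(1), of ?d \<xi>] fourier_packet[OF pr(1) pr(3) w(1), of ?d \<xi>]
        by (simp_all add: G_def z1_def z2_def norm_mult)
      have "\<bar>z1\<bar> * (?A * ?B) \<le> norm (fourier (G 0) \<xi>)" "\<bar>z2\<bar> * (?A * ?B) \<le> norm (fourier (G 1) \<xi>)"
        "z1\<^sup>2 * (?A * ?B) \<le> norm (fourier (G 2) \<xi>)" "z2\<^sup>2 * (?A * ?B) \<le> norm (fourier (G 3) \<xi>)"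
        unfolding FG
        using mult_right_mono[OF one(1)[of z1], of ?B] mult_left_mono[OF one(1)[of z2], of ?A]
          mult_right_mono[OF two[of z1], of ?B] mult_left_mono[OF two[of z2], of ?A]
        by (simp_all add: mult_ac)
      from this[THEN power_mono, of 2]
      have sq: "z1\<^sup>2 * (?A * ?B)\<^sup>2 \<le> (norm (fourier (G 0) \<xi>))\<^sup>2" "z2\<^sup>2 * (?A * ?B)\<^sup>2 \<le> (norm (fourier (G 1) \<xi>))\<^sup>2"
        "z1 ^ 4 * (?A * ?B)\<^sup>2 \<le> (norm (fourier (G 2) \<xi>))\<^sup>2" "z2 ^ 4 * (?A * ?B)\<^sup>2 \<le> (norm (fourier (G 3) \<xi>))\<^sup>2"
        by (simp_all add: power_mult_distrib)
      have S4: "(\<Sum>i<4. h i) = h 0 + h 1 + h 2 + h (3::nat)" for h :: "nat \<Rightarrow> real"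
        by (simp add: eval_nat_numeral)
      show "z1\<^sup>2 * (norm (fourier (wave w R) \<xi>))\<^sup>2 + z2\<^sup>2 * (norm (fourier (wave w R) \<xi>))\<^sup>2
        + z1 ^ 4 * (norm (fourier (wave w R) \<xi>))\<^sup>2 + z2 ^ 4 * (norm (fourier (wave w R) \<xi>))\<^sup>2
        \<le> (\<Sum>i<4. (norm (fourier (G i) \<xi>))\<^sup>2)"
        unfolding g S4 by (intro add_mono sq)
    qed simp
    finally show ?thesis .
  qed
  have "trace_sq \<Gamma> ?f \<le> (\<integral>\<^sup>+\<xi>. ennreal (2304 / R\<^sup>2) * (\<Sum>i<4. ennreal ((norm (fourier (G i) \<xi>))\<^sup>2)) \<partial>restrict_space hausdorff1 \<Gamma>)"
    unfolding trace_sq_def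
  proof (rule nn_integral_mono)
    fix \<xi> assume "\<xi> \<in> space (restrict_space hausdorff1 \<Gamma>)"
    then have "\<xi> \<in> \<Gamma>" by (simp add: space_restrict_space)
    then show "ennreal ((norm (fourier ?f \<xi>))\<^sup>2) \<le> ennreal (2304 / R\<^sup>2) * (\<Sum>i<4. ennreal ((norm (fourier (G i) \<xi>))\<^sup>2))"
      using ennreal_leI[OF fG[of \<xi>]] by (subst sum_ennreal, simp, subst ennreal_mult''[symmetric], auto intro: sum_nonneg)
  qed
  also have "\<dots> = ennreal (2304 / R\<^sup>2) * (\<Sum>i<4. trace_sq \<Gamma> (G i))"
  proof -
    have m: "(\<lambda>\<xi>. ennreal ((norm (fourier (G i) \<xi>))\<^sup>2)) \<in> borel_measurable (restrict_space hausdorff1 \<Gamma>)" for i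
      using G by (intro norm_fourier_measurable_curve) auto
    show ?thesis
      unfolding trace_sq_def by (subst nn_integral_cmult, intro borel_measurable_sum m, subst nn_integral_sum, rule m, rule refl)
  qed
  also have "\<dots> \<le> ennreal (2304 / R\<^sup>2) * (\<Sum>i<(4::nat). ennreal trace_const * ennreal (if i < 2 then 64 else 576 / w\<^sup>2))"
    by (intro mult_left_mono sum_mono order_trans[OF curve_trace_inequality[OF \<Gamma> \<eta> G]] sqG) auto
  also have "\<dots> = ennreal (2304 / R\<^sup>2 * (trace_const * (128 + 1152 / w\<^sup>2)))"
  proof -
    let ?c = "\<lambda>i::nat. trace_const * (if i < 2 then 64 else 576 / w\<^sup>2)"
    have "(\<Sum>i<(4::nat). ennreal trace_const * ennreal (if i < 2 then 64 else 576 / w\<^sup>2)) = (\<Sum>i<4. ennreal (?c i))"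
      using trace_const_pos by (intro sum.cong refl ennreal_mult'[symmetric]) auto
    also have "\<dots> = ennreal (\<Sum>i<4. ?c i)"
      using trace_const_pos by (intro sum_ennreal) auto
    also have "(\<Sum>i<4. ?c i) = trace_const * (128 + 1152 / w\<^sup>2)"
      by (simp add: eval_nat_numeral algebra_simps)
    finally show ?thesis
      by (simp only:) (rule ennreal_mult'[symmetric], simp)
  qed
  \<comment> \<open>As \<open>w \<le> 1/4\<close>, the first derivatives are dominated by the second
    ones, \<open>128 \<le> 8 / w\<^sup>2\<close>; and \<open>2304 * 1160\<close> is below
    3000000.\<close>
  also have "\<dots> \<le> ennreal (trace_const * (3000000 / (R\<^sup>2 * w\<^sup>2)))"
  proof (rule ennreal_leI)
    have "w\<^sup>2 \<le> (1/4)\<^sup>2" using w by (intro power_mono) auto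
    then have "128 + 1152 / w\<^sup>2 \<le> 1160 / w\<^sup>2"
      using w by (simp add: field_simps power2_eq_square)
    then have "2304 / R\<^sup>2 * (trace_const * (128 + 1152 / w\<^sup>2)) \<le> 2304 / R\<^sup>2 * (trace_const * (1160 / w\<^sup>2))"
      using trace_const_pos by (intro mult_left_mono) auto
    also have "\<dots> \<le> trace_const * (3000000 / (R\<^sup>2 * w\<^sup>2))"
      using trace_const_pos R w by (simp add: field_simps)
    finally show "2304 / R\<^sup>2 * (trace_const * (128 + 1152 / w\<^sup>2)) \<le> trace_const * (3000000 / (R\<^sup>2 * w\<^sup>2))" .
  qed
  finally show ?thesis .
qed

section \<open>Haar approximation\<close>

lemma sum_of_bool_mult:
  fixes f :: "'a \<Rightarrow> 'b::semiring_1"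
  assumes "finite A" "a \<in> A"
  shows "(\<Sum>k\<in>A. of_bool (k = a) * f k) = f a" "(\<Sum>k\<in>A. f k * of_bool (k = a)) = f a"
proof -
  have "(\<Sum>k\<in>A. of_bool (k = a) * f k) = (\<Sum>k\<in>A. if k = a then f k else 0)"
    "(\<Sum>k\<in>A. f k * of_bool (k = a)) = (\<Sum>k\<in>A. if k = a then f k else 0)"
    by (auto intro!: sum.cong)
  then show "(\<Sum>k\<in>A. of_bool (k = a) * f k) = f a" "(\<Sum>k\<in>A. f k * of_bool (k = a)) = f a"
    using assms by simp_all
qed

definition level_indices :: "nat \<Rightarrow> haar_index set" where
  "level_indices n = {i \<in> haar_indices. fst i < n}"

definition haar_span :: "nat \<Rightarrow> (real^2 \<Rightarrow> complex) set" where
  "haar_span n = {\<lambda>x. \<Sum>i\<in>level_indices n. c i * of_real (haar i x) | c. True}"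

lemma haar_spanI: "(\<And>x. f x = (\<Sum>i\<in>level_indices n. c i * of_real (haar i x))) \<Longrightarrow> f \<in> haar_span n"
  unfolding haar_span_def mem_Collect_eq by (intro exI[of _ c]) (simp add: fun_eq_iff)

lemma haar_spanE:
  assumes "f \<in> haar_span n"
  obtains c where "f = (\<lambda>x. \<Sum>i\<in>level_indices n. c i * of_real (haar i x))"
  using assms unfolding haar_span_def by blast

lemma level_indices_Suc:
  "level_indices (Suc n) = level_indices n \<union>
    {n} \<times> (({0..<2 ^ n} \<times> {0..<2 ^ n}) \<times> ({0, 1} \<times> {0, 1} - {(0, 0)}))"
  by (auto simp: level_indices_def haar_indices_def less_Suc_eq)

text \<open>Level \<open>j\<close> carries \<open>3 * 4 ^ j\<close> wavelets, so the levels below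
  \<open>n\<close> carry \<open>4 ^ n - 1\<close> in total.\<close>

lemma finite_card_level_indices: "finite (level_indices n) \<and> card (level_indices n) < 4 ^ n"
proof (induction n)
  case 0
  then show ?case by (simp add: level_indices_def)
next
  case (Suc n)
  let ?E = "{0, 1} \<times> {0, 1} - {(0::nat, 0::nat)}"
  have "?E = {(0, 1), (1, 0), (1, 1)}" by auto
  then have "card ?E = 3" by simp
  then have "card ({n} \<times> (({0..<2 ^ n :: int} \<times> {0..<2 ^ n :: int}) \<times> ?E)) = 3 * 4 ^ n"
    by (simp add: card_cartesian_product nat_power_eq power_mult_distrib[symmetric])
  then show ?case
    using Suc card_Un_le[of "level_indices n" "{n} \<times> (({0..<2 ^ n :: int} \<times> {0..<2 ^ n :: int}) \<times> ?E)"]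
    unfolding level_indices_Suc by simp
qed

lemma haar_span_add: "f \<in> haar_span n \<Longrightarrow> g \<in> haar_span n \<Longrightarrow> (\<lambda>x. f x + g x) \<in> haar_span n"
proof -
  assume "f \<in> haar_span n" "g \<in> haar_span n"
  then obtain c d where "f = (\<lambda>x. \<Sum>i\<in>level_indices n. c i * of_real (haar i x))"
    "g = (\<lambda>x. \<Sum>i\<in>level_indices n. d i * of_real (haar i x))"
    by (elim haar_spanE)
  then show ?thesis
    by (intro haar_spanI[where c = "\<lambda>i. c i + d i"]) (simp add: sum.distrib distrib_right)
qed

lemma haar_span_scale: "f \<in> haar_span n \<Longrightarrow> (\<lambda>x. a * f x) \<in> haar_span n"
proof -
  assume "f \<in> haar_span n"
  then obtain c where "f = (\<lambda>x. \<Sum>i\<in>level_indices n. c i * of_real (haar i x))"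
    by (elim haar_spanE)
  then show ?thesis
    by (intro haar_spanI[where c = "\<lambda>i. a * c i"]) (simp add: sum_distrib_left mult.assoc)
qed

lemma haar_span_zero: "(\<lambda>x. 0) \<in> haar_span n"
  by (rule haar_spanI[where c = "\<lambda>_. 0"]) simp

lemma haar_span_sum:
  "finite K \<Longrightarrow> (\<And>k. k \<in> K \<Longrightarrow> f k \<in> haar_span n) \<Longrightarrow> (\<lambda>x. \<Sum>k\<in>K. f k x) \<in> haar_span n"
  by (induction K rule: finite_induct) (auto intro: haar_span_add haar_span_zero)

lemma haar_in_span:
  assumes "i \<in> level_indices n"
  shows "(\<lambda>x. of_real (haar i x)) \<in> haar_span n"
  using assms finite_card_level_indices[of n]
  by (intro haar_spanI[where c = "\<lambda>j. of_bool (j = i)"]) (simp add: sum_of_bool_mult)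

lemma haar_span_mono:
  assumes "f \<in> haar_span n"
  shows "f \<in> haar_span (Suc n)"
proof -
  obtain c where f: "f = (\<lambda>x. \<Sum>i\<in>level_indices n. c i * of_real (haar i x))"
    using assms by (rule haar_spanE)
  show ?thesis
    unfolding f using finite_card_level_indices[of n]
    by (intro haar_span_sum haar_span_scale haar_in_span) (simp_all add: level_indices_def)
qed

section \<open>Indicators of dyadic cells in terms of Haar functions\<close>

definition grid1 :: "nat \<Rightarrow> int \<Rightarrow> real \<Rightarrow> real" where
  "grid1 n k t = of_bool (\<lfloor>2 ^ n * (t + 1/2)\<rfloor> = k)"

definition grid :: "nat \<Rightarrow> int \<times> int \<Rightarrow> real^2 \<Rightarrow> complex" where
  "grid n k x = of_real (grid1 n (fst k) (x $ 1)) * of_real (grid1 n (snd k) (x $ 2))"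

text \<open>The indicator of half an interval is the average of the indicator of the whole interval
  and plus or minus its Haar function: plus for the left half (\<open>m\<close> even), minus for the
  right one.\<close>

lemma grid1_Suc:
  "grid1 (Suc n) m t = (haar1 0 (2 ^ n * (t + 1/2) - of_int (m div 2))
     + (-1) ^ nat (m mod 2) * haar1 1 (2 ^ n * (t + 1/2) - of_int (m div 2))) / 2"
proof -
  define y where "y = 2 ^ n * (t + 1/2)"
  define k where "k = m div 2"
  have y: "2 ^ Suc n * (t + 1/2) = 2 * y" by (simp add: y_def)
  consider "m = 2 * k" "m mod 2 = 0" | "m = 2 * k + 1" "m mod 2 = 1"
    unfolding k_def by (cases "even m") (auto simp: even_iff_mod_2_eq_zero odd_iff_mod_2_eq_one)
  then show ?thesis
  proof cases
    case 1
    then show ?thesis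
      unfolding grid1_def y y_def[symmetric] k_def[symmetric] haar1_def floor_eq_iff by (auto simp: indicator_def)
  next
    case 2
    then show ?thesis
      unfolding grid1_def y y_def[symmetric] k_def[symmetric] haar1_def floor_eq_iff by (auto simp: indicator_def)
  qed
qed

lemma grid1_haar1: "grid1 n k t = haar1 0 (2 ^ n * (t + 1/2) - of_int k)"
  unfolding grid1_def haar1_def floor_eq_iff by (auto simp: indicator_def)

lemma haar_power: "haar (j, (k1, k2), (e1, e2)) x =
  2 ^ j * (haar1 e1 (2 ^ j * (x $ 1 + 1/2) - of_int k1) * haar1 e2 (2 ^ j * (x $ 2 + 1/2) - of_int k2))"
proof -
  have "2 powr (real j / 2) * 2 powr (real j / 2) = (2::real) ^ j"
    by (simp add: powr_add[symmetric] powr_realpow)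
  then show ?thesis
    by (simp add: mult_ac)
qed

text \<open>Product of the one-dimensional identities in both coordinates. One of the four products
  is a cell indicator of level \<open>n\<close>, the others are wavelets; dividing by
  \<open>2 ^ n\<close> undoes their normalisation.\<close>

lemma grid_Suc:
  fixes m1 m2 :: int
  defines "k1 \<equiv> m1 div 2" and "k2 \<equiv> m2 div 2"
    and "s1 \<equiv> (-1) ^ nat (m1 mod 2)" and "s2 \<equiv> (-1) ^ nat (m2 mod 2)"
  shows "grid (Suc n) (m1, m2) x = 1/4 * grid n (k1, k2) x
    + (s1 / (4 * 2 ^ n) * of_real (haar (n, (k1, k2), (1, 0)) x)
    + (s2 / (4 * 2 ^ n) * of_real (haar (n, (k1, k2), (0, 1)) x)
    + s1 * s2 / (4 * 2 ^ n) * of_real (haar (n, (k1, k2), (1, 1)) x)))"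
proof -
  let ?a = "\<lambda>e. haar1 e (2 ^ n * (x $ 1 + 1/2) - of_int k1)" and ?b = "\<lambda>e. haar1 e (2 ^ n * (x $ 2 + 1/2) - of_int k2)"
  have g1: "complex_of_real (grid1 (Suc n) m1 (x $ 1)) = (of_real (?a 0) + s1 * of_real (?a 1)) / 2"
    unfolding grid1_Suc k1_def s1_def by simp
  have g2: "complex_of_real (grid1 (Suc n) m2 (x $ 2)) = (of_real (?b 0) + s2 * of_real (?b 1)) / 2"
    unfolding grid1_Suc k2_def s2_def by simp
  have h: "s / (4 * 2 ^ n) * complex_of_real (haar (n, (k1, k2), (e1, e2)) x) = s / 4 * (of_real (?a e1) * of_real (?b e2))" for s e1 e2
    unfolding haar_power by simp
  show ?thesis
    unfolding h unfolding grid_def fst_conv snd_conv g1 g2 unfolding grid1_haar1 by (simp add: algebra_simps add_divide_distrib)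
qed

text \<open>The subtracted term is the mean of the cell indicator times the indicator of the whole
  square, a direction orthogonal to all wavelets. In the induction step a quarter of the corrected
  indicator of the parent cell is combined with the three wavelets on that cell.\<close>

lemma grid_in_span:
  assumes "k1 \<in> {0..<2 ^ n}" "k2 \<in> {0..<2 ^ n}"
  shows "(\<lambda>x. grid n (k1, k2) x - 1 / 4 ^ n * grid 0 (0, 0) x) \<in> haar_span n"
  using assms
proof (induction n arbitrary: k1 k2)
  case 0
  then have "k1 = 0" "k2 = 0" by auto
  then show ?case by (simp add: haar_span_zero)
next
  case (Suc n)
  let ?k1 = "k1 div 2" and ?k2 = "k2 div 2"
  let ?s1 = "(-1) ^ nat (k1 mod 2) :: complex" and ?s2 = "(-1) ^ nat (k2 mod 2) :: complex"
  have k: "?k1 \<in> {0..<2 ^ n}" "?k2 \<in> {0..<2 ^ n}" using Suc.prems by auto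
  have lev: "(n, (?k1, ?k2), (1, 0)) \<in> level_indices (Suc n)" "(n, (?k1, ?k2), (0, 1)) \<in> level_indices (Suc n)"
    "(n, (?k1, ?k2), (1, 1)) \<in> level_indices (Suc n)"
    using k unfolding level_indices_Suc by auto
  have "(\<lambda>x. grid (Suc n) (k1, k2) x - 1 / 4 ^ Suc n * grid 0 (0, 0) x) =
    (\<lambda>x. 1/4 * (grid n (?k1, ?k2) x - 1 / 4 ^ n * grid 0 (0, 0) x)
    + (?s1 / (4 * 2 ^ n) * of_real (haar (n, (?k1, ?k2), (1, 0)) x)
    + (?s2 / (4 * 2 ^ n) * of_real (haar (n, (?k1, ?k2), (0, 1)) x)
    + ?s1 * ?s2 / (4 * 2 ^ n) * of_real (haar (n, (?k1, ?k2), (1, 1)) x))))"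
    unfolding grid_Suc by (simp add: fun_eq_iff algebra_simps)
  also have "\<dots> \<in> haar_span (Suc n)"
    by (intro haar_span_add haar_span_scale haar_in_span lev haar_span_mono[OF Suc.IH[OF k]])
  finally show ?case .
qed

lemma grid1_indicator: "grid1 n k t = indicator {of_int k / 2 ^ n - 1/2 ..< (of_int k + 1) / 2 ^ n - 1/2} t"
  unfolding grid1_def floor_eq_iff by (auto simp: indicator_def field_simps)

lemma grid1_integral:
  "integrable lborel (\<lambda>t. complex_of_real (grid1 n k t))" "(\<integral>t. complex_of_real (grid1 n k t) \<partial>lborel) = 1 / 2 ^ n"
proof -
  have le: "(of_int k / 2 ^ n - 1/2 :: real) \<le> (of_int k + 1) / 2 ^ n - 1/2"
    by (simp add: divide_right_mono)
  have "integrable lborel (grid1 n k)"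
    unfolding grid1_indicator[abs_def] using le by (intro integrable_real_indicator) auto
  then show "integrable lborel (\<lambda>t. complex_of_real (grid1 n k t))" by (rule integrable_of_real)
  have "(\<integral>t. grid1 n k t \<partial>lborel) = 1 / 2 ^ n"
    unfolding grid1_indicator[abs_def] using le by (simp add: add_divide_distrib)
  then show "(\<integral>t. complex_of_real (grid1 n k t) \<partial>lborel) = 1 / 2 ^ n"
    by simp
qed

lemma integral_grid: "(\<integral>x. grid n k x \<partial>lborel) = 1 / 4 ^ n"
proof -
  have "(4::complex) ^ n = 2 ^ n * 2 ^ n"
    by (simp add: power_mult_distrib[symmetric])
  then show ?thesis
    unfolding grid_def integral_real2_product[OF grid1_integral(1) grid1_integral(1)] grid1_integral(2) by simp
qed

section \<open>Approximation by mean-free step functions\<close>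

definition grid_indices :: "nat \<Rightarrow> (int \<times> int) set" where
  "grid_indices n = {0..<2 ^ n} \<times> {0..<2 ^ n}"

definition grid_index :: "nat \<Rightarrow> real^2 \<Rightarrow> int \<times> int" where
  "grid_index n x = (\<lfloor>2 ^ n * (x $ 1 + 1/2)\<rfloor>, \<lfloor>2 ^ n * (x $ 2 + 1/2)\<rfloor>)"

definition grid_corner :: "nat \<Rightarrow> int \<times> int \<Rightarrow> real^2" where
  "grid_corner n k = vector [of_int (fst k) / 2 ^ n - 1/2, of_int (snd k) / 2 ^ n - 1/2]"

definition open_square :: "(real^2) set" where
  "open_square = {x. -1/2 < x $ 1 \<and> x $ 1 < 1/2 \<and> -1/2 < x $ 2 \<and> x $ 2 < 1/2}"

text \<open>The half-open square is the disjoint union of the grid cells of any level. It lies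
  between the open square, off which the wave pair vanishes, and the closed one of
  \<open>bdd_on_square\<close>.\<close>

definition cell_square :: "(real^2) set" where
  "cell_square = {x. -1/2 \<le> x $ 1 \<and> x $ 1 < 1/2 \<and> -1/2 \<le> x $ 2 \<and> x $ 2 < 1/2}"

lemma grid_eq: "grid n k x = of_bool (k = grid_index n x)"
  by (auto simp: grid_def grid1_def grid_index_def prod_eq_iff)

lemma sum_grid:
  assumes "x \<in> cell_square"
  shows "grid_index n x \<in> grid_indices n" "(\<Sum>k\<in>grid_indices n. v k * grid n k x) = v (grid_index n x)"
proof -
  have "\<lfloor>2 ^ n * (t + 1/2)\<rfloor> \<in> {0..<2 ^ n}" if "-1/2 \<le> t" "t < 1/2" for t :: real
  proof -
    have "2 ^ n * (t + 1/2) < 2 ^ n * 1" using that by (intro mult_strict_left_mono) auto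
    moreover have "0 \<le> 2 ^ n * (t + 1/2)" using that by simp
    ultimately show ?thesis by (simp add: floor_less_iff)
  qed
  then show i: "grid_index n x \<in> grid_indices n"
    using assms by (auto simp: grid_index_def grid_indices_def cell_square_def)
  have "finite (grid_indices n)" by (simp add: grid_indices_def)
  then show "(\<Sum>k\<in>grid_indices n. v k * grid n k x) = v (grid_index n x)"
    using i unfolding grid_eq by (intro sum_of_bool_mult)
qed

lemma sum_grid_outside:
  assumes "x \<notin> cell_square"
  shows "(\<Sum>k\<in>grid_indices n. v k * grid n k x) = 0"
proof -
  have "-1/2 \<le> t \<and> t < 1/2" if "\<lfloor>2 ^ n * (t + 1/2)\<rfloor> \<in> {0..<2 ^ n}" for t :: real
  proof -
    have "0 \<le> 2 ^ n * (t + 1/2)" "2 ^ n * (t + 1/2) < 2 ^ n * 1"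
      using that by (simp_all add: floor_less_iff)
    moreover have p: "(0::real) < 2 ^ n" by simp
    ultimately have "0 \<le> t + 1/2" "t + 1/2 < 1"
      by (simp_all only: zero_le_mult_iff mult_less_cancel_left_pos[OF p]) auto
    then show ?thesis by auto
  qed
  then have "grid_index n x \<notin> grid_indices n"
    using assms by (auto simp: grid_index_def grid_indices_def cell_square_def simp del: atLeastLessThan_iff)
  then show ?thesis
    by (intro sum.neutral) (auto simp: grid_eq)
qed

lemma grid_corner_close:
  "\<bar>grid_corner n (grid_index n x) $ 1 - x $ 1\<bar> \<le> 1 / 2 ^ n" "\<bar>grid_corner n (grid_index n x) $ 2 - x $ 2\<bar> \<le> 1 / 2 ^ n"
proof -
  have "\<bar>of_int \<lfloor>2 ^ n * (t + 1/2)\<rfloor> / 2 ^ n - 1/2 - t\<bar> \<le> 1 / 2 ^ n" for t :: real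
  proof -
    let ?y = "2 ^ n * (t + 1/2)"
    have "\<bar>of_int \<lfloor>?y\<rfloor> - ?y\<bar> \<le> 1" by linarith
    moreover have "of_int \<lfloor>?y\<rfloor> / 2 ^ n - 1/2 - t = (of_int \<lfloor>?y\<rfloor> - ?y) / 2 ^ n"
      by (simp add: diff_divide_distrib)
    ultimately show ?thesis
      by (simp only: abs_divide) (simp add: divide_right_mono)
  qed
  then show "\<bar>grid_corner n (grid_index n x) $ 1 - x $ 1\<bar> \<le> 1 / 2 ^ n" "\<bar>grid_corner n (grid_index n x) $ 2 - x $ 2\<bar> \<le> 1 / 2 ^ n"
    by (simp_all add: grid_corner_def grid_index_def)
qed

lemma grid_measurable [measurable]: "grid n k \<in> borel_measurable borel"
  unfolding grid_def[abs_def] grid1_def by measurable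

lemma open_subset_cell_square: "open_square \<subseteq> cell_square"
  by (auto simp: open_square_def cell_square_def)

lemma cell_subset_half_square: "cell_square \<subseteq> half_square"
  by (auto simp: half_square_def cell_square_def abs_le_iff)

text \<open>\<open>f\<close> is sampled at the lower left corners of the cells, and the mean of the
  resulting step function is subtracted to reach the Haar span. Sampling costs
  \<open>2 * L / 2 ^ n\<close> pointwise; the subtracted mean differs from that of \<open>f\<close>,
  which is \<open>fourier f 0\<close>, by at most the same amount.\<close>

lemma haar_approximation:
  fixes f :: "real^2 \<Rightarrow> complex"
  assumes f: "bdd_on_square f" and zero: "\<And>x. x \<notin> open_square \<Longrightarrow> f x = 0"
    and "0 \<le> L" and lip: "\<And>x y. norm (f x - f y) \<le> L * (\<bar>x $ 1 - y $ 1\<bar> + \<bar>x $ 2 - y $ 2\<bar>)"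
  shows "\<exists>g\<in>haar_span n. bdd_on_square g \<and> (\<forall>x. norm (g x - f x) \<le> 4 * L / 2 ^ n + norm (fourier f 0))"
proof -
  define v where "v k = f (grid_corner n k)" for k
  \<comment> \<open>Every cell has area \<open>1 / 4 ^ n\<close>, so this is the integral of the
    step function \<open>P\<close> over the unit square.\<close>
  define \<mu> where "\<mu> = (\<Sum>k\<in>grid_indices n. v k) / 4 ^ n"
  define P where "P x = (\<Sum>k\<in>grid_indices n. v k * grid n k x)" for x
  define g where "g x = (\<Sum>k\<in>grid_indices n. (v k - \<mu>) * grid n k x)" for x
  have fin: "finite (grid_indices n)" and card: "of_nat (card (grid_indices n)) = (4::complex) ^ n"
    by (simp_all add: grid_indices_def card_cartesian_product nat_power_eq power_mult_distrib[symmetric])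
  have Pf: "norm (P x - f x) \<le> 2 * L / 2 ^ n" for x
  proof (cases "x \<in> cell_square")
    case True
    have "norm (P x - f x) \<le> L * (\<bar>grid_corner n (grid_index n x) $ 1 - x $ 1\<bar> + \<bar>grid_corner n (grid_index n x) $ 2 - x $ 2\<bar>)"
      unfolding P_def sum_grid(2)[OF True] v_def by (rule lip)
    also have "\<dots> \<le> L * (1 / 2 ^ n + 1 / 2 ^ n)"
      by (intro mult_left_mono add_mono grid_corner_close \<open>0 \<le> L\<close>)
    finally show ?thesis by (simp add: mult.commute)
  next
    case False
    then have "f x = 0" using zero open_subset_cell_square by auto
    then show ?thesis using False \<open>0 \<le> L\<close> by (simp add: P_def sum_grid_outside)
  qed
  obtain B where B: "\<And>x. norm (f x) \<le> B" using f by (auto simp: bdd_on_square_def)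
  have P_bdd: "bdd_on_square P"
    unfolding bdd_on_square_def
  proof (intro conjI exI allI impI)
    show "P \<in> borel_measurable borel" unfolding P_def[abs_def] by measurable
    show "norm (P x) \<le> 2 * L / 2 ^ n + B" for x
      using norm_triangle_ineq[of "P x - f x" "f x"] Pf[of x] B[of x] by simp
    show "P x = 0" if "x \<notin> half_square" for x
      unfolding P_def using that cell_subset_half_square by (intro sum_grid_outside) auto
  qed
  have int_grid: "integrable lborel (grid n k)" if "k \<in> grid_indices n" for k
  proof (rule bdd_on_square_integrable)
    have "grid n k x = 0" if "x \<notin> cell_square" for x
      using sum_grid_outside[OF that, where n = n and v = "\<lambda>j. of_bool (j = k)"] fin \<open>k \<in> _\<close>
      by (simp add: sum_of_bool_mult)
    then show "bdd_on_square (grid n k)"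
      unfolding bdd_on_square_def using cell_subset_half_square
      by (auto intro!: exI[of _ 1] simp: grid_eq)
  qed
  have int_P: "(\<integral>x. P x \<partial>lborel) = \<mu>"
    unfolding P_def \<mu>_def using int_grid
    by (subst Bochner_Integration.integral_sum) (auto simp: integral_grid sum_divide_distrib)
  have f0: "fourier f 0 = (\<integral>x. f x \<partial>lborel)"
    by (simp add: fourier_char char_cis)
  have "norm (\<mu> - fourier f 0) = norm (\<integral>x. P x - f x \<partial>lborel)"
    unfolding f0 int_P[symmetric] using bdd_on_square_integrable[OF P_bdd] bdd_on_square_integrable[OF f] by simp
  also have "\<dots> \<le> (\<integral>x. norm (P x - f x) \<partial>lborel)"
    by (rule integral_norm_bound)
  also have "\<dots> \<le> (\<integral>x. indicator half_square x *\<^sub>R (2 * L / 2 ^ n) \<partial>lborel)"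
  proof (intro integral_mono integrable_norm Bochner_Integration.integrable_diff bdd_on_square_integrable P_bdd f)
    show "integrable lborel (\<lambda>x::real^2. indicator half_square x *\<^sub>R (2 * L / 2 ^ n))"
      by (intro integrable_scaleR_left integrable_real_indicator) (auto simp: emeasure_half_square)
    show "norm (P x - f x) \<le> indicator half_square x *\<^sub>R (2 * L / 2 ^ n)" for x
      using Pf[of x] P_bdd f by (cases "x \<in> half_square") (auto simp: bdd_on_square_def)
  qed
  also have "\<dots> = 2 * L / 2 ^ n"
    using emeasure_half_square by (simp add: measure_def)
  finally have \<mu>: "norm \<mu> \<le> 2 * L / 2 ^ n + norm (fourier f 0)"
    using norm_triangle_ineq[of "\<mu> - fourier f 0" "fourier f 0"] by simp
  have gf: "norm (g x - f x) \<le> 4 * L / 2 ^ n + norm (fourier f 0)" for x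
  proof (cases "x \<in> cell_square")
    case True
    then have eq: "g x - f x = (P x - f x) - \<mu>"
      by (simp add: g_def P_def sum_grid(2))
    show ?thesis
      unfolding eq using norm_triangle_ineq4[of "P x - f x" \<mu>] add_mono[OF Pf[of x] \<mu>] by simp
  next
    case False
    then have "f x = 0" using zero open_subset_cell_square by auto
    then show ?thesis using False \<open>0 \<le> L\<close> by (simp add: g_def sum_grid_outside)
  qed
  have g_bdd: "bdd_on_square g"
    unfolding bdd_on_square_def
  proof (intro conjI exI allI impI)
    show "g \<in> borel_measurable borel" unfolding g_def[abs_def] by measurable
    show "norm (g x) \<le> 4 * L / 2 ^ n + norm (fourier f 0) + B" for x
      using norm_triangle_ineq[of "g x - f x" "f x"] gf[of x] B[of x] by simp
    show "g x = 0" if "x \<notin> half_square" for x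
      unfolding g_def using that cell_subset_half_square by (intro sum_grid_outside) auto
  qed
  have sum0: "(\<Sum>k\<in>grid_indices n. v k - \<mu>) = 0"
    by (simp add: sum_subtractf card \<mu>_def)
  \<comment> \<open>The coefficients \<open>v k - \<mu>\<close> add up to 0, so subtracting the mean
    of each cell indicator leaves \<open>g\<close> unchanged.\<close>
  have "g = (\<lambda>x. \<Sum>k\<in>grid_indices n. (v k - \<mu>) * (grid n (fst k, snd k) x - 1 / 4 ^ n * grid 0 (0, 0) x))"
  proof
    fix x
    have "(\<Sum>k\<in>grid_indices n. (v k - \<mu>) * (grid n k x - 1 / 4 ^ n * grid 0 (0, 0) x))
        = g x - (\<Sum>k\<in>grid_indices n. v k - \<mu>) * (1 / 4 ^ n * grid 0 (0, 0) x)"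
      unfolding g_def sum_distrib_right by (simp only: right_diff_distrib sum_subtractf)
    then show "g x = (\<Sum>k\<in>grid_indices n. (v k - \<mu>) * (grid n (fst k, snd k) x - 1 / 4 ^ n * grid 0 (0, 0) x))"
      unfolding sum0 prod.collapse by simp
  qed
  also have "\<dots> \<in> haar_span n"
    using fin by (intro haar_span_sum haar_span_scale grid_in_span) (auto simp: grid_indices_def)
  finally show ?thesis
    using gf g_bdd by blast
qed

section \<open>The stability margin\<close>

text \<open>The pointwise inequality \<open>(a + b)^2 \<le> 2 * a^2 + 2 * b^2\<close> replaces the
  triangle inequality for norms and stays with squared, extended-valued integrals.\<close>

lemma nn_integral_square_triangle:
  fixes u v :: "'a \<Rightarrow> complex"
  assumes [measurable]: "(\<lambda>x. ennreal ((norm (v x))\<^sup>2)) \<in> borel_measurable M"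
    "(\<lambda>x. ennreal ((norm (u x - v x))\<^sup>2)) \<in> borel_measurable M"
  shows "(\<integral>\<^sup>+x. ennreal ((norm (u x))\<^sup>2) \<partial>M)
    \<le> 2 * (\<integral>\<^sup>+x. ennreal ((norm (v x))\<^sup>2) \<partial>M) + 2 * (\<integral>\<^sup>+x. ennreal ((norm (u x - v x))\<^sup>2) \<partial>M)"
proof -
  have *: "ennreal ((norm (u x))\<^sup>2) \<le> 2 * ennreal ((norm (v x))\<^sup>2) + 2 * ennreal ((norm (u x - v x))\<^sup>2)" for x
  proof -
    have "(norm (u x))\<^sup>2 \<le> (norm (v x) + norm (u x - v x))\<^sup>2"
      using norm_triangle_ineq[of "v x" "u x - v x"] by (intro power_mono) auto
    also have "\<dots> \<le> 2 * (norm (v x))\<^sup>2 + 2 * (norm (u x - v x))\<^sup>2"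
      using zero_le_power2[of "norm (v x) - norm (u x - v x)"] by (simp add: power2_eq_square algebra_simps)
    finally have "ennreal ((norm (u x))\<^sup>2) \<le> ennreal (2 * (norm (v x))\<^sup>2 + 2 * (norm (u x - v x))\<^sup>2)"
      by (rule ennreal_leI)
    then show ?thesis
      by (simp add: ennreal_plus ennreal_mult')
  qed
  have "(\<integral>\<^sup>+x. ennreal ((norm (u x))\<^sup>2) \<partial>M)
      \<le> (\<integral>\<^sup>+x. 2 * ennreal ((norm (v x))\<^sup>2) + 2 * ennreal ((norm (u x - v x))\<^sup>2) \<partial>M)"
    by (intro nn_integral_mono *)
  also have "\<dots> = 2 * (\<integral>\<^sup>+x. ennreal ((norm (v x))\<^sup>2) \<partial>M) + 2 * (\<integral>\<^sup>+x. ennreal ((norm (u x - v x))\<^sup>2) \<partial>M)"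
    by (subst nn_integral_add) (auto simp: nn_integral_cmult[OF assms(1)] nn_integral_cmult[OF assms(2)])
  finally show ?thesis .
qed

lemma bdd_on_square_diff:
  assumes f: "bdd_on_square f" and g: "bdd_on_square g"
  shows "bdd_on_square (\<lambda>x. f x - g x)"
proof -
  have [measurable]: "f \<in> borel_measurable borel" "g \<in> borel_measurable borel" using f g by auto
  obtain B B' where B: "\<And>x. norm (f x) \<le> B" "\<And>x. norm (g x) \<le> B'"
    using f g unfolding bdd_on_square_def by blast
  have "norm (f x - g x) \<le> B + B'" for x
    using norm_triangle_ineq4[of "f x" "g x"] B(1)[of x] B(2)[of x] by simp
  then show ?thesis
    using f g unfolding bdd_on_square_def by (intro conjI exI[of _ "B + B'"]) auto
qed

lemma sq_integral_triangle:
  assumes "bdd_on_square f" "bdd_on_square g"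
  shows "sq_integral f \<le> 2 * sq_integral g + 2 * sq_integral (\<lambda>x. f x - g x)"
proof -
  have [measurable]: "f \<in> borel_measurable borel" "g \<in> borel_measurable borel" using assms by auto
  show ?thesis
    unfolding sq_integral_def by (rule nn_integral_square_triangle) measurable
qed

lemma trace_sq_triangle:
  assumes f: "bdd_on_square f" and g: "bdd_on_square g"
  shows "trace_sq \<Gamma> f \<le> 2 * trace_sq \<Gamma> g + 2 * trace_sq \<Gamma> (\<lambda>x. f x - g x)"
proof -
  have "trace_sq \<Gamma> (\<lambda>x. f x - g x) = (\<integral>\<^sup>+\<xi>. ennreal ((norm (fourier f \<xi> - fourier g \<xi>))\<^sup>2) \<partial>restrict_space hausdorff1 \<Gamma>)"
    unfolding trace_sq_def fourier_diff[OF assms] ..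
  moreover have "(\<lambda>\<xi>. ennreal ((norm (fourier f \<xi> - fourier g \<xi>))\<^sup>2)) \<in> borel_measurable (restrict_space hausdorff1 \<Gamma>)"
    unfolding fourier_diff[OF assms, symmetric]
    using bdd_on_square_diff[OF assms] by (intro norm_fourier_measurable_curve) auto
  ultimately show ?thesis
    using norm_fourier_measurable_curve[of g \<Gamma>] g
    unfolding trace_sq_def by (simp add: nn_integral_square_triangle bdd_on_square_measurable)
qed

section \<open>Bounds for the margin from test functions\<close>

lemma L2_norm_le:
  assumes "(\<integral>\<^sup>+x. ennreal ((norm (f x))\<^sup>2) \<partial>M) \<le> ennreal (c\<^sup>2)" "0 \<le> c"
  shows "L2_norm M f \<le> ennreal c"
proof -
  let ?I = "\<integral>\<^sup>+x. ennreal ((norm (f x))\<^sup>2) \<partial>M"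
  have I: "?I \<noteq> \<infinity>" using assms(1) by (auto simp: top_unique)
  have "enn2real ?I \<le> c\<^sup>2" using assms by (intro enn2real_leI) auto
  then have "sqrt (enn2real ?I) \<le> c" using assms(2) by (simp add: real_le_lsqrt)
  then show ?thesis
    using I unfolding L2_norm_def Let_def by (simp add: ennreal_leI)
qed

lemma L2_norm_eq_1: "sq_integral f = 1 \<Longrightarrow> L2_norm lborel f = 1"
  unfolding sq_integral_def L2_norm_def Let_def by simp

text \<open>\<open>g\<close> is divided by its norm \<open>sqrt S\<close>, under which the span is
  invariant and the squared trace scales by \<open>1 / S\<close>. All wavelets below level
  \<open>n\<close> are used, fewer than \<open>4 ^ n\<close> in number.\<close>

lemma stability_margin_le:
  assumes g: "bdd_on_square g" and span: "g \<in> haar_span n"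
    and n: "4 ^ n \<le> N" "\<And>j. j < n \<Longrightarrow> real j \<le> J"
    and S: "sq_integral g = ennreal S" "0 < S" and T: "trace_sq \<Gamma> g \<le> ennreal T" "0 \<le> T"
  shows "stability_margin \<Gamma> (sparse_haar N J) \<le> ennreal (sqrt (T / S))"
proof -
  have [measurable]: "g \<in> borel_measurable borel" using g by auto
  define a where "a = 1 / sqrt S"
  have a2: "a\<^sup>2 = 1 / S" using S by (simp add: a_def power_divide)
  obtain c where c: "g = (\<lambda>x. \<Sum>i\<in>level_indices n. c i * of_real (haar i x))"
    using span by (rule haar_spanE)
  define f where "f x = of_real a * g x" for x
  have f_eq: "f = (\<lambda>x. \<Sum>i\<in>level_indices n. (of_real a * c i) * of_real (haar i x))"
    unfolding f_def[abs_def] by (simp add: c sum_distrib_left mult.assoc)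
  have mem: "f \<in> sparse_haar N J"
    unfolding sparse_haar_def mem_Collect_eq
    using finite_card_level_indices[of n] n
    by (intro exI[of _ "level_indices n"] exI[of _ "\<lambda>i. of_real a * c i"] conjI f_eq)
       (auto simp: level_indices_def)
  have "sq_integral f = ennreal (a\<^sup>2) * sq_integral g"
    unfolding sq_integral_def f_def
    by (simp add: norm_mult power_mult_distrib ennreal_mult' nn_integral_cmult)
  also have "\<dots> = 1"
    using S by (simp add: a2 ennreal_mult'[symmetric])
  finally have norm: "L2_norm lborel f = 1" by (rule L2_norm_eq_1)
  have ff: "fourier f \<xi> = of_real a * fourier g \<xi>" for \<xi>
    unfolding fourier_char f_def by (simp add: mult.left_commute[of _ "of_real a"])
  have "(\<integral>\<^sup>+\<xi>. ennreal ((norm (fourier f \<xi>))\<^sup>2) \<partial>restrict_space hausdorff1 \<Gamma>) = ennreal (a\<^sup>2) * trace_sq \<Gamma> g"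
    unfolding trace_sq_def ff using norm_fourier_measurable_curve[of g \<Gamma>]
    by (simp add: norm_mult power_mult_distrib ennreal_mult' nn_integral_cmult)
  also have "\<dots> \<le> ennreal (a\<^sup>2) * ennreal T"
    by (intro mult_left_mono T) simp
  also have "\<dots> = ennreal ((sqrt (T / S))\<^sup>2)"
    using S T by (simp add: a2 ennreal_mult'[symmetric])
  finally have tr: "L2_norm (restrict_space hausdorff1 \<Gamma>) (fourier f) \<le> ennreal (sqrt (T / S))"
    using S T by (intro L2_norm_le) auto
  have "stability_margin \<Gamma> (sparse_haar N J) \<le> L2_norm (restrict_space hausdorff1 \<Gamma>) (fourier f)"
    unfolding stability_margin_def using mem norm by (intro INF_lower) auto
  with tr show ?thesis by (rule order_trans[rotated])
qed

lemma emeasure_cell_square: "emeasure lborel cell_square = 1"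
proof (rule antisym)
  have m: "cell_square \<in> sets borel"
    unfolding cell_square_def by measurable
  have "emeasure lborel cell_square \<le> emeasure lborel half_square"
    using m by (intro emeasure_mono cell_subset_half_square) auto
  then show "emeasure lborel cell_square \<le> 1" by (simp add: emeasure_half_square)
  let ?B = "box (vector [-1/2,-1/2]) (vector [1/2,1/2]) :: (real^2) set"
  have "emeasure lborel ?B = 1"
    by (subst emeasure_lborel_box) (auto simp: Basis_real2 inner_axis axis_1_neq_2)
  moreover have "emeasure lborel ?B \<le> emeasure lborel cell_square"
    using m by (intro emeasure_mono) (auto simp: cell_square_def mem_box_cart forall_2)
  ultimately show "1 \<le> emeasure lborel cell_square" by simp
qed

text \<open>The wavelet of level 0 with \<open>e = (1, 0)\<close> has modulus 1 on the half-open
  square and hence norm 1, so the trace inequality bounds its trace directly.\<close>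

lemma stability_margin_le_trace_const:
  assumes \<Gamma>: "is_curve \<eta> \<Gamma>" and \<eta>: "7/10 < \<eta>" "\<eta> < 3/2" and "1 \<le> N" "0 \<le> J"
  shows "stability_margin \<Gamma> (sparse_haar N J) \<le> ennreal (sqrt trace_const)"
proof -
  define i :: haar_index where "i = (0, (0, 0), (1, 0))"
  define f where "f x = complex_of_real (haar i x)" for x
  have mem: "f \<in> sparse_haar N J"
    unfolding sparse_haar_def mem_Collect_eq using assms
    by (intro exI[of _ "{i}"] exI[of _ "\<lambda>_. 1"]) (auto simp: f_def[abs_def] i_def haar_indices_def)
  have norm_f: "norm (f x) = indicator cell_square x" for x
    unfolding f_def i_def haar_power
    by (auto simp: haar1_def cell_square_def indicator_def)
  have "f \<in> borel_measurable borel"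
    unfolding f_def[abs_def] i_def haar_power haar1_def by measurable
  moreover have "f x = 0" if "x \<notin> half_square" for x
  proof -
    have "norm (f x) = 0" unfolding norm_f using that cell_subset_half_square by (auto simp: indicator_def)
    then show ?thesis by simp
  qed
  ultimately have bdd: "bdd_on_square f"
    unfolding bdd_on_square_def by (auto intro!: exI[of _ 1] simp: norm_f indicator_def)
  have m: "cell_square \<in> sets borel"
    unfolding cell_square_def by measurable
  have "sq_integral f = (\<integral>\<^sup>+x. indicator cell_square x \<partial>lborel)"
    unfolding sq_integral_def norm_f by (intro nn_integral_cong) (auto simp: indicator_def)
  then have sq: "sq_integral f = 1"
    using m by (simp add: emeasure_cell_square)
  have "trace_sq \<Gamma> f \<le> ennreal ((sqrt trace_const)\<^sup>2)"
    using curve_trace_inequality[OF \<Gamma> \<eta> bdd] trace_const_pos by (simp add: sq)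
  then have tr: "L2_norm (restrict_space hausdorff1 \<Gamma>) (fourier f) \<le> ennreal (sqrt trace_const)"
    unfolding trace_sq_def using trace_const_pos by (intro L2_norm_le) auto
  have "stability_margin \<Gamma> (sparse_haar N J) \<le> L2_norm (restrict_space hausdorff1 \<Gamma>) (fourier f)"
    unfolding stability_margin_def using mem L2_norm_eq_1[OF sq] by (intro INF_lower) auto
  with tr show ?thesis by (rule order_trans[rotated])
qed

lemma pitch_bounds:
  assumes "0 < \<epsilon>" "\<epsilon> < 1" "\<eta> = (1 + \<epsilon>) * (sqrt 2 / 2)"
  shows "7/10 < \<eta>" "\<eta> < 3/2"
proof -
  have "7/5 < sqrt 2"
    by (rule real_less_rsqrt) (simp add: power2_eq_square)
  moreover have "sqrt 2 < 3/2"
    by (rule real_less_lsqrt) (simp_all add: power2_eq_square)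
  moreover have "1 * (sqrt 2 / 2) < \<eta>" "\<eta> < 2 * (sqrt 2 / 2)"
    unfolding assms(3) using assms(1,2) by (intro mult_strict_right_mono; simp)+
  ultimately show "7/10 < \<eta>" "\<eta> < 3/2" by auto
qed

text \<open>\<open>M\<close> stands for \<open>N powr (1 / 6)\<close>, so \<open>M ^ 3\<close> for
  \<open>sqrt N\<close>. With \<open>w = \<epsilon> / 4\<close> and
  \<open>R = M / \<epsilon>\<close> the trace of \<open>f\<close> is \<open>O(q * w)\<close>, and so
  is the error of its Haar approximant \<open>g\<close>, while the norm of \<open>f\<close> is at
  least of order \<open>w\<close>. Smallness of \<open>q\<close> lets \<open>g\<close> inherit this
  lower bound.\<close>

lemma stability_margin_small:
  fixes \<epsilon> M \<eta> :: real and N n :: nat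
  assumes \<epsilon>: "0 < \<epsilon>" "\<epsilon> < 1" and \<eta>: "\<eta> = (1 + \<epsilon>) * (sqrt 2 / 2)" and \<Gamma>: "is_curve \<eta> \<Gamma>"
    and M: "1 \<le> M" and n: "4 ^ n \<le> N" "M ^ 3 \<le> 2 * 2 ^ n" "\<And>j. j < n \<Longrightarrow> real j \<le> J"
    and q: "1 / (M * \<epsilon>) \<le> 1 / 10000"
  shows "stability_margin \<Gamma> (sparse_haar N J) \<le> ennreal (300000 * sqrt trace_const * (1 / (M * \<epsilon>)))"
proof -
  define q where "q = 1 / (M * \<epsilon>)"
  define w where "w = \<epsilon> / 4"
  define \<alpha> where "\<alpha> = 1 / (2 * (1 + \<epsilon>))"
  define R where "R = M / \<epsilon>"
  define L where "L = 8 / w + 10 * R"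
  define \<beta> where "\<beta> = curve_phase \<eta> \<Gamma>"
  define f where "f = wave_pair w \<alpha> R \<beta>"
  note \<eta>b = pitch_bounds[OF \<epsilon> \<eta>]
  have w: "0 < w" "w \<le> 1/4" using \<epsilon> by (auto simp: w_def)
  have R: "0 < R" using \<epsilon> M by (simp add: R_def)
  have \<alpha>1: "1/4 \<le> \<alpha>" using \<epsilon> by (simp add: \<alpha>_def field_simps)
  \<comment> \<open>The bumps must fit into the square: the gap
    \<open>1/2 - \<alpha> = \<epsilon> / (2 * (1 + \<epsilon>))\<close> is at least
    \<open>\<epsilon> / 4 = w\<close> because \<open>\<epsilon> < 1\<close>.\<close>
  have \<alpha>2: "\<alpha> + w \<le> 1/2"
  proof -
    have "\<epsilon> * \<epsilon> \<le> \<epsilon>" using \<epsilon> by (simp add: mult_left_le)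
    then show ?thesis using \<epsilon> by (simp add: \<alpha>_def w_def field_simps)
  qed
  have \<alpha>\<eta>: "\<alpha> = 1 / (2 * sqrt 2 * \<eta>)"
    using \<epsilon> by (simp add: \<alpha>_def \<eta> field_simps)
  note wf = w \<alpha>1 \<alpha>2 R
  have q_pos: "0 < q" "q \<le> 1 / 10000" using q \<epsilon> M by (auto simp: q_def)
  have f: "bdd_on_square f" unfolding f_def by (rule bdd_on_square_wave_pair[OF wf])
  have "0 \<le> L" using w R by (simp add: L_def)
  obtain g where g: "g \<in> haar_span n" "bdd_on_square g"
    and gf: "\<And>x. norm (g x - f x) \<le> 4 * L / 2 ^ n + norm (fourier f 0)"
    using haar_approximation[OF f _ \<open>0 \<le> L\<close>, of n] wave_pair_outside[OF wf, of _ \<beta>] wave_pair_lipschitz[OF wf, of \<beta>]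
    unfolding f_def L_def open_square_def by auto
  have close: "norm (g x - f x) \<le> 1352 * q * w" for x
  proof -
    have "32 / \<epsilon> \<le> 32 * M / \<epsilon>"
      using M \<epsilon> by (intro divide_right_mono) auto
    then have L: "L \<le> 42 * M / \<epsilon>"
      using \<epsilon> by (simp add: L_def w_def R_def)
    have "1 / 2 ^ n \<le> 2 / M ^ 3"
      using n(2) M by (simp add: field_simps)
    then have "4 * L * (1 / 2 ^ n) \<le> 4 * (42 * M / \<epsilon>) * (2 / M ^ 3)"
      using L \<open>0 \<le> L\<close> by (intro mult_mono) auto
    \<comment> \<open>\<open>1 / M\<close> equals \<open>4 * q * w\<close>, so a second factor
      \<open>q\<close> appears; it is estimated by 1 below.\<close>
    also have "\<dots> = 336 * q * (1 / M)"
      using M \<epsilon> by (simp add: q_def power3_eq_cube field_simps)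
    also have "\<dots> = 1344 * q * q * w"
      using M \<epsilon> by (simp add: q_def w_def field_simps)
    also have "\<dots> \<le> 1344 * q * 1 * w"
      using q_pos w by (intro mult_mono) auto
    finally have 1: "4 * L / 2 ^ n \<le> 1344 * q * w" by simp
    have "norm (fourier f 0) \<le> 8 * w / R"
      unfolding f_def by (rule norm_fourier_wave_pair_zero[OF wf])
    also have "\<dots> = 8 * w * (\<epsilon> * \<epsilon> * q)"
      using M \<epsilon> by (simp add: R_def q_def)
    also have "\<dots> \<le> 8 * w * (1 * 1 * q)"
      using \<epsilon> q_pos w by (intro mult_left_mono mult_right_mono mult_mono) auto
    finally show ?thesis
      using 1 gf[of x] by (simp add: mult_ac)
  qed
  define D where "D = (1352 * q * w)\<^sup>2"
  have D: "D \<le> 1/50 * w\<^sup>2" "D \<le> 2000000 * q\<^sup>2 * w\<^sup>2" "0 \<le> D"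
  proof -
    have "q\<^sup>2 \<le> (1/10000)\<^sup>2" using q_pos by (intro power_mono) auto
    then have "1352\<^sup>2 * q\<^sup>2 \<le> 1/50" by (simp add: power2_eq_square)
    then have "1352\<^sup>2 * q\<^sup>2 * w\<^sup>2 \<le> 1/50 * w\<^sup>2" by (intro mult_right_mono) auto
    then show "D \<le> 1/50 * w\<^sup>2" by (simp add: D_def power_mult_distrib)
    show "D \<le> 2000000 * q\<^sup>2 * w\<^sup>2" by (simp add: D_def power_mult_distrib mult_right_mono)
  qed (simp add: D_def)
  have diff: "sq_integral (\<lambda>x. g x - f x) \<le> ennreal D" "sq_integral (\<lambda>x. f x - g x) \<le> ennreal D"
  proof -
    have "sq_integral (\<lambda>x. g x - f x) \<le> ennreal ((1352 * q * w)\<^sup>2) * emeasure lborel half_square"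
      using close f g by (intro sq_integral_le) (auto simp: bdd_on_square_def)
    then show "sq_integral (\<lambda>x. g x - f x) \<le> ennreal D" by (simp add: D_def emeasure_half_square)
    then show "sq_integral (\<lambda>x. f x - g x) \<le> ennreal D" by (simp add: sq_integral_def norm_minus_commute)
  qed
  obtain B where B: "\<And>x. norm (g x) \<le> B" using g by (auto simp: bdd_on_square_def)
  have "sq_integral g \<le> ennreal (B\<^sup>2) * emeasure lborel half_square"
    using B g by (intro sq_integral_le) (auto simp: bdd_on_square_def)
  then have fin: "sq_integral g \<noteq> top" by (auto simp: emeasure_half_square top_unique)
  define S where "S = enn2real (sq_integral g)"
  have S: "sq_integral g = ennreal S" "0 \<le> S" using fin by (auto simp: S_def ennreal_enn2real_if)
  have two: "2 * ennreal x + 2 * ennreal y = ennreal (2 * x + 2 * y)" if "0 \<le> x" "0 \<le> y" for x y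
    using that by (simp add: ennreal_plus ennreal_mult')
  have "ennreal (9/100 * w\<^sup>2) \<le> sq_integral f"
    unfolding f_def by (rule sq_integral_wave_pair_ge[OF wf])
  also have "\<dots> \<le> 2 * sq_integral g + 2 * sq_integral (\<lambda>x. f x - g x)"
    by (rule sq_integral_triangle[OF f g(2)])
  also have "\<dots> \<le> 2 * ennreal S + 2 * ennreal D"
    unfolding S by (intro add_left_mono mult_left_mono diff) auto
  also have "\<dots> = ennreal (2 * S + 2 * D)"
    using S D by (intro two)
  finally have "9/100 * w\<^sup>2 \<le> 2 * S + 2 * D"
    using S D by (subst (asm) ennreal_le_iff) auto
  \<comment> \<open>The error takes away 2/50 of 9/100, and half of the remainder still exceeds
    1/50.\<close>
  then have S_ge: "1/50 * w\<^sup>2 \<le> S" using D by simp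
  have "0 < w\<^sup>2" using w by simp
  then have S_pos: "0 < S" using S_ge by linarith
  define T where "T = trace_const * (1600000000 * q\<^sup>2 * w\<^sup>2)"
  have "trace_sq \<Gamma> g \<le> 2 * trace_sq \<Gamma> f + 2 * trace_sq \<Gamma> (\<lambda>x. g x - f x)"
    by (rule trace_sq_triangle[OF g(2) f])
  also have "\<dots> \<le> 2 * ennreal (trace_const * (3000000 / (R\<^sup>2 * w\<^sup>2))) + 2 * (ennreal trace_const * ennreal D)"
  proof (intro add_mono mult_left_mono)
    show "trace_sq \<Gamma> f \<le> ennreal (trace_const * (3000000 / (R\<^sup>2 * w\<^sup>2)))"
      unfolding f_def \<beta>_def by (rule wave_pair_trace[OF \<Gamma> \<eta>b wf \<alpha>\<eta>])
    show "trace_sq \<Gamma> (\<lambda>x. g x - f x) \<le> ennreal trace_const * ennreal D"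
      using curve_trace_inequality[OF \<Gamma> \<eta>b bdd_on_square_diff[OF g(2) f]] mult_left_mono[OF diff(1), of "ennreal trace_const"]
      by (rule order_trans) simp
  qed auto
  also have "\<dots> = ennreal (2 * (trace_const * (3000000 / (R\<^sup>2 * w\<^sup>2))) + 2 * (trace_const * D))"
    unfolding ennreal_mult''[OF D(3), symmetric] using trace_const_pos D by (intro two) auto
  also have "\<dots> \<le> ennreal T"
  proof (rule ennreal_leI)
    \<comment> \<open>\<open>R * w = M / 4\<close> and \<open>1 / M = 4 * q * w\<close>, hence the
      factor \<open>16 * 16\<close>.\<close>
    have "3000000 / (R\<^sup>2 * w\<^sup>2) = 768000000 * q\<^sup>2 * w\<^sup>2"
      using M \<epsilon> by (simp add: R_def w_def q_def power_divide power_mult_distrib)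
    then have "3000000 / (R\<^sup>2 * w\<^sup>2) + D \<le> 800000000 * q\<^sup>2 * w\<^sup>2"
      using D by simp
    then have "trace_const * (3000000 / (R\<^sup>2 * w\<^sup>2) + D) \<le> trace_const * (800000000 * q\<^sup>2 * w\<^sup>2)"
      using trace_const_pos by (intro mult_left_mono) auto
    then show "2 * (trace_const * (3000000 / (R\<^sup>2 * w\<^sup>2))) + 2 * (trace_const * D) \<le> T"
      by (simp add: T_def distrib_left)
  qed
  finally have tr: "trace_sq \<Gamma> g \<le> ennreal T" .
  have T0: "0 \<le> T" using trace_const_pos by (simp add: T_def)
  have "stability_margin \<Gamma> (sparse_haar N J) \<le> ennreal (sqrt (T / S))"
    by (rule stability_margin_le[OF g(2,1) n(1,3) S(1) S_pos tr T0])
  also have "\<dots> \<le> ennreal (300000 * sqrt trace_const * q)"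
  proof (intro ennreal_leI real_le_lsqrt)
    have "T / S \<le> T / (1/50 * w\<^sup>2)"
      using S_ge S_pos T0 w by (intro divide_left_mono) auto
    also have "\<dots> = trace_const * (80000000000 * q\<^sup>2)"
      using w by (simp add: T_def)
    also have "\<dots> \<le> trace_const * (300000\<^sup>2 * q\<^sup>2)"
      using trace_const_pos by (intro mult_left_mono mult_right_mono) auto
    also have "\<dots> = (300000 * sqrt trace_const * q)\<^sup>2"
      using trace_const_pos by (simp add: power_mult_distrib)
    finally show "T / S \<le> (300000 * sqrt trace_const * q)\<^sup>2" .
  qed (use trace_const_pos q_pos T0 S_pos in auto)
  finally show ?thesis by (simp add: q_def)
qed

theorem theoremC:
  shows "\<exists>C::real. C > 0 \<and>
    (\<forall>(\<epsilon>::real) (\<eta>::real) (\<Gamma>::(real^2) set) (N::nat) (J::real).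
       0 < \<epsilon> \<longrightarrow> \<epsilon> < 1 \<longrightarrow> \<eta> = (1 + \<epsilon>) * (sqrt 2 / 2) \<longrightarrow>
       (\<Gamma> = spiral \<eta> \<or> \<Gamma> = concentric_circles \<eta>) \<longrightarrow>
       N \<ge> 1 \<longrightarrow> J = C * ln (inverse \<epsilon> * real N) \<longrightarrow>
       stability_margin \<Gamma> (sparse_haar N J)
         \<le> ennreal (C * real N powr (- 1 / 6) * inverse \<epsilon> * ln (C * real N) ^ 4))"
proof -
  \<comment> \<open>The summand 3 exceeds \<open>exp 1\<close>, so \<open>ln (C * N)\<close> and its
    fourth power are at least 1; moreover \<open>C \<ge> 1\<close> gives
    \<open>J \<ge> ln N\<close>.\<close>
  define C where "C = 300000 * sqrt trace_const + 3"
  have C: "300000 * sqrt trace_const \<le> C" "3 \<le> C" "0 < C"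
    using trace_const_pos by (auto simp: C_def add_pos_pos)
  have "stability_margin \<Gamma> (sparse_haar N J) \<le> ennreal (C * real N powr (- 1 / 6) * inverse \<epsilon> * ln (C * real N) ^ 4)"
    if \<epsilon>: "0 < \<epsilon>" "\<epsilon> < 1" and \<eta>: "\<eta> = (1 + \<epsilon>) * (sqrt 2 / 2)" and \<Gamma>: "\<Gamma> = spiral \<eta> \<or> \<Gamma> = concentric_circles \<eta>"
      and N: "N \<ge> 1" and J: "J = C * ln (inverse \<epsilon> * real N)"
    for \<epsilon> \<eta> J :: real and \<Gamma> :: "(real^2) set" and N :: nat
  proof -
    have curve: "is_curve \<eta> \<Gamma>" using \<Gamma> by (simp add: is_curve_def)
    define M where "M = real N powr (1 / 6)"
    have M: "1 \<le> M" using N by (simp add: M_def ge_one_powr_ge_zero)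
    define q where "q = 1 / (M * \<epsilon>)"
    have q_pos: "0 < q" using M \<epsilon> by (simp add: q_def)
    have q_eq: "real N powr (- 1 / 6) * inverse \<epsilon> = q"
      using N \<epsilon> by (simp add: q_def M_def powr_minus_divide field_simps)
    have lnN: "0 \<le> ln (real N)" using N by simp
    have "1 \<le> inverse \<epsilon>" using \<epsilon> by (simp add: one_le_inverse)
    then have "real N \<le> inverse \<epsilon> * real N" using N by (simp add: mult_le_cancel_right2)
    then have "ln (real N) \<le> ln (inverse \<epsilon> * real N)" using N by (intro ln_mono) auto
    also have "\<dots> \<le> J" unfolding J using C lnN calculation by (simp add: mult_le_cancel_right1)
    finally have J_ge: "ln (real N) \<le> J" .
    have "exp 1 \<le> C * real N"
    proof -
      have "C * 1 \<le> C * real N" using C N by (intro mult_left_mono) auto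
      then show ?thesis using exp_le C by linarith
    qed
    then have "1 \<le> ln (C * real N)" using C N by (subst ln_ge_iff) auto
    then have log: "1 \<le> ln (C * real N) ^ 4" by (rule one_le_power)
    have margin: "stability_margin \<Gamma> (sparse_haar N J) \<le> ennreal (300000 * sqrt trace_const * q)"
    proof (cases "q \<le> 1 / 10000")
      case True
      \<comment> \<open>The lower bound pays for all levels below \<open>n\<close>; the upper bound
        becomes \<open>M ^ 3 = sqrt N \<le> 2 * 2 ^ n\<close>.\<close>
      obtain n where n: "4 ^ n \<le> N" "N < 4 ^ (n + 1)"
        using ex_power_ivl1[of 4 N] N by auto
      have M6: "M ^ 6 = real N"
        using N by (simp add: M_def powr_power)
      have "(M ^ 3)\<^sup>2 \<le> (2 * 2 ^ n)\<^sup>2"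
      proof -
        have "(M ^ 3)\<^sup>2 = real N" by (simp add: M6[symmetric] power_mult[symmetric])
        also have "\<dots> \<le> real (4 ^ (n + 1))" using n(2) by linarith
        also have "\<dots> = (2 * 2 ^ n)\<^sup>2"
          by (simp add: power_mult_distrib power2_eq_square) (simp add: power_mult_distrib[symmetric])
        finally show ?thesis .
      qed
      then have M3: "M ^ 3 \<le> 2 * 2 ^ n"
        by (rule power2_le_imp_le) simp
      have "real j \<le> J" if "j < n" for j
      proof -
        \<comment> \<open>Since \<open>exp 1 \<le> 4\<close>, all levels used are below
          \<open>n \<le> ln N \<le> J\<close>.\<close>
        have "exp (real n) \<le> 4 ^ n"
        proof -
          have "exp (real n) = exp 1 ^ n" by (simp add: exp_of_nat_mult[symmetric])
          also have "\<dots> \<le> 4 ^ n" using exp_le by (intro power_mono) auto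
          finally show ?thesis .
        qed
        also have "\<dots> = real (4 ^ n)" by simp
        also have "\<dots> \<le> real N" using n(1) by linarith
        finally have "real n \<le> ln (real N)" using N by (subst ln_ge_iff) auto
        then show ?thesis using that J_ge by linarith
      qed
      from stability_margin_small[OF \<epsilon> \<eta> curve M n(1) M3 this] True show ?thesis
        by (simp add: q_def)
    next
      case False
      have "stability_margin \<Gamma> (sparse_haar N J) \<le> ennreal (sqrt trace_const)"
        using N order_trans[OF lnN J_ge] by (intro stability_margin_le_trace_const[OF curve pitch_bounds[OF \<epsilon> \<eta>]]) auto
      also have "\<dots> \<le> ennreal (300000 * sqrt trace_const * q)"
      proof (rule ennreal_leI)
        have "1 \<le> 300000 * q" using False by simp
        then have "sqrt trace_const * 1 \<le> sqrt trace_const * (300000 * q)"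
          using trace_const_pos by (intro mult_left_mono) auto
        then show "sqrt trace_const \<le> 300000 * sqrt trace_const * q" by (simp add: mult_ac)
      qed
      finally show ?thesis .
    qed
    also have "\<dots> \<le> ennreal (C * real N powr (- 1 / 6) * inverse \<epsilon> * ln (C * real N) ^ 4)"
    proof (rule ennreal_leI)
      have "300000 * sqrt trace_const * q * 1 \<le> C * q * ln (C * real N) ^ 4"
        using C q_pos log trace_const_pos by (intro mult_mono) auto
      then show "300000 * sqrt trace_const * q \<le> C * real N powr (- 1 / 6) * inverse \<epsilon> * ln (C * real N) ^ 4"
        by (simp add: q_eq[symmetric] mult.assoc)
    qed
    finally show ?thesis .
  qed
  then show ?thesis
    using C(3) by (intro exI[of _ C]) blast
qed

end
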